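(* Let $A$ be a complex vector space equipped with a positive bivector $\pi_A\in\wedge^2A$. An action of $A$ on a complex manifold $M$ by holomorphic transformations induces an $A$-invariant Poisson structure $\pi_M$ on $M$, namely $\pi_M:=\wedge^2\rho(\pi_A)$ where $\rho$ is the infinitesimal action, with the property that, for every complex subspace $B\subset A$, the induced action $(B,0)\curvearrowright(M,\pi_M)$ is Poisson and has coregular Poisson-Dirac submanifolds as orbits.
   Context: The vector space $A$ acts as an additive Lie group. For an action $\alpha:A\times M\to M$, the infinitesimal action is $\rho:A\to\mathfrak X(M)$, $\rho(v)_x=\frac{d}{dt}\alpha(-tv,x)|_{t=0}$, extended to $\wedge^2\rho:\wedge^2A\to\mathfrak X^2(M)$ (here $\wedge^2A$ is the exterior square of $A$ as a real vector space). $(B,0)$ denotes the abelian group $B$ with the zero Poisson structure; an action of a Poisson-Lie group $(G,\pi_G)$ on $(M,\pi_M)$ is Poisson if the action map $(G,\pi_G)\times(M,\pi_M)\to(M,\pi_M)$ is a Poisson map. Positive bivector: let $J$ be the complex structure of $A$. A bivector $\pi_A\in\wedge^2A$ is positive if $J$ makes the symplectic leaves of $\pi_A$ into Kähler manifolds; explicitly, if $S:=\pi_A^\sharp(A^* )$ is a complex subspace, $J:(S,\omega_S)\to(S,\omega_S)$ is a symplectic automorphism, where $\omega_S$ is the symplectic form on $S$ determined by $\pi_A$ (sign normalized so that $\frac{\partial}{\partial x}\wedge\frac{\partial}{\partial y}$ on $\mathbb C$ is positive), and $g_S(u,v):=\omega_S(u,Jv)$ is symmetric and positive-definite. For a Poisson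 manifold $(M,\pi_M)$, $\pi_M^\sharp:T^*M\to TM$ is contraction with $\pi_M$, and $N^*X\subset T^*M|_X$ is the annihilator of $TX$. A submanifold $X$ (for orbits: injectively immersed) is a coregular Poisson-Dirac submanifold if $\pi_M^\sharp(N^*X)$ is a vector subbundle of $TM|_X$ which meets $TX$ trivially.
   Formalization: The action map A×M→M is assumed holomorphic, not merely each transformation of M; with only the latter, the claim fails for translations of C² along a real-linear map with non-complex kernel. *)

theory Defs
  imports "HOL-Analysis.Analysis"
begin

section \<open>Smooth maps between Euclidean spaces\<close>

primrec Ck_on :: "nat \<Rightarrow> ('a::euclidean_space \<Rightarrow> 'b::real_normed_vector) \<Rightarrow> 'a set \<Rightarrow> bool" where
  "Ck_on 0 = (\<lambda>f U. continuous_on U f)"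
| "Ck_on (Suc k) = (\<lambda>f U. (\<forall>x\<in>U. f differentiable (at x)) \<and>
     (\<forall>v. Ck_on k (\<lambda>x. frechet_derivative f (at x) v) U))"

text \<open>Smoothness on an arbitrary set is local extendability to a smooth function on an open
  set. It is used for relatively open subsets of linear subspaces, where it agrees with
  smoothness in linear coordinates of the subspace.\<close>

definition smooth_on :: "'a::euclidean_space set \<Rightarrow> ('a \<Rightarrow> 'b::real_normed_vector) \<Rightarrow> bool" where
  "smooth_on S f \<longleftrightarrow> (\<forall>x\<in>S. \<exists>U g. open U \<and> x \<in> U \<and> (\<forall>k. Ck_on k g U) \<and> (\<forall>y\<in>S \<inter> U. g y = f y))"

section \<open>Manifolds\<close>

text \<open>Charts take values in a linear subspace \<open>mmodel\<close> of a Euclidean space, so that manifolds of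
  varying dimension (such as orbits) and linear subspaces can be treated without changing
  the type. A chart is given by its domain and its coordinate map.\<close>

record ('m, 'e) mfd =
  mtop :: "'m topology"
  mmodel :: "'e set"
  matlas :: "('m set \<times> ('m \<Rightarrow> 'e)) set"

abbreviation pts :: "('m, 'e) mfd \<Rightarrow> 'm set" where
  "pts M \<equiv> topspace (mtop M)"

definition smooth_manifold :: "('m, 'e::euclidean_space) mfd \<Rightarrow> bool" where
  "smooth_manifold M \<longleftrightarrow>
     subspace (mmodel M) \<and> Hausdorff_space (mtop M) \<and> second_countable (mtop M) \<and>
     (\<Union>(U, \<phi>)\<in>matlas M. U) = pts M \<and>
     (\<forall>(U, \<phi>)\<in>matlas M. openin (mtop M) U \<and> openin (top_of_set (mmodel M)) (\<phi> ` U) \<and>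
        homeomorphic_map (subtopology (mtop M) U) (top_of_set (\<phi> ` U)) \<phi>) \<and>
     (\<forall>(U, \<phi>)\<in>matlas M. \<forall>(V, \<psi>)\<in>matlas M. smooth_on (\<phi> ` (U \<inter> V)) (\<psi> \<circ> inv_into U \<phi>))"

definition smooth_map ::
    "('m, 'e::euclidean_space) mfd \<Rightarrow> ('n, 'f::euclidean_space) mfd \<Rightarrow> ('m \<Rightarrow> 'n) \<Rightarrow> bool" where
  "smooth_map M N F \<longleftrightarrow> continuous_map (mtop M) (mtop N) F \<and>
     (\<forall>(U, \<phi>)\<in>matlas M. \<forall>(V, \<psi>)\<in>matlas N.
        smooth_on (\<phi> ` (U \<inter> F -` V)) (\<psi> \<circ> F \<circ> inv_into U \<phi>))"

definition smooth_fun :: "('m, 'e::euclidean_space) mfd \<Rightarrow> 'm set \<Rightarrow> ('m \<Rightarrow> real) \<Rightarrow> bool" where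
  "smooth_fun M W f \<longleftrightarrow> openin (mtop M) W \<and>
     (\<forall>(U, \<phi>)\<in>matlas M. smooth_on (\<phi> ` (U \<inter> W)) (f \<circ> inv_into U \<phi>))"

definition smooth_at :: "('m, 'e::euclidean_space) mfd \<Rightarrow> 'm \<Rightarrow> ('m \<Rightarrow> real) \<Rightarrow> bool" where
  "smooth_at M p f \<longleftrightarrow> (\<exists>W. p \<in> W \<and> smooth_fun M W f)"

definition subspace_mfd :: "'a::euclidean_space set \<Rightarrow> ('a, 'a) mfd" where
  "subspace_mfd B = \<lparr> mtop = top_of_set B, mmodel = B, matlas = {(B, id)} \<rparr>"

definition prod_mfd ::
    "('m, 'e::euclidean_space) mfd \<Rightarrow> ('n, 'f::euclidean_space) mfd \<Rightarrow> ('m \<times> 'n, 'e \<times> 'f) mfd" where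
  "prod_mfd M N = \<lparr> mtop = prod_topology (mtop M) (mtop N), mmodel = mmodel M \<times> mmodel N,
     matlas = {(U \<times> V, map_prod \<phi> \<psi>) | U \<phi> V \<psi>. (U, \<phi>) \<in> matlas M \<and> (V, \<psi>) \<in> matlas N} \<rparr>"

section \<open>Tangent and cotangent vectors\<close>

text \<open>A tangent vector at \<open>p\<close> is the velocity of a smooth curve through \<open>p\<close>, regarded as a
  derivation on germs of smooth functions at \<open>p\<close>; it is set to 0 on functions that are not
  smooth at \<open>p\<close>, so that equality of tangent vectors is equality of operators. Linear
  operations are pointwise. Curves may be taken to be defined on the whole real line, since
  only their germ at 0 matters and they can be reparametrized.\<close>

type_synonym 'm tvec = "('m \<Rightarrow> real) \<Rightarrow> real"

definition velocity :: "('m, 'e::euclidean_space) mfd \<Rightarrow> (real \<Rightarrow> 'm) \<Rightarrow> 'm tvec" where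
  "velocity M \<gamma> = (\<lambda>f. if smooth_at M (\<gamma> 0) f then deriv (\<lambda>t. f (\<gamma> t)) 0 else 0)"

definition tangent :: "('m, 'e::euclidean_space) mfd \<Rightarrow> 'm \<Rightarrow> 'm tvec set" where
  "tangent M p = {velocity M \<gamma> | \<gamma>. smooth_map (subspace_mfd UNIV) M \<gamma> \<and> \<gamma> 0 = p}"

definition push ::
    "('m, 'e::euclidean_space) mfd \<Rightarrow> ('n, 'f::euclidean_space) mfd \<Rightarrow> ('m \<Rightarrow> 'n) \<Rightarrow> 'm \<Rightarrow> 'm tvec \<Rightarrow> 'n tvec" where
  "push M N F p X = (\<lambda>f. if smooth_at N (F p) f then X (f \<circ> F) else 0)"

text \<open>Cotangent vectors are the linear functionals on the tangent space, set to 0 outside of it.\<close>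

type_synonym 'm cvec = "'m tvec \<Rightarrow> real"

definition cotangent :: "('m, 'e::euclidean_space) mfd \<Rightarrow> 'm \<Rightarrow> 'm cvec set" where
  "cotangent M p = {\<xi>.
     (\<forall>X\<in>tangent M p. \<forall>Y\<in>tangent M p. \<forall>a b. \<xi> (\<lambda>f. a * X f + b * Y f) = a * \<xi> X + b * \<xi> Y) \<and>
     (\<forall>X. X \<notin> tangent M p \<longrightarrow> \<xi> X = 0)}"

definition differential :: "('m, 'e::euclidean_space) mfd \<Rightarrow> 'm \<Rightarrow> ('m \<Rightarrow> real) \<Rightarrow> 'm cvec" where
  "differential M p f = (\<lambda>X. if X \<in> tangent M p then X f else 0)"

definition pull ::
    "('m, 'e::euclidean_space) mfd \<Rightarrow> ('n, 'f::euclidean_space) mfd \<Rightarrow> ('m \<Rightarrow> 'n) \<Rightarrow> 'm \<Rightarrow> 'n cvec \<Rightarrow> 'm cvec" where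
  "pull M N F p \<xi> = (\<lambda>X. if X \<in> tangent M p then \<xi> (push M N F p X) else 0)"

section \<open>Poisson structures\<close>

text \<open>An element of the exterior square of a finite-dimensional real vector space is represented
  as an alternating bilinear form on the dual space: \<open>u \<and> v\<close> is the form
  \<open>(\<xi>, \<eta>) \<mapsto> \<xi>(u) \<eta>(v) - \<xi>(v) \<eta>(u)\<close>. A linear map acts on bivectors by
  \<open>P \<mapsto> P(L\<^sup>* \<xi>, L\<^sup>* \<eta>)\<close>, and \<open>P\<^sup>\<sharp> \<xi>\<close> is the vector representing \<open>P(\<xi>, -)\<close>.\<close>

type_synonym 'm bivec = "'m cvec \<Rightarrow> 'm cvec \<Rightarrow> real"

definition bivector_at :: "('m, 'e::euclidean_space) mfd \<Rightarrow> 'm \<Rightarrow> 'm bivec \<Rightarrow> bool" where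
  "bivector_at M p P \<longleftrightarrow>
     (\<forall>\<xi>\<in>cotangent M p. \<forall>\<eta>\<in>cotangent M p. \<forall>\<zeta>\<in>cotangent M p. \<forall>a b.
        P (\<lambda>X. a * \<xi> X + b * \<eta> X) \<zeta> = a * P \<xi> \<zeta> + b * P \<eta> \<zeta> \<and>
        P \<zeta> (\<lambda>X. a * \<xi> X + b * \<eta> X) = a * P \<zeta> \<xi> + b * P \<zeta> \<eta>) \<and>
     (\<forall>\<xi>\<in>cotangent M p. P \<xi> \<xi> = 0)"

definition bracket ::
    "('m, 'e::euclidean_space) mfd \<Rightarrow> ('m \<Rightarrow> 'm bivec) \<Rightarrow> ('m \<Rightarrow> real) \<Rightarrow> ('m \<Rightarrow> real) \<Rightarrow> 'm \<Rightarrow> real" where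
  "bracket M \<pi> f g p = \<pi> p (differential M p f) (differential M p g)"

definition bivector_field :: "('m, 'e::euclidean_space) mfd \<Rightarrow> ('m \<Rightarrow> 'm bivec) \<Rightarrow> bool" where
  "bivector_field M \<pi> \<longleftrightarrow> (\<forall>p\<in>pts M. bivector_at M p (\<pi> p)) \<and>
     (\<forall>W f g. smooth_fun M W f \<and> smooth_fun M W g \<longrightarrow> smooth_fun M W (bracket M \<pi> f g))"

definition poisson_structure :: "('m, 'e::euclidean_space) mfd \<Rightarrow> ('m \<Rightarrow> 'm bivec) \<Rightarrow> bool" where
  "poisson_structure M \<pi> \<longleftrightarrow> bivector_field M \<pi> \<and>
     (\<forall>f g h. smooth_fun M (pts M) f \<and> smooth_fun M (pts M) g \<and> smooth_fun M (pts M) h \<longrightarrow>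
        (\<forall>p\<in>pts M. bracket M \<pi> f (bracket M \<pi> g h) p + bracket M \<pi> g (bracket M \<pi> h f) p
                 + bracket M \<pi> h (bracket M \<pi> f g) p = 0))"

definition bivectors_related ::
    "('m, 'e::euclidean_space) mfd \<Rightarrow> ('m \<Rightarrow> 'm bivec) \<Rightarrow> ('n, 'f::euclidean_space) mfd \<Rightarrow> ('n \<Rightarrow> 'n bivec)
      \<Rightarrow> ('m \<Rightarrow> 'n) \<Rightarrow> bool" where
  "bivectors_related M \<pi> N \<sigma> F \<longleftrightarrow> (\<forall>p\<in>pts M. \<forall>\<xi>\<in>cotangent N (F p). \<forall>\<eta>\<in>cotangent N (F p).
     \<pi> p (pull M N F p \<xi>) (pull M N F p \<eta>) = \<sigma> (F p) \<xi> \<eta>)"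

definition poisson_map ::
    "('m, 'e::euclidean_space) mfd \<Rightarrow> ('m \<Rightarrow> 'm bivec) \<Rightarrow> ('n, 'f::euclidean_space) mfd \<Rightarrow> ('n \<Rightarrow> 'n bivec)
      \<Rightarrow> ('m \<Rightarrow> 'n) \<Rightarrow> bool" where
  "poisson_map M \<pi> N \<sigma> F \<longleftrightarrow> smooth_map M N F \<and> bivectors_related M \<pi> N \<sigma> F"

text \<open>The sum of the images of the two bivectors under the slice inclusions through \<open>(p, q)\<close>.\<close>

definition prod_bivector ::
    "('m, 'e::euclidean_space) mfd \<Rightarrow> ('m \<Rightarrow> 'm bivec) \<Rightarrow> ('n, 'f::euclidean_space) mfd \<Rightarrow> ('n \<Rightarrow> 'n bivec)
      \<Rightarrow> 'm \<times> 'n \<Rightarrow> ('m \<times> 'n) bivec" where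
  "prod_bivector M \<pi> N \<sigma> = (\<lambda>(p, q) \<xi> \<eta>.
     \<pi> p (pull M (prod_mfd M N) (\<lambda>p'. (p', q)) p \<xi>) (pull M (prod_mfd M N) (\<lambda>p'. (p', q)) p \<eta>) +
     \<sigma> q (pull N (prod_mfd M N) (\<lambda>q'. (p, q')) q \<xi>) (pull N (prod_mfd M N) (\<lambda>q'. (p, q')) q \<eta>))"

definition zero_bivector :: "'m \<Rightarrow> 'm bivec" where
  "zero_bivector = (\<lambda>p \<xi> \<eta>. 0)"

definition sharp :: "('m, 'e::euclidean_space) mfd \<Rightarrow> ('m \<Rightarrow> 'm bivec) \<Rightarrow> 'm \<Rightarrow> 'm cvec \<Rightarrow> 'm tvec" where
  "sharp M \<pi> p \<xi> = (THE X. X \<in> tangent M p \<and> (\<forall>\<eta>\<in>cotangent M p. \<eta> X = \<pi> p \<xi> \<eta>))"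

section \<open>Coregular Poisson-Dirac submanifolds\<close>

text \<open>An injectively immersed submanifold carries its own topology and atlas; the immersion is
  the inclusion of its set of points.\<close>

definition immersed_submanifold ::
    "('m, 'f::euclidean_space) mfd \<Rightarrow> ('m, 'e::euclidean_space) mfd \<Rightarrow> bool" where
  "immersed_submanifold X M \<longleftrightarrow> smooth_manifold X \<and> pts X \<subseteq> pts M \<and> smooth_map X M (\<lambda>p. p) \<and>
     (\<forall>p\<in>pts X. inj_on (push X M (\<lambda>p. p) p) (tangent X p))"

definition sub_tangent ::
    "('m, 'f::euclidean_space) mfd \<Rightarrow> ('m, 'e::euclidean_space) mfd \<Rightarrow> 'm \<Rightarrow> 'm tvec set" where
  "sub_tangent X M p = push X M (\<lambda>p. p) p ` tangent X p"

definition conormal ::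
    "('m, 'f::euclidean_space) mfd \<Rightarrow> ('m, 'e::euclidean_space) mfd \<Rightarrow> 'm \<Rightarrow> 'm cvec set" where
  "conormal X M p = {\<xi> \<in> cotangent M p. \<forall>V\<in>sub_tangent X M p. \<xi> V = 0}"

definition smooth_section_along ::
    "('m, 'f::euclidean_space) mfd \<Rightarrow> ('m, 'e::euclidean_space) mfd \<Rightarrow> 'm set \<Rightarrow> ('m \<Rightarrow> 'm tvec) \<Rightarrow> bool" where
  "smooth_section_along X M W s \<longleftrightarrow> (\<forall>q\<in>W. s q \<in> tangent M q) \<and>
     (\<forall>V f. smooth_fun M V f \<longrightarrow> smooth_fun X (W \<inter> V) (\<lambda>q. s q f))"

text \<open>A family of subspaces \<open>E q\<close> of the fibres of \<open>TM|\<^sub>X\<close> is a vector subbundle if it locally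
  has a smooth frame.\<close>

definition vector_subbundle_along ::
    "('m, 'f::euclidean_space) mfd \<Rightarrow> ('m, 'e::euclidean_space) mfd \<Rightarrow> ('m \<Rightarrow> 'm tvec set) \<Rightarrow> bool" where
  "vector_subbundle_along X M E \<longleftrightarrow> (\<forall>p\<in>pts X. \<exists>W (k::nat) s. openin (mtop X) W \<and> p \<in> W \<and>
     (\<forall>i<k. smooth_section_along X M W (s i)) \<and>
     (\<forall>q\<in>W. E q = {(\<lambda>f. \<Sum>i<k. c i * s i q f) | c. True} \<and>
        (\<forall>c. (\<lambda>f. \<Sum>i<k. c i * s i q f) = (\<lambda>f. 0) \<longrightarrow> (\<forall>i<k. c i = 0))))"

definition coregular_poisson_dirac ::
    "('m, 'e::euclidean_space) mfd \<Rightarrow> ('m \<Rightarrow> 'm bivec) \<Rightarrow> ('m, 'f::euclidean_space) mfd \<Rightarrow> bool" where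
  "coregular_poisson_dirac M \<pi> X \<longleftrightarrow> immersed_submanifold X M \<and>
     vector_subbundle_along X M (\<lambda>p. sharp M \<pi> p ` conormal X M p) \<and>
     (\<forall>p\<in>pts X. sharp M \<pi> p ` conormal X M p \<inter> sub_tangent X M p = {\<lambda>f. 0})"

section \<open>Complex structures and positive bivectors\<close>

definition complex_structure :: "'a::euclidean_space set \<Rightarrow> ('a \<Rightarrow> 'a) \<Rightarrow> bool" where
  "complex_structure V J \<longleftrightarrow> subspace V \<and> linear J \<and> J ` V \<subseteq> V \<and> (\<forall>v\<in>V. J (J v) = - v)"

definition complex_subspace :: "('a::euclidean_space \<Rightarrow> 'a) \<Rightarrow> 'a set \<Rightarrow> bool" where
  "complex_subspace J B \<longleftrightarrow> subspace B \<and> J ` B \<subseteq> B"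

definition bivector :: "('a::euclidean_space \<Rightarrow>\<^sub>L real \<Rightarrow> 'a \<Rightarrow>\<^sub>L real \<Rightarrow> real) \<Rightarrow> bool" where
  "bivector P \<longleftrightarrow> bilinear P \<and> (\<forall>\<xi>. P \<xi> \<xi> = 0)"

definition vsharp :: "('a::euclidean_space \<Rightarrow>\<^sub>L real \<Rightarrow> 'a \<Rightarrow>\<^sub>L real \<Rightarrow> real) \<Rightarrow> 'a \<Rightarrow>\<^sub>L real \<Rightarrow> 'a" where
  "vsharp P \<xi> = (THE u. \<forall>\<eta>. blinfun_apply \<eta> u = P \<xi> \<eta>)"

text \<open>The symplectic form on the range of \<open>P\<^sup>\<sharp>\<close>: \<open>\<omega>(P\<^sup>\<sharp> \<xi>, P\<^sup>\<sharp> \<eta>) = P(\<xi>, \<eta>)\<close>. For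
  \<open>P = \<partial>\<^sub>x \<and> \<partial>\<^sub>y\<close> this gives \<open>\<omega>(\<partial>\<^sub>x, \<partial>\<^sub>y) = 1\<close>, so \<open>\<partial>\<^sub>x \<and> \<partial>\<^sub>y\<close> is positive for \<open>J \<partial>\<^sub>x = \<partial>\<^sub>y\<close>.\<close>

definition leaf_form ::
    "('a::euclidean_space \<Rightarrow>\<^sub>L real \<Rightarrow> 'a \<Rightarrow>\<^sub>L real \<Rightarrow> real) \<Rightarrow> 'a \<Rightarrow> 'a \<Rightarrow> real" where
  "leaf_form P u v = (THE c. \<exists>\<xi> \<eta>. u = vsharp P \<xi> \<and> v = vsharp P \<eta> \<and> c = P \<xi> \<eta>)"

definition positive_bivector ::
    "('a::euclidean_space \<Rightarrow> 'a) \<Rightarrow> ('a \<Rightarrow>\<^sub>L real \<Rightarrow> 'a \<Rightarrow>\<^sub>L real \<Rightarrow> real) \<Rightarrow> bool" where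
  "positive_bivector J P \<longleftrightarrow> bivector P \<and>
     (let S = range (vsharp P); \<omega> = leaf_form P; g = (\<lambda>u v. \<omega> u (J v)) in
        complex_subspace J S \<and>
        (\<forall>u\<in>S. \<forall>v\<in>S. \<omega> (J u) (J v) = \<omega> u v) \<and>
        (\<forall>u\<in>S. \<forall>v\<in>S. g u v = g v u) \<and>
        (\<forall>u\<in>S. u \<noteq> 0 \<longrightarrow> g u u > 0))"

text \<open>The derivative within the relatively open subset \<open>S\<close> of \<open>V\<close> is determined on \<open>V\<close> only.\<close>

definition complex_differentiable_on ::
    "'a::euclidean_space set \<Rightarrow> ('a \<Rightarrow> 'a) \<Rightarrow> ('b::euclidean_space \<Rightarrow> 'b) \<Rightarrow> 'a set \<Rightarrow> ('a \<Rightarrow> 'b) \<Rightarrow> bool" where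
  "complex_differentiable_on V J J' S f \<longleftrightarrow>
     (\<forall>x\<in>S. \<exists>D. (f has_derivative D) (at x within S) \<and> (\<forall>v\<in>V. D (J v) = J' (D v)))"

definition complex_manifold :: "('m, 'e::euclidean_space) mfd \<Rightarrow> ('e \<Rightarrow> 'e) \<Rightarrow> bool" where
  "complex_manifold M J \<longleftrightarrow> smooth_manifold M \<and> complex_structure (mmodel M) J \<and>
     (\<forall>(U, \<phi>)\<in>matlas M. \<forall>(V, \<psi>)\<in>matlas M.
        complex_differentiable_on (mmodel M) J J (\<phi> ` (U \<inter> V)) (\<psi> \<circ> inv_into U \<phi>))"

definition holomorphic_map ::
    "('m, 'e::euclidean_space) mfd \<Rightarrow> ('e \<Rightarrow> 'e) \<Rightarrow> ('n, 'f::euclidean_space) mfd \<Rightarrow> ('f \<Rightarrow> 'f)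
      \<Rightarrow> ('m \<Rightarrow> 'n) \<Rightarrow> bool" where
  "holomorphic_map M J N J' F \<longleftrightarrow> smooth_map M N F \<and>
     (\<forall>(U, \<phi>)\<in>matlas M. \<forall>(V, \<psi>)\<in>matlas N.
        complex_differentiable_on (mmodel M) J J' (\<phi> ` (U \<inter> F -` V)) (\<psi> \<circ> F \<circ> inv_into U \<phi>))"

section \<open>Actions of a vector space\<close>

text \<open>The vector space acts as a complex Lie group: the action map itself is holomorphic.
  If only each single transformation were required to be holomorphic, stabilizers would
  not need to be complex, as for translations of \<open>\<complex>\<^sup>n\<close> along a real-linear map.\<close>

definition holomorphic_action ::
    "('a::euclidean_space \<Rightarrow> 'a) \<Rightarrow> ('m, 'e::euclidean_space) mfd \<Rightarrow> ('e \<Rightarrow> 'e) \<Rightarrow> ('a \<Rightarrow> 'm \<Rightarrow> 'm) \<Rightarrow> bool" where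
  "holomorphic_action J M JM \<alpha> \<longleftrightarrow>
     holomorphic_map (prod_mfd (subspace_mfd UNIV) M) (map_prod J JM) M JM (\<lambda>(a, x). \<alpha> a x) \<and>
     (\<forall>x\<in>pts M. \<alpha> 0 x = x) \<and> (\<forall>a b. \<forall>x\<in>pts M. \<alpha> (a + b) x = \<alpha> a (\<alpha> b x))"

definition infinitesimal ::
    "('m, 'e::euclidean_space) mfd \<Rightarrow> ('a::euclidean_space \<Rightarrow> 'm \<Rightarrow> 'm) \<Rightarrow> 'a \<Rightarrow> 'm \<Rightarrow> 'm tvec" where
  "infinitesimal M \<alpha> v x = velocity M (\<lambda>t. \<alpha> (- (t *\<^sub>R v)) x)"

definition induced_bivector ::
    "('m, 'e::euclidean_space) mfd \<Rightarrow> ('a::euclidean_space \<Rightarrow> 'm \<Rightarrow> 'm)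
      \<Rightarrow> ('a \<Rightarrow>\<^sub>L real \<Rightarrow> 'a \<Rightarrow>\<^sub>L real \<Rightarrow> real) \<Rightarrow> 'm \<Rightarrow> 'm bivec" where
  "induced_bivector M \<alpha> P x \<xi> \<eta> =
     P (Blinfun (\<lambda>v. \<xi> (infinitesimal M \<alpha> v x))) (Blinfun (\<lambda>v. \<eta> (infinitesimal M \<alpha> v x)))"

definition invariant_bivector ::
    "('m, 'e::euclidean_space) mfd \<Rightarrow> ('a \<Rightarrow> 'm \<Rightarrow> 'm) \<Rightarrow> ('m \<Rightarrow> 'm bivec) \<Rightarrow> bool" where
  "invariant_bivector M \<alpha> \<pi> \<longleftrightarrow> (\<forall>a. bivectors_related M \<pi> M \<pi> (\<alpha> a))"

definition poisson_action ::
    "('a::euclidean_space) set \<Rightarrow> ('a \<Rightarrow> 'a bivec) \<Rightarrow> ('m, 'e::euclidean_space) mfd \<Rightarrow> ('m \<Rightarrow> 'm bivec)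
      \<Rightarrow> ('a \<Rightarrow> 'm \<Rightarrow> 'm) \<Rightarrow> bool" where
  "poisson_action B \<pi>B M \<pi> \<alpha> \<longleftrightarrow>
     poisson_map (prod_mfd (subspace_mfd B) M) (prod_bivector (subspace_mfd B) \<pi>B M \<pi>) M \<pi>
       (\<lambda>(b, x). \<alpha> b x)"

text \<open>The manifold structure of a homogeneous space on the orbit is determined by
  requiring the orbit map to be a surjective submersion.\<close>

definition orbit_manifold ::
    "'a::euclidean_space set \<Rightarrow> ('a \<Rightarrow> 'm \<Rightarrow> 'm) \<Rightarrow> 'm \<Rightarrow> ('m, 'f::euclidean_space) mfd \<Rightarrow> bool" where
  "orbit_manifold B \<alpha> x X \<longleftrightarrow> smooth_manifold X \<and> pts X = (\<lambda>b. \<alpha> b x) ` B \<and>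
     smooth_map (subspace_mfd B) X (\<lambda>b. \<alpha> b x) \<and>
     (\<forall>b\<in>B. push (subspace_mfd B) X (\<lambda>b. \<alpha> b x) b ` tangent (subspace_mfd B) b = tangent X (\<alpha> b x))"

end

theory Submission
  imports Defs
begin

text \<open>Along each orbit the bracket of \<open>\<pi>\<^sub>M\<close> pulls back to the bracket of a constant bivector on
  \<open>A\<close>, whose Jacobi identity is the symmetry of second derivatives; invariance and the Poisson
  property of the action hold because the fundamental vector fields are invariant under the
  abelian group \<open>A\<close>. For an orbit \<open>X\<close> of \<open>B\<close> through \<open>x\<close>, let \<open>K\<close> be the kernel of \<open>\<rho>\<close> at \<open>x\<close>, which
  is the same at all points of \<open>X\<close> and is a complex subspace because the action is holomorphic. Then
  \<open>\<pi>\<^sub>M\<^sup>\<sharp>(N\<^sup>*X)\<close> is the image under \<open>\<rho>\<close> of the fixed subspace \<open>F = \<pi>\<^sub>A\<^sup>\<sharp>((B + K)\<^sup>\<bottom>)\<close>, and \<open>TX = \<rho>(B)\<close>.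
  If \<open>u = \<pi>\<^sub>A\<^sup>\<sharp> \<xi> \<in> F\<close> lies in \<open>B + K\<close>, then so does \<open>J u\<close>, hence \<open>\<omega>(u, J u) = \<plusminus> \<xi>(J u) = 0\<close>, and
  positivity gives \<open>u = 0\<close>. So \<open>\<rho>\<close> maps \<open>F\<close> injectively, which gives both the constant rank and the
  trivial intersection with \<open>TX\<close>.

  The orbit itself is the quotient of a linear complement \<open>C\<close> of \<open>B \<inter> K\<close> in \<open>B\<close> by a discrete
  subgroup: \<open>B \<inter> K\<close> fixes \<open>x\<close>, and the orbit map has injective derivative on \<open>C\<close>.\<close>

section \<open>Calculus of smooth maps on subsets of Euclidean spaces\<close>

text \<open>Tangent vectors are operators on functions, so computing with them requires a chart that
  identifies them with vectors of the model space. The bridge is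
  \<open>velocity_eq_chart_vec\<close>: a velocity depends only on the derivative of the curve in
  one chart. As the model may be a proper subspace, smoothness means local extendability;
  derivatives of extensions are evaluated only in directions of curves inside the domain, where they
  do not depend on the extension. The Jacobi identity concerns functions on all of \<open>M\<close>.
  These pull back along an orbit map to functions on the whole acting vector space, so it becomes an
  identity in flat space. The kernel of \<open>\<rho>\<close> is complex because the derivative at 0
  of the orbit map intertwines the two complex structures. A complement stands in for a quotient
  vector space because charts must take values in a linear subspace of a Euclidean space. The charts
  of the orbit are balls of one fixed radius, half of an injectivity radius at \<open>x\<close>;
  translations carry this radius to every other point.\<close>

lemma Ck_on_subset: "Ck_on k f U \<Longrightarrow> V \<subseteq> U \<Longrightarrow> Ck_on k f V"
  by (induction k arbitrary: f) (auto intro: continuous_on_subset)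

lemma Ck_on_has_derivative:
  "Ck_on (Suc k) f U \<Longrightarrow> x \<in> U \<Longrightarrow> (f has_derivative frechet_derivative f (at x)) (at x)"
  by (simp add: frechet_derivative_works)

text \<open>Openness of \<open>U\<close> turns agreement on \<open>U\<close> into agreement near
  each point, so both functions have the same derivatives there.\<close>

lemma Ck_on_cong:
  assumes "open U" and "\<And>x. x \<in> U \<Longrightarrow> f x = g x" and "Ck_on k f U"
  shows "Ck_on k g U"
  using assms(2,3)
proof (induction k arbitrary: f g)
  case 0
  then show ?case by (simp cong: continuous_on_cong)
next
  case (Suc k)
  have eq: "frechet_derivative f (at x) = frechet_derivative g (at x)" if "x \<in> U" for x
    using Suc.prems that by (intro frechet_derivative_transform_within_open[OF _ assms(1)]) auto
  have "g differentiable (at x)" if "x \<in> U" for x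
    using has_derivative_transform_within_open[OF Ck_on_has_derivative[OF Suc.prems(2) that]
        assms(1) that] Suc.prems(1) by (auto intro: differentiableI)
  moreover have "Ck_on k (\<lambda>x. frechet_derivative g (at x) v) U" for v
    by (rule Suc.IH[of "\<lambda>x. frechet_derivative f (at x) v"]) (use Suc.prems eq in auto)
  ultimately show ?case by simp
qed

text \<open>\<open>Ck_on\<close> speaks of the derivative selected by
  \<open>frechet_derivative\<close>. This rule admits any explicit formula \<open>f'\<close>
  instead, and the closure properties below rest on it.\<close>

lemma Ck_on_SucI:
  assumes "open U" and "\<And>x. x \<in> U \<Longrightarrow> (f has_derivative f' x) (at x)"
    and "\<And>v. Ck_on k (\<lambda>x. f' x v) U"
  shows "Ck_on (Suc k) f U"
proof -
  have "f' x v = frechet_derivative f (at x) v" if "x \<in> U" for x v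
    using frechet_derivative_at[OF assms(2)[OF that]] by simp
  then have "Ck_on k (\<lambda>x. frechet_derivative f (at x) v) U" for v
    using Ck_on_cong[OF assms(1) _ assms(3)[of v]] by simp
  then show ?thesis
    using assms(2) by (auto simp: differentiable_def)
qed

lemma Ck_on_Suc: "Ck_on (Suc k) f U \<Longrightarrow> Ck_on k f U"
proof (induction k arbitrary: f)
  case 0
  then show ?case
    by (auto intro!: continuous_at_imp_continuous_on differentiable_imp_continuous_within)
next
  case (Suc k)
  then show ?case by simp
qed

lemma Ck_on_const: "open U \<Longrightarrow> Ck_on k (\<lambda>x. c) U"
proof (induction k arbitrary: c)
  case (Suc k)
  then show ?case by (intro Ck_on_SucI[where f' = "\<lambda>_ _. 0"]) auto
qed simp

lemma Ck_on_linear: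
  assumes "open U" "bounded_linear L"
  shows "Ck_on k L U"
proof (cases k)
  case 0
  then show ?thesis using assms by (simp add: linear_continuous_on)
next
  case (Suc n)
  have "(L has_derivative L) (at x)" for x
    using assms(2) by (rule bounded_linear_imp_has_derivative)
  then show ?thesis
    unfolding Suc using assms by (intro Ck_on_SucI[where f' = "\<lambda>_. L"] Ck_on_const) auto
qed

lemma Ck_on_bounded_linear_compose:
  assumes "open U" "bounded_linear L"
  shows "Ck_on k f U \<Longrightarrow> Ck_on k (\<lambda>x. L (f x)) U"
proof (induction k arbitrary: f)
  case 0
  then show ?case using assms(2) by (simp add: bounded_linear.continuous_on)
next
  case (Suc k)
  show ?case
    by (rule Ck_on_SucI[OF assms(1) bounded_linear.has_derivative[OF assms(2)]])
      (use Suc in \<open>auto intro: Ck_on_has_derivative\<close>)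
qed

lemma Ck_on_add:
  assumes "open U"
  shows "Ck_on k f U \<Longrightarrow> Ck_on k g U \<Longrightarrow> Ck_on k (\<lambda>x. f x + g x) U"
proof (induction k arbitrary: f g)
  case 0
  then show ?case by (simp add: continuous_on_add)
next
  case (Suc k)
  show ?case
    by (rule Ck_on_SucI[OF assms has_derivative_add]) (use Suc in \<open>auto intro: Ck_on_has_derivative\<close>)
qed

lemma Ck_on_scaleR:
  assumes "open U"
  shows "Ck_on k r U \<Longrightarrow> Ck_on k f U \<Longrightarrow> Ck_on k (\<lambda>x. r x *\<^sub>R f x) U"
proof (induction k arbitrary: r f)
  case 0
  then show ?case by (simp add: continuous_on_scaleR)
next
  case (Suc k)
  show ?case
  proof (rule Ck_on_SucI[OF assms has_derivative_scaleR])
    fix v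
    show "Ck_on k (\<lambda>x. r x *\<^sub>R frechet_derivative f (at x) v
        + frechet_derivative r (at x) v *\<^sub>R f x) U"
      using Suc Ck_on_Suc[of k r] Ck_on_Suc[of k f] by (intro Ck_on_add[OF assms] Suc.IH) auto
  qed (use Suc in \<open>auto intro: Ck_on_has_derivative\<close>)
qed

lemma Ck_on_sum:
  assumes "open U"
  shows "(\<And>i. i \<in> I \<Longrightarrow> Ck_on k (f i) U) \<Longrightarrow> Ck_on k (\<lambda>x. \<Sum>i\<in>I. f i x) U"
  by (induction I rule: infinite_finite_induct) (auto intro: Ck_on_add Ck_on_const assms)

lemma Ck_on_compose:
  fixes f :: "'a::euclidean_space \<Rightarrow> 'b::euclidean_space" and g :: "'b \<Rightarrow> 'c::real_normed_vector"
  assumes "open U" "open V" "f ` U \<subseteq> V"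
  shows "Ck_on k f U \<Longrightarrow> Ck_on k g V \<Longrightarrow> Ck_on k (\<lambda>x. g (f x)) U"
proof (induction k arbitrary: g)
  case 0
  then show ?case using assms(3) by (auto intro: continuous_on_compose2)
next
  case (Suc k)
  show ?case
  proof (rule Ck_on_SucI[OF assms(1)])
    fix x assume x: "x \<in> U"
    show "((\<lambda>x. g (f x)) has_derivative
      (\<lambda>v. frechet_derivative g (at (f x)) (frechet_derivative f (at x) v))) (at x)"
      using assms(3) x
      by (intro has_derivative_compose[OF Ck_on_has_derivative[OF Suc.prems(1)]
          Ck_on_has_derivative[OF Suc.prems(2)]]) auto
  next
    fix v
    \<comment> \<open>The derivative of \<open>g\<close> varies with \<open>x\<close> and is applied
      to a vector that also varies. Expanding this vector in the basis leaves derivatives of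
      \<open>g\<close> in fixed directions, to which the induction hypothesis, general in
      \<open>g\<close>, applies.\<close>
    let ?h = "\<lambda>x. \<Sum>i\<in>Basis. (frechet_derivative f (at x) v \<bullet> i) *\<^sub>R frechet_derivative g (at (f x)) i"
    have "Ck_on k (\<lambda>x. frechet_derivative f (at x) v \<bullet> i) U" for i
      using Suc.prems by (intro Ck_on_bounded_linear_compose[OF assms(1) bounded_linear_inner_left]) auto
    moreover have "Ck_on k (\<lambda>x. frechet_derivative g (at (f x)) i) U" for i
      using Suc.prems Ck_on_Suc[of k f] by (intro Suc.IH) auto
    ultimately have h: "Ck_on k ?h U"
      by (intro Ck_on_sum Ck_on_scaleR assms)
    have "?h x = frechet_derivative g (at (f x)) (frechet_derivative f (at x) v)" if "x \<in> U" for x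
    proof -
      interpret bounded_linear "frechet_derivative g (at (f x))"
        using Ck_on_has_derivative[OF Suc.prems(2), of "f x"] that assms(3)
        by (auto intro: has_derivative_bounded_linear)
      show ?thesis
        by (subst (2) euclidean_representation[symmetric]) (simp only: sum scaleR)
    qed
    then show "Ck_on k (\<lambda>x. frechet_derivative g (at (f x)) (frechet_derivative f (at x) v)) U"
      by (rule Ck_on_cong[OF assms(1) _ h])
  qed
qed

text \<open>One induction treats both functions because each is the derivative of the other up to
  sign. The sine later turns a short segment into a curve defined for all times.\<close>

lemma Ck_on_sin: "Ck_on k (sin :: real \<Rightarrow> real) UNIV \<and> Ck_on k (cos :: real \<Rightarrow> real) UNIV"
proof (induction k)
  case 0
  then show ?case by (auto intro!: continuous_intros)
next
  case (Suc k)
  have c: "Ck_on k (\<lambda>x::real. v *\<^sub>R cos x) UNIV" for v :: real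
    using Suc.IH by (intro Ck_on_scaleR[OF open_UNIV Ck_on_const[OF open_UNIV]]) simp
  have s: "Ck_on k (\<lambda>x::real. (- v) *\<^sub>R sin x) UNIV" for v :: real
    using Suc.IH by (intro Ck_on_scaleR[OF open_UNIV Ck_on_const[OF open_UNIV]]) simp
  have "Ck_on (Suc k) (sin :: real \<Rightarrow> real) UNIV"
    by (rule Ck_on_SucI[OF open_UNIV _ c]) (auto intro!: derivative_eq_intros)
  moreover have "Ck_on (Suc k) (cos :: real \<Rightarrow> real) UNIV"
    by (rule Ck_on_SucI[OF open_UNIV _ s]) (auto intro!: derivative_eq_intros)
  ultimately show ?case ..
qed

text \<open>The second difference of \<open>F\<close> over the parallelogram with sides
  \<open>h u\<close> and \<open>h v\<close> is symmetric in \<open>u\<close> and \<open>v\<close>.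
  Two applications of the mean value theorem express it through either mixed derivative at a point
  near \<open>x\<close>, and continuity compares these values with those at
  \<open>x\<close>.\<close>

lemma second_derivative_symmetric:
  fixes F :: "'a::euclidean_space \<Rightarrow> real"
  assumes "Ck_on 2 F UNIV"
  shows "frechet_derivative (\<lambda>y. frechet_derivative F (at y) u) (at x) v
       = frechet_derivative (\<lambda>y. frechet_derivative F (at y) v) (at x) u"
proof -
  define D where "D = (\<lambda>(u::'a) (F::'a \<Rightarrow> real) x. frechet_derivative F (at x) u)"
  have C2: "Ck_on (Suc (Suc 0)) F UNIV" using assms by (simp add: numeral_2_eq_2)
  have dF: "(F has_derivative (\<lambda>u. D u F x)) (at x)" for x
    using Ck_on_has_derivative[OF C2] by (simp add: D_def)
  have C1: "Ck_on (Suc 0) (D u F) UNIV" for u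
    using C2 unfolding D_def by simp
  have ddF: "(D u F has_derivative (\<lambda>v. D v (D u F) x)) (at x)" for u x
    using Ck_on_has_derivative[OF C1[of u], of x] unfolding D_def by simp
  have cont: "isCont (D v (D u F)) x" for u v x
    using C1[of u] unfolding D_def by (simp add: continuous_on_eq_continuous_at)
  have bl: "bounded_linear (\<lambda>u. D u F x)" "bounded_linear (\<lambda>v. D v (D u F) x)" for u x
    using dF ddF has_derivative_bounded_linear by blast+
  have scF: "D (c *\<^sub>R u) F x = c * D u F x" for c u x
    using linear_cmul[OF bounded_linear.linear[OF bl(1)]] by simp
  have scD: "D (c *\<^sub>R v) (D u F) x = c * D v (D u F) x" for c u v x
    using linear_cmul[OF bounded_linear.linear[OF bl(2)]] by simp
  have line: "((\<lambda>t. f (y + t *\<^sub>R w)) has_real_derivative f' (y + t *\<^sub>R w) w) (at t)"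
    if "\<And>x. (f has_derivative f' x) (at x)" for f :: "'a \<Rightarrow> real" and f' y w t
  proof -
    have "((\<lambda>t. f (y + t *\<^sub>R w)) has_derivative (\<lambda>s. f' (y + t *\<^sub>R w) (s *\<^sub>R w))) (at t)"
      by (rule has_derivative_compose[OF _ that]) (auto intro!: derivative_eq_intros)
    moreover have "f' (y + t *\<^sub>R w) (s *\<^sub>R w) = f' (y + t *\<^sub>R w) w * s" for s
      using linear_cmul[OF has_derivative_linear[OF that]] by simp
    ultimately show ?thesis by (simp add: has_field_derivative_def)
  qed
  have mvt: "\<exists>s t. 0 < s \<and> s < h \<and> 0 < t \<and> t < h \<and>
      F (x + h *\<^sub>R u + h *\<^sub>R v) - F (x + h *\<^sub>R u) - F (x + h *\<^sub>R v) + F x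
      = h * (h * D v (D u F) (x + s *\<^sub>R u + t *\<^sub>R v))" if "h > 0" for h u v
  proof -
    \<comment> \<open>The mean value theorem is applied first along \<open>u\<close>, to the
      difference of \<open>F\<close> across the side \<open>h v\<close>, and then along
      \<open>v\<close>, to the resulting derivative \<open>D u F\<close>.\<close>
    let ?g = "\<lambda>s. F ((x + h *\<^sub>R v) + s *\<^sub>R u) - F (x + s *\<^sub>R u)"
    have "(?g has_real_derivative D u F ((x + h *\<^sub>R v) + s *\<^sub>R u) - D u F (x + s *\<^sub>R u)) (at s)" for s
      by (intro DERIV_diff line[where f' = "\<lambda>x u. D u F x"] dF)
    from MVT2[OF that this] obtain s where s: "0 < s" "s < h"
      "?g h - ?g 0 = h * (D u F ((x + h *\<^sub>R v) + s *\<^sub>R u) - D u F (x + s *\<^sub>R u))" by auto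
    have "((\<lambda>t. D u F ((x + s *\<^sub>R u) + t *\<^sub>R v)) has_real_derivative
        D v (D u F) ((x + s *\<^sub>R u) + t *\<^sub>R v)) (at t)" for t
      by (intro line[where f' = "\<lambda>x v. D v (D u F) x"] ddF)
    from MVT2[OF that this] obtain t where t: "0 < t" "t < h"
      "D u F ((x + s *\<^sub>R u) + h *\<^sub>R v) - D u F (x + s *\<^sub>R u + 0 *\<^sub>R v)
       = h * D v (D u F) ((x + s *\<^sub>R u) + t *\<^sub>R v)" by auto
    have eq: "(x + h *\<^sub>R v) + s *\<^sub>R u = (x + s *\<^sub>R u) + h *\<^sub>R v" "(x + h *\<^sub>R v) + h *\<^sub>R u = x + h *\<^sub>R u + h *\<^sub>R v"
      by (simp_all add: algebra_simps)
    show ?thesis using s t unfolding eq by (intro exI[of _ s] exI[of _ t]) (auto simp: algebra_simps)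
  qed
  have "D v (D u F) x = D u (D v F) x"
  proof (rule ccontr)
    assume ne: "D v (D u F) x \<noteq> D u (D v F) x"
    \<comment> \<open>The two mixed derivatives take a common value at points near \<open>x\<close>.
      If each of these lies within \<open>e\<close> of the value at \<open>x\<close>, the gap is
      less than \<open>2 e\<close>, contrary to this choice.\<close>
    define e where "e = \<bar>D v (D u F) x - D u (D v F) x\<bar> / 2"
    have e: "e > 0" using ne by (simp add: e_def)
    have near: "\<exists>d>0. \<forall>y. dist y x < d \<longrightarrow> dist (D b (D a F) y) (D b (D a F) x) < e" for a b
      using cont[of x b a] e unfolding continuous_at_eps_delta by simp
    obtain d1 where d1: "d1 > 0"
      "\<forall>y. dist y x < d1 \<longrightarrow> dist (D v (D u F) y) (D v (D u F) x) < e"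
      using near[of v u] by (elim exE conjE)
    obtain d2 where d2: "d2 > 0"
      "\<forall>y. dist y x < d2 \<longrightarrow> dist (D u (D v F) y) (D u (D v F) x) < e"
      using near[of u v] by (elim exE conjE)
    \<comment> \<open>Parameters below \<open>h\<close> keep all intermediate points within
      \<open>min d1 d2\<close> of \<open>x\<close>. The summand 1 keeps the denominator positive
      when \<open>u\<close> and \<open>v\<close> vanish.\<close>
    define h where "h = min d1 d2 / (norm u + norm v + 1)"
    have nn: "norm u + norm v + 1 > 0" by (smt (verit) norm_ge_zero)
    have h: "h > 0" using d1 d2 nn by (simp add: h_def)
    have small: "dist (x + s *\<^sub>R a + t *\<^sub>R b) x < min d1 d2"
      if "0 < s" "s < h" "0 < t" "t < h" "norm a + norm b = norm u + norm v" for s t a b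
    proof -
      have "dist (x + s *\<^sub>R a + t *\<^sub>R b) x \<le> norm (s *\<^sub>R a) + norm (t *\<^sub>R b)"
        using norm_triangle_ineq[of "s *\<^sub>R a" "t *\<^sub>R b"] by (simp add: dist_norm add.assoc)
      also have "\<dots> = s * norm a + t * norm b" using that by simp
      also have "\<dots> \<le> h * norm a + h * norm b"
        using that by (intro add_mono mult_right_mono) auto
      also have "\<dots> = h * (norm u + norm v)" using that(5) by (metis distrib_left)
      also have "\<dots> < h * (norm u + norm v + 1)" using h by simp
      also have "\<dots> = min d1 d2" using nn by (simp add: h_def)
      finally show ?thesis .
    qed
    obtain s t where st: "0 < s" "s < h" "0 < t" "t < h"
      "F (x + h *\<^sub>R u + h *\<^sub>R v) - F (x + h *\<^sub>R u) - F (x + h *\<^sub>R v) + F x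
      = h * (h * D v (D u F) (x + s *\<^sub>R u + t *\<^sub>R v))" using mvt[OF h, of u v] by blast
    obtain s' t' where st': "0 < s'" "s' < h" "0 < t'" "t' < h"
      "F (x + h *\<^sub>R v + h *\<^sub>R u) - F (x + h *\<^sub>R v) - F (x + h *\<^sub>R u) + F x
      = h * (h * D u (D v F) (x + s' *\<^sub>R v + t' *\<^sub>R u))" using mvt[OF h, of v u] by blast
    have "x + h *\<^sub>R v + h *\<^sub>R u = x + h *\<^sub>R u + h *\<^sub>R v" by (simp add: algebra_simps)
    from st(5) st'(5)[unfolded this] have "h * (h * D v (D u F) (x + s *\<^sub>R u + t *\<^sub>R v))
        = h * (h * D u (D v F) (x + s' *\<^sub>R v + t' *\<^sub>R u))" by linarith
    then have "D v (D u F) (x + s *\<^sub>R u + t *\<^sub>R v) = D u (D v F) (x + s' *\<^sub>R v + t' *\<^sub>R u)"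
      using h by (simp only: mult_cancel_left) simp
    moreover have "dist (D v (D u F) (x + s *\<^sub>R u + t *\<^sub>R v)) (D v (D u F) x) < e"
      using d1(2) small[OF st(1-4), of u v] by simp
    moreover have "dist (D u (D v F) (x + s' *\<^sub>R v + t' *\<^sub>R u)) (D u (D v F) x) < e"
      using d2(2) small[OF st'(1-4), of v u] by simp
    ultimately show False unfolding dist_real_def e_def by (smt (verit) field_sum_of_halves)
  qed
  then show ?thesis by (simp add: D_def)
qed

lemma Ck_on_local:
  assumes "\<And>x. x \<in> S \<Longrightarrow> \<exists>U. open U \<and> x \<in> U \<and> Ck_on k f U"
  shows "Ck_on k f S"
  using assms
proof (induction k arbitrary: f)
  case 0
  have "isCont f x" if x: "x \<in> S" for x
    using 0[OF x] by (auto simp: continuous_on_eq_continuous_at)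
  then show ?case by (simp add: continuous_at_imp_continuous_on)
next
  case (Suc k)
  have "Ck_on k (\<lambda>x. frechet_derivative f (at x) v) S" for v
    by (rule Suc.IH) (use Suc.prems in fastforce)
  moreover have "f differentiable (at x)" if x: "x \<in> S" for x
    using Suc.prems[OF x] by auto
  ultimately show ?case by simp
qed

section \<open>Smoothness on sets that need not be open\<close>

lemma smooth_onI_Ck:
  assumes "open U" "S \<subseteq> U" "\<And>k. Ck_on k f U"
  shows "smooth_on S f"
  unfolding smooth_on_def using assms by (intro ballI exI[of _ U] exI[of _ f]) auto

lemma smooth_onE:
  assumes "smooth_on S f" "x \<in> S"
  obtains U g where "open U" "x \<in> U" "\<forall>k. Ck_on k g U" "\<forall>y\<in>S \<inter> U. g y = f y"
proof -
  have "\<exists>U g. open U \<and> x \<in> U \<and> (\<forall>k. Ck_on k g U) \<and> (\<forall>y\<in>S \<inter> U. g y = f y)"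
    using assms unfolding smooth_on_def by (rule bspec)
  then show thesis using that by (elim exE conjE)
qed

lemma smooth_on_subset:
  assumes "smooth_on T f" "S \<subseteq> T"
  shows "smooth_on S f"
  unfolding smooth_on_def
proof
  fix x assume "x \<in> S"
  with assms have "x \<in> T" by auto
  with assms(1) obtain U g where U: "open U" "x \<in> U" "\<forall>k. Ck_on k g U" "\<forall>y\<in>T \<inter> U. g y = f y"
    by (rule smooth_onE)
  then show "\<exists>U g. open U \<and> x \<in> U \<and> (\<forall>k. Ck_on k g U) \<and> (\<forall>y\<in>S \<inter> U. g y = f y)"
    using assms(2) by (intro exI[of _ U] exI[of _ g] conjI) auto
qed

lemma smooth_on_cong:
  assumes "smooth_on S f" "\<And>x. x \<in> S \<Longrightarrow> f x = g x"
  shows "smooth_on S g"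
  using assms(1) unfolding smooth_on_def by (simp add: assms(2))

lemma smooth_on_local:
  assumes "\<And>x. x \<in> S \<Longrightarrow> \<exists>U. open U \<and> x \<in> U \<and> smooth_on (S \<inter> U) f"
  shows "smooth_on S f"
  unfolding smooth_on_def
proof
  fix x assume x: "x \<in> S"
  obtain U where U: "open U" "x \<in> U" "smooth_on (S \<inter> U) f" using assms[OF x] by blast
  have "x \<in> S \<inter> U" using x U by simp
  from U(3) this obtain V g where V: "open V" "x \<in> V" "\<forall>k. Ck_on k g V"
    "\<forall>y\<in>S \<inter> U \<inter> V. g y = f y" by (rule smooth_onE) blast
  show "\<exists>U g. open U \<and> x \<in> U \<and> (\<forall>k. Ck_on k g U) \<and> (\<forall>y\<in>S \<inter> U. g y = f y)"
    using U(1,2) V Ck_on_subset[OF V(3)[THEN spec], of "U \<inter> V"] by (intro exI[of _ "U \<inter> V"] exI[of _ g]) auto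
qed

text \<open>On an open set the local extensions coincide with \<open>f\<close> near each point, so
  \<open>f\<close> itself has the derivatives.\<close>

lemma smooth_on_open_Ck:
  assumes "smooth_on S f" "open S"
  shows "Ck_on k f S"
proof (rule Ck_on_local)
  fix x assume x: "x \<in> S"
  obtain U g where U: "open U" "x \<in> U" "\<forall>k. Ck_on k g U" "\<forall>y\<in>S \<inter> U. g y = f y"
    using smooth_onE[OF assms(1) x] by blast
  have "Ck_on k f (S \<inter> U)"
    by (rule Ck_on_cong[OF _ _ Ck_on_subset[OF U(3)[THEN spec]], of "S \<inter> U" f]) (use assms(2) U in auto)
  then show "\<exists>U. open U \<and> x \<in> U \<and> Ck_on k f U"
    using assms(2) U x by (intro exI[of _ "S \<inter> U"]) auto
qed

lemma smooth_on_continuous_on: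
  assumes "smooth_on S f"
  shows "continuous_on S f"
proof -
  have "continuous (at x within S) f" if x: "x \<in> S" for x
  proof -
    obtain U g where U: "open U" "x \<in> U" "\<forall>k. Ck_on k g U" "\<forall>y\<in>S \<inter> U. g y = f y"
      using smooth_onE[OF assms x] by blast
    have "continuous (at x within S) g"
      using U(1,2) U(3)[THEN spec, of 0] by (simp add: continuous_on_eq_continuous_at continuous_at_imp_continuous_at_within)
    then show ?thesis
      by (rule continuous_transform_within_openin[where S = "S \<inter> U"]) (use U x in \<open>auto simp: openin_open_Int\<close>)
  qed
  then show ?thesis by (simp add: continuous_on_eq_continuous_within)
qed

lemma smooth_on_compose:
  fixes f :: "'a::euclidean_space \<Rightarrow> 'b::euclidean_space" and g :: "'b \<Rightarrow> 'c::real_normed_vector"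
  assumes "smooth_on T g" "smooth_on S f" "\<And>x. x \<in> S \<Longrightarrow> f x \<in> T"
  shows "smooth_on S (\<lambda>x. g (f x))"
  unfolding smooth_on_def
proof
  fix x assume x: "x \<in> S"
  obtain U f' where U: "open U" "x \<in> U" "\<forall>k. Ck_on k f' U" "\<forall>y\<in>S \<inter> U. f' y = f y"
    using smooth_onE[OF assms(2) x] by blast
  obtain V g' where V: "open V" "f x \<in> V" "\<forall>k. Ck_on k g' V" "\<forall>y\<in>T \<inter> V. g' y = g y"
    using smooth_onE[OF assms(1) assms(3)[OF x]] by blast
  have "continuous_on U f'" using U(3)[THEN spec, of 0] by simp
  then have op: "open (U \<inter> f' -` V)" using U(1) V(1) by (rule continuous_open_preimage)
  have Ck: "Ck_on k (\<lambda>x. g' (f' x)) (U \<inter> f' -` V)" for k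
    using op V(1) by (rule Ck_on_compose) (auto intro: Ck_on_subset[OF U(3)[THEN spec]] V(3)[THEN spec])
  show "\<exists>U h. open U \<and> x \<in> U \<and> (\<forall>k. Ck_on k h U) \<and> (\<forall>y\<in>S \<inter> U. h y = g (f y))"
    using op Ck U V x assms(3) by (intro exI[of _ "U \<inter> f' -` V"] exI[of _ "\<lambda>x. g' (f' x)"]) auto
qed

lemma smooth_on_const: "smooth_on S (\<lambda>x. c)"
  by (rule smooth_onI_Ck[OF open_UNIV]) (auto intro: Ck_on_const)

lemma smooth_on_bounded_linear: "bounded_linear L \<Longrightarrow> smooth_on S L"
  by (rule smooth_onI_Ck[OF open_UNIV]) (auto intro: Ck_on_linear)

lemma smooth_on_linear:
  fixes L :: "'a::euclidean_space \<Rightarrow> 'b::real_normed_vector"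
  shows "linear L \<Longrightarrow> smooth_on S L"
  by (simp add: linear_linear smooth_on_bounded_linear)

text \<open>The two arguments extend to different open sets. Passing to the intersection reduces
  sums, scalings and pairs alike to the corresponding rule for \<open>Ck_on\<close>.\<close>

lemma smooth_on_bilinear_op:
  fixes f :: "'a::euclidean_space \<Rightarrow> 'b::real_normed_vector" and g :: "'a \<Rightarrow> 'c::real_normed_vector"
    and h :: "'b \<Rightarrow> 'c \<Rightarrow> 'd::real_normed_vector"
  assumes "smooth_on S f" "smooth_on S g"
    and op: "\<And>k U f g. open U \<Longrightarrow> Ck_on k f U \<Longrightarrow> Ck_on k g U \<Longrightarrow> Ck_on k (\<lambda>x::'a. h (f x) (g x)) U"
  shows "smooth_on S (\<lambda>x. h (f x) (g x))"
  unfolding smooth_on_def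
proof
  fix x assume x: "x \<in> S"
  obtain U f' where U: "open U" "x \<in> U" "\<forall>k. Ck_on k f' U" "\<forall>y\<in>S \<inter> U. f' y = f y"
    using smooth_onE[OF assms(1) x] by blast
  obtain V g' where V: "open V" "x \<in> V" "\<forall>k. Ck_on k g' V" "\<forall>y\<in>S \<inter> V. g' y = g y"
    using smooth_onE[OF assms(2) x] by blast
  have "Ck_on k (\<lambda>x. h (f' x) (g' x)) (U \<inter> V)" for k
    using U(1) V(1) by (intro op Ck_on_subset[OF U(3)[THEN spec]] Ck_on_subset[OF V(3)[THEN spec]]) auto
  then show "\<exists>U g'. open U \<and> x \<in> U \<and> (\<forall>k. Ck_on k g' U) \<and> (\<forall>y\<in>S \<inter> U. g' y = h (f y) (g y))"
    using U V by (intro exI[of _ "U \<inter> V"] exI[of _ "\<lambda>x. h (f' x) (g' x)"]) auto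
qed

lemma smooth_on_add: "smooth_on S f \<Longrightarrow> smooth_on S g \<Longrightarrow> smooth_on S (\<lambda>x. f x + g x)"
  by (rule smooth_on_bilinear_op[of _ _ _ "(+)"]) (auto intro: Ck_on_add)

lemma smooth_on_scaleR: "smooth_on S f \<Longrightarrow> smooth_on S g \<Longrightarrow> smooth_on S (\<lambda>x. f x *\<^sub>R g x)"
  by (rule smooth_on_bilinear_op[of _ _ _ "(*\<^sub>R)"]) (auto intro: Ck_on_scaleR)

lemma smooth_on_mult:
  fixes f g :: "'a::euclidean_space \<Rightarrow> real"
  shows "smooth_on S f \<Longrightarrow> smooth_on S g \<Longrightarrow> smooth_on S (\<lambda>x. f x * g x)"
  using smooth_on_scaleR[of S f g] by simp

lemma Ck_on_Pair:
  assumes "open U" "Ck_on k f U" "Ck_on k g U"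
  shows "Ck_on k (\<lambda>x. (f x, g x)) U"
proof -
  have "Ck_on k (\<lambda>x. (f x, 0) + (0, g x)) U"
    using assms
      Ck_on_bounded_linear_compose[OF assms(1) bounded_linear_Pair[OF bounded_linear_ident bounded_linear_zero]]
      Ck_on_bounded_linear_compose[OF assms(1) bounded_linear_Pair[OF bounded_linear_zero bounded_linear_ident]]
    by (intro Ck_on_add) auto
  then show ?thesis by simp
qed

lemma smooth_on_Pair: "smooth_on S f \<Longrightarrow> smooth_on S g \<Longrightarrow> smooth_on S (\<lambda>x. (f x, g x))"
  by (rule smooth_on_bilinear_op[of _ _ _ Pair]) (auto intro: Ck_on_Pair)

lemma smooth_on_id: "smooth_on S (\<lambda>x. x)"
  by (rule smooth_on_bounded_linear) (rule bounded_linear_ident)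

lemma smooth_on_partial:
  fixes g :: "'a::euclidean_space \<Rightarrow> 'b::real_normed_vector"
  assumes "open U" "\<And>k. Ck_on k g U"
  shows "smooth_on U (\<lambda>x. frechet_derivative g (at x) v)"
  using assms(2)[of "Suc k" for k] by (intro smooth_onI_Ck[OF assms(1)]) auto

section \<open>Smooth maps of manifolds\<close>

text \<open>The vector-valued counterpart of \<open>smooth_fun\<close>. Coordinate maps become
  smooth objects themselves (\<open>chart_smooth\<close>), and smooth maps can be described by
  composing with charts of the target.\<close>

definition smooth_into ::
    "('m, 'e::euclidean_space) mfd \<Rightarrow> 'm set \<Rightarrow> ('m \<Rightarrow> 'b::real_normed_vector) \<Rightarrow> bool" where
  "smooth_into M W f \<longleftrightarrow> openin (mtop M) W \<and>
     (\<forall>(U, \<phi>)\<in>matlas M. smooth_on (\<phi> ` (U \<inter> W)) (f \<circ> inv_into U \<phi>))"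

lemma smooth_fun_iff: "smooth_fun M W f \<longleftrightarrow> smooth_into M W f"
  by (simp add: smooth_fun_def smooth_into_def)

lemma smooth_intoD:
  assumes "smooth_into M W f" "(U, \<phi>) \<in> matlas M"
  shows "smooth_on (\<phi> ` (U \<inter> W)) (f \<circ> inv_into U \<phi>)"
  using bspec[OF conjunct2[OF assms(1)[unfolded smooth_into_def]] assms(2)] by simp

lemma smooth_intoI:
  assumes "openin (mtop M) W"
    and "\<And>U \<phi>. (U, \<phi>) \<in> matlas M \<Longrightarrow> smooth_on (\<phi> ` (U \<inter> W)) (f \<circ> inv_into U \<phi>)"
  shows "smooth_into M W f"
  unfolding smooth_into_def using assms(1) by (auto intro: assms(2))

lemma smooth_into_openin: "smooth_into M W f \<Longrightarrow> openin (mtop M) W"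
  by (simp add: smooth_into_def)

locale smooth_mfd =
  fixes M :: "('m, 'e::euclidean_space) mfd"
  assumes mfd: "smooth_manifold M"
begin

lemma model: "subspace (mmodel M)"
  using mfd by (simp add: smooth_manifold_def)

lemma Hausdorff: "Hausdorff_space (mtop M)"
  using mfd by (simp add: smooth_manifold_def)

lemma chart_exists:
  assumes "p \<in> pts M"
  obtains U \<phi> where "(U, \<phi>) \<in> matlas M" "p \<in> U"
proof -
  have "p \<in> (\<Union>(U, \<phi>)\<in>matlas M. U)" using assms mfd by (simp add: smooth_manifold_def)
  then show thesis using that by blast
qed

context
  fixes U \<phi>
  assumes chart: "(U, \<phi>) \<in> matlas M"
begin

lemma chart_openin: "openin (mtop M) U"
  using mfd chart by (auto simp: smooth_manifold_def)

lemma chart_subset: "U \<subseteq> pts M"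
  using chart_openin by (rule openin_subset)

lemma chart_homeo: "homeomorphic_map (subtopology (mtop M) U) (top_of_set (\<phi> ` U)) \<phi>"
  using mfd chart by (auto simp: smooth_manifold_def)

lemma chart_image_openin: "openin (top_of_set (mmodel M)) (\<phi> ` U)"
  using mfd chart by (auto simp: smooth_manifold_def)

lemma chart_inj: "inj_on \<phi> U"
  using homeomorphic_imp_injective_map[OF chart_homeo] chart_subset
  by (simp add: Int_absorb1 topspace_subtopology)

lemma chart_inv [simp]: "p \<in> U \<Longrightarrow> inv_into U \<phi> (\<phi> p) = p"
  using chart_inj by simp

lemma chart_model: "p \<in> U \<Longrightarrow> \<phi> p \<in> mmodel M"
  using openin_subset[OF chart_image_openin] by auto

lemma chart_image_Int_openin:
  assumes "openin (mtop M) W"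
  shows "openin (top_of_set (mmodel M)) (\<phi> ` (U \<inter> W))"
proof -
  have "openin (subtopology (mtop M) U) (U \<inter> W)"
    using assms by (metis Int_commute openin_subtopology)
  then have "openin (top_of_set (\<phi> ` U)) (\<phi> ` (U \<inter> W))"
    using homeomorphic_imp_open_map[OF chart_homeo] by (auto simp: open_map_def)
  then show ?thesis using chart_image_openin openin_trans by blast
qed

lemma chart_image_Int_open:
  assumes "openin (mtop M) W"
  obtains T where "open T" "\<phi> ` (U \<inter> W) = mmodel M \<inter> T"
  using chart_image_Int_openin[OF assms] by (auto simp: openin_open)

lemma chart_inv_continuous: "continuous_map (top_of_set (\<phi> ` U)) (mtop M) (inv_into U \<phi>)"
proof -
  obtain g where g: "homeomorphic_maps (subtopology (mtop M) U) (top_of_set (\<phi> ` U)) \<phi> g"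
    using chart_homeo by (auto simp: homeomorphic_map_maps)
  then have "continuous_map (top_of_set (\<phi> ` U)) (mtop M) g"
    by (auto simp: homeomorphic_maps_def continuous_map_in_subtopology)
  moreover have "g y = inv_into U \<phi> y" if "y \<in> topspace (top_of_set (\<phi> ` U))" for y
    using g that chart_subset by (auto simp: homeomorphic_maps_def)
  ultimately show ?thesis by (rule continuous_map_eq)
qed

lemma chart_smooth: "smooth_into M U \<phi>"
proof (rule smooth_intoI[OF chart_openin])
  fix V \<psi> assume V: "(V, \<psi>) \<in> matlas M"
  have "\<forall>(U, \<phi>)\<in>matlas M. \<forall>(V, \<psi>)\<in>matlas M. smooth_on (\<phi> ` (U \<inter> V)) (\<psi> \<circ> inv_into U \<phi>)"
    using mfd by (simp add: smooth_manifold_def)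
  from bspec[OF this V] have "\<forall>(U, \<phi>)\<in>matlas M. smooth_on (\<psi> ` (V \<inter> U)) (\<phi> \<circ> inv_into V \<psi>)"
    by simp
  from bspec[OF this chart] show "smooth_on (\<psi> ` (V \<inter> U)) (\<phi> \<circ> inv_into V \<psi>)"
    by simp
qed

end

lemma smooth_into_subset:
  assumes "smooth_into M W f" "openin (mtop M) V" "V \<subseteq> W"
  shows "smooth_into M V f"
proof (rule smooth_intoI[OF assms(2)])
  fix U \<phi> assume "(U, \<phi>) \<in> matlas M"
  from smooth_intoD[OF assms(1) this] show "smooth_on (\<phi> ` (U \<inter> V)) (f \<circ> inv_into U \<phi>)"
    by (rule smooth_on_subset) (use assms(3) in auto)
qed

lemma smooth_into_cong:
  assumes "smooth_into M W f" "\<And>p. p \<in> W \<Longrightarrow> f p = g p"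
  shows "smooth_into M W g"
proof (rule smooth_intoI[OF smooth_into_openin[OF assms(1)]])
  fix U \<phi> assume U: "(U, \<phi>) \<in> matlas M"
  from smooth_intoD[OF assms(1) U] show "smooth_on (\<phi> ` (U \<inter> W)) (g \<circ> inv_into U \<phi>)"
    by (rule smooth_on_cong) (use U assms(2) in auto)
qed

lemma smooth_into_compose_left:
  fixes f :: "'m \<Rightarrow> 'b::euclidean_space" and g :: "'b \<Rightarrow> 'c::real_normed_vector"
  assumes "smooth_into M W f" "smooth_on UNIV g"
  shows "smooth_into M W (\<lambda>p. g (f p))"
proof (rule smooth_intoI[OF smooth_into_openin[OF assms(1)]])
  fix U \<phi> assume U: "(U, \<phi>) \<in> matlas M"
  show "smooth_on (\<phi> ` (U \<inter> W)) ((\<lambda>p. g (f p)) \<circ> inv_into U \<phi>)"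
    using smooth_on_compose[OF assms(2) smooth_intoD[OF assms(1) U]] by (simp add: comp_def)
qed

lemma smooth_into_add:
  assumes "smooth_into M W f" "smooth_into M W g"
  shows "smooth_into M W (\<lambda>p. f p + g p)"
proof (rule smooth_intoI[OF smooth_into_openin[OF assms(1)]])
  fix U \<phi> assume U: "(U, \<phi>) \<in> matlas M"
  show "smooth_on (\<phi> ` (U \<inter> W)) ((\<lambda>p. f p + g p) \<circ> inv_into U \<phi>)"
    using smooth_on_add[OF smooth_intoD[OF assms(1) U] smooth_intoD[OF assms(2) U]] by (simp add: comp_def)
qed

lemma smooth_into_mult:
  fixes f g :: "'m \<Rightarrow> real"
  assumes "smooth_into M W f" "smooth_into M W g"
  shows "smooth_into M W (\<lambda>p. f p * g p)"
proof (rule smooth_intoI[OF smooth_into_openin[OF assms(1)]])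
  fix U \<phi> assume U: "(U, \<phi>) \<in> matlas M"
  show "smooth_on (\<phi> ` (U \<inter> W)) ((\<lambda>p. f p * g p) \<circ> inv_into U \<phi>)"
    using smooth_on_mult[OF smooth_intoD[OF assms(1) U] smooth_intoD[OF assms(2) U]] by (simp add: comp_def)
qed

lemma smooth_into_const: "openin (mtop M) W \<Longrightarrow> smooth_into M W (\<lambda>p. c)"
  by (rule smooth_intoI) (simp_all add: comp_def smooth_on_const)

lemma smooth_into_sum:
  assumes "openin (mtop M) W" "\<And>i. i \<in> I \<Longrightarrow> smooth_into M W (f i)"
  shows "smooth_into M W (\<lambda>p. \<Sum>i\<in>I. f i p)"
  using assms(2)
  by (induction I rule: infinite_finite_induct) (auto intro: smooth_into_add smooth_into_const assms(1))

end

lemma smooth_mapD: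
  "smooth_map M N F \<Longrightarrow> continuous_map (mtop M) (mtop N) F"
  by (simp add: smooth_map_def)

lemma smooth_map_pts: "smooth_map M N F \<Longrightarrow> p \<in> pts M \<Longrightarrow> F p \<in> pts N"
  using continuous_map_image_subset_topspace[OF smooth_mapD] by fastforce

lemma smooth_map_vimage_openin:
  "smooth_map M N F \<Longrightarrow> openin (mtop N) W \<Longrightarrow> openin (mtop M) (pts M \<inter> F -` W)"
  using openin_continuous_map_preimage[OF smooth_mapD] by (fastforce simp: vimage_def Int_def)

lemma smooth_map_chart:
  assumes "smooth_map M N F" "(U, \<phi>) \<in> matlas M" "(V, \<psi>) \<in> matlas N"
  shows "smooth_on (\<phi> ` (U \<inter> F -` V)) (\<psi> \<circ> F \<circ> inv_into U \<phi>)"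
proof -
  have "\<forall>(U, \<phi>)\<in>matlas M. \<forall>(V, \<psi>)\<in>matlas N. smooth_on (\<phi> ` (U \<inter> F -` V)) (\<psi> \<circ> F \<circ> inv_into U \<phi>)"
    using assms(1) by (simp add: smooth_map_def)
  from bspec[OF this assms(2)]
  have "\<forall>(V, \<psi>)\<in>matlas N. smooth_on (\<phi> ` (U \<inter> F -` V)) (\<psi> \<circ> F \<circ> inv_into U \<phi>)" by simp
  from bspec[OF this assms(3)] show ?thesis by simp
qed

lemma smooth_mapI:
  assumes "continuous_map (mtop M) (mtop N) F"
    and "\<And>U \<phi> V \<psi>. (U, \<phi>) \<in> matlas M \<Longrightarrow> (V, \<psi>) \<in> matlas N \<Longrightarrow>
      smooth_on (\<phi> ` (U \<inter> F -` V)) (\<psi> \<circ> F \<circ> inv_into U \<phi>)"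
  shows "smooth_map M N F"
  unfolding smooth_map_def using assms(1) by (auto intro: assms(2))

lemma (in smooth_mfd) chart_Int_vimage:
  "(U, \<phi>) \<in> matlas M \<Longrightarrow> U \<inter> (pts M \<inter> F -` V) = U \<inter> F -` V"
  using chart_subset by auto

text \<open>\<open>F\<close> is a total function and may send points outside \<open>M\<close> into
  \<open>V\<close>. Cutting the preimage down to \<open>pts M\<close> makes it an open set of
  \<open>M\<close>.\<close>

lemma smooth_map_smooth_into:
  assumes "smooth_manifold M" "smooth_manifold N" "smooth_map M N F" "(V, \<psi>) \<in> matlas N"
  shows "smooth_into M (pts M \<inter> F -` V) (\<psi> \<circ> F)"
proof -
  interpret M: smooth_mfd M by (rule smooth_mfd.intro) fact
  interpret N: smooth_mfd N by (rule smooth_mfd.intro) fact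
  show ?thesis
  proof (rule smooth_intoI)
    show "openin (mtop M) (pts M \<inter> F -` V)"
      by (rule smooth_map_vimage_openin[OF assms(3) N.chart_openin[OF assms(4)]])
    show "smooth_on (\<phi> ` (U \<inter> (pts M \<inter> F -` V))) (\<psi> \<circ> F \<circ> inv_into U \<phi>)"
      if U: "(U, \<phi>) \<in> matlas M" for U \<phi>
      unfolding M.chart_Int_vimage[OF U] by (rule smooth_map_chart[OF assms(3) U assms(4)])
  qed
qed

lemma smooth_mapI_smooth_into:
  assumes "smooth_manifold M" "continuous_map (mtop M) (mtop N) F"
    and "\<And>V \<psi>. (V, \<psi>) \<in> matlas N \<Longrightarrow> smooth_into M (pts M \<inter> F -` V) (\<psi> \<circ> F)"
  shows "smooth_map M N F"
proof -
  interpret M: smooth_mfd M by (rule smooth_mfd.intro) fact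
  show ?thesis
  proof (rule smooth_mapI[OF assms(2)])
    fix U \<phi> V \<psi> assume UV: "(U, \<phi>) \<in> matlas M" "(V, \<psi>) \<in> matlas N"
    show "smooth_on (\<phi> ` (U \<inter> F -` V)) (\<psi> \<circ> F \<circ> inv_into U \<phi>)"
      using smooth_intoD[OF assms(3)[OF UV(2)] UV(1)] unfolding M.chart_Int_vimage[OF UV(1)] .
  qed
qed

text \<open>The local expression of the composite is factored through a chart of \<open>N\<close>
  around \<open>F p\<close>. This works only near \<open>p\<close>, hence the use of
  \<open>smooth_on_local\<close>.\<close>

lemma smooth_into_compose:
  fixes f :: "'n \<Rightarrow> 'b::real_normed_vector"
  assumes "smooth_manifold M" "smooth_manifold N" "smooth_map M N F" "smooth_into N W f"
  shows "smooth_into M (pts M \<inter> F -` W) (f \<circ> F)"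
proof -
  interpret M: smooth_mfd M by (rule smooth_mfd.intro) fact
  interpret N: smooth_mfd N by (rule smooth_mfd.intro) fact
  have W: "openin (mtop N) W" using assms(4) by (rule smooth_into_openin)
  have "smooth_on (\<phi> ` (U \<inter> (pts M \<inter> F -` W))) (f \<circ> F \<circ> inv_into U \<phi>)"
    if U: "(U, \<phi>) \<in> matlas M" for U \<phi>
  proof (rule smooth_on_local)
    fix y assume "y \<in> \<phi> ` (U \<inter> (pts M \<inter> F -` W))"
    then obtain p where p: "y = \<phi> p" "p \<in> U" "p \<in> pts M" "F p \<in> W" by auto
    then have "F p \<in> pts N" using smooth_map_pts[OF assms(3)] by auto
    then obtain V \<psi> where V: "(V, \<psi>) \<in> matlas N" "F p \<in> V" by (rule N.chart_exists)
    let ?O = "pts M \<inter> F -` (V \<inter> W)"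
    have "openin (mtop M) ?O"
      using N.chart_openin[OF V(1)] W by (intro smooth_map_vimage_openin[OF assms(3)] openin_Int)
    then obtain T where T: "open T" "\<phi> ` (U \<inter> ?O) = mmodel M \<inter> T"
      by (rule M.chart_image_Int_open[OF U])
    have sub: "\<phi> ` (U \<inter> (pts M \<inter> F -` W)) \<inter> T \<subseteq> \<phi> ` (U \<inter> ?O)"
      using M.chart_model[OF U] unfolding T(2) by auto
    have s1: "smooth_on (\<phi> ` (U \<inter> ?O)) (\<psi> \<circ> F \<circ> inv_into U \<phi>)"
      by (rule smooth_on_subset[OF smooth_map_chart[OF assms(3) U V(1)]]) auto
    have s2: "smooth_on (\<psi> ` (V \<inter> W)) (f \<circ> inv_into V \<psi>)"
      using assms(4) V(1) by (rule smooth_intoD)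
    have "smooth_on (\<phi> ` (U \<inter> ?O)) (\<lambda>x. (f \<circ> inv_into V \<psi>) ((\<psi> \<circ> F \<circ> inv_into U \<phi>) x))"
      by (rule smooth_on_compose[OF s2 s1]) (use M.chart_inv[OF U] in auto)
    then have "smooth_on (\<phi> ` (U \<inter> ?O)) (f \<circ> F \<circ> inv_into U \<phi>)"
      by (rule smooth_on_cong) (use M.chart_inv[OF U] N.chart_inv[OF V(1)] in auto)
    then have "smooth_on (\<phi> ` (U \<inter> (pts M \<inter> F -` W)) \<inter> T) (f \<circ> F \<circ> inv_into U \<phi>)"
      using sub by (rule smooth_on_subset)
    moreover have "y \<in> T" using p V T(2) by auto
    ultimately show "\<exists>T. open T \<and> y \<in> T \<and>
        smooth_on (\<phi> ` (U \<inter> (pts M \<inter> F -` W)) \<inter> T) (f \<circ> F \<circ> inv_into U \<phi>)"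
      using T(1) by blast
  qed
  then show ?thesis
    by (rule smooth_intoI[OF smooth_map_vimage_openin[OF assms(3) W]])
qed

lemma smooth_map_compose:
  assumes "smooth_manifold M" "smooth_manifold N" "smooth_manifold P"
    and "smooth_map M N F" "smooth_map N P G"
  shows "smooth_map M P (G \<circ> F)"
proof (rule smooth_mapI_smooth_into[OF assms(1)])
  show "continuous_map (mtop M) (mtop P) (G \<circ> F)"
    using assms(4,5) by (auto intro: continuous_map_compose smooth_mapD)
next
  fix V \<psi> assume V: "(V, \<psi>) \<in> matlas P"
  have "smooth_into M (pts M \<inter> F -` (pts N \<inter> G -` V)) (\<psi> \<circ> G \<circ> F)"
    by (rule smooth_into_compose[OF assms(1,2,4) smooth_map_smooth_into[OF assms(2,3,5) V]])
  moreover have "pts M \<inter> F -` (pts N \<inter> G -` V) = pts M \<inter> (G \<circ> F) -` V"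
    using smooth_map_pts[OF assms(4)] by auto
  ultimately show "smooth_into M (pts M \<inter> (G \<circ> F) -` V) (\<psi> \<circ> (G \<circ> F))" by (simp add: comp_assoc)
qed

lemma smooth_fun_compose:
  assumes "smooth_manifold M" "smooth_manifold N" "smooth_map M N F" "smooth_fun N W f"
  shows "smooth_fun M (pts M \<inter> F -` W) (f \<circ> F)"
  using smooth_into_compose[OF assms(1-3)] assms(4) by (simp add: smooth_fun_iff)

lemma smooth_at_compose:
  assumes "smooth_manifold M" "smooth_manifold N" "smooth_map M N F" "p \<in> pts M" "smooth_at N (F p) f"
  shows "smooth_at M p (f \<circ> F)"
proof -
  obtain W where "F p \<in> W" "smooth_fun N W f" using assms(5) unfolding smooth_at_def by (elim exE conjE)
  then show ?thesis
    using smooth_fun_compose[OF assms(1-3)] assms(4) unfolding smooth_at_def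
    by (intro exI[of _ "pts M \<inter> F -` W"]) simp
qed

section \<open>Linear subspaces and products as manifolds\<close>

lemma second_countable_euclidean: "second_countable (euclidean :: 'a::euclidean_space topology)"
proof -
  obtain \<B> :: "'a set set" where \<B>: "countable \<B>" "\<And>C. C \<in> \<B> \<Longrightarrow> open C"
    "\<And>S. open S \<Longrightarrow> \<exists>U. U \<subseteq> \<B> \<and> S = \<Union>U"
    by (rule univ_second_countable) blast
  have "\<exists>V\<in>\<B>. x \<in> V \<and> V \<subseteq> U" if U: "open U" "x \<in> U" for U x
    using \<B>(3)[OF U(1)] U(2) by auto
  then show ?thesis
    unfolding second_countable_def using \<B>(1,2) by (intro exI[of _ \<B>]) auto
qed

lemma smooth_manifold_subspace_mfd:
  assumes "subspace B"
  shows "smooth_manifold (subspace_mfd B)"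
  unfolding smooth_manifold_def
proof (intro conjI)
  show "second_countable (mtop (subspace_mfd B))"
    by (simp add: subspace_mfd_def second_countable_subtopology second_countable_euclidean)
  have "inv_into B id x = x" if "x \<in> B" for x using inv_into_f_f[of id B x] that by simp
  then have "smooth_on B (id \<circ> inv_into B id)"
    by (intro smooth_on_cong[OF smooth_on_id]) simp
  then show "\<forall>(U, \<phi>)\<in>matlas (subspace_mfd B). \<forall>(V, \<psi>)\<in>matlas (subspace_mfd B).
      smooth_on (\<phi> ` (U \<inter> V)) (\<psi> \<circ> inv_into U \<phi>)"
    by (simp add: subspace_mfd_def)
qed (use assms in \<open>auto simp: subspace_mfd_def Hausdorff_space_subtopology subtopology_subtopology\<close>)

lemma pts_subspace_mfd [simp]: "pts (subspace_mfd B) = B"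
  by (simp add: subspace_mfd_def)

text \<open>The only chart is \<open>id\<close>, and \<open>inv_into B id\<close> is the identity on
  \<open>B\<close> alone; this is enough because \<open>W\<close> lies in \<open>B\<close>.\<close>

lemma smooth_into_subspace_mfd:
  "smooth_into (subspace_mfd B) W f \<longleftrightarrow> openin (top_of_set B) W \<and> smooth_on W f"
proof -
  have inv: "inv_into B id x = x" if "x \<in> B" for x using inv_into_f_f[of id B x] that by simp
  have "smooth_on (B \<inter> W) (f \<circ> inv_into B id) \<longleftrightarrow> smooth_on W f" if "W \<subseteq> B"
  proof -
    have "B \<inter> W = W" using that by auto
    then show ?thesis
      using smooth_on_cong[of W f "f \<circ> inv_into B id"] smooth_on_cong[of W "f \<circ> inv_into B id" f] inv that
      by (metis comp_apply subsetD)
  qed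
  then show ?thesis
    unfolding smooth_into_def by (auto simp: subspace_mfd_def dest: openin_subset)
qed

lemma smooth_map_subspaceI:
  assumes "subspace B" "smooth_manifold N" "continuous_map (top_of_set B) (mtop N) F"
    and "\<And>V \<psi>. (V, \<psi>) \<in> matlas N \<Longrightarrow> smooth_on (B \<inter> F -` V) (\<psi> \<circ> F)"
  shows "smooth_map (subspace_mfd B) N F"
proof (rule smooth_mapI_smooth_into[OF smooth_manifold_subspace_mfd[OF assms(1)]])
  interpret N: smooth_mfd N by (rule smooth_mfd.intro) fact
  show c: "continuous_map (mtop (subspace_mfd B)) (mtop N) F"
    using assms(3) by (simp add: subspace_mfd_def)
  fix V \<psi> assume V: "(V, \<psi>) \<in> matlas N"
  have "openin (top_of_set B) (B \<inter> F -` V)"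
    using openin_continuous_map_preimage[OF assms(3) N.chart_openin[OF V]]
    by (simp add: vimage_def Int_def)
  then show "smooth_into (subspace_mfd B) (pts (subspace_mfd B) \<inter> F -` V) (\<psi> \<circ> F)"
    using assms(4)[OF V] by (simp add: smooth_into_subspace_mfd)
qed

lemma smooth_map_subspaceD:
  assumes "subspace B" "smooth_manifold N" "smooth_map (subspace_mfd B) N F" "(V, \<psi>) \<in> matlas N"
  shows "openin (top_of_set B) (B \<inter> F -` V)" "smooth_on (B \<inter> F -` V) (\<psi> \<circ> F)"
  using smooth_map_smooth_into[OF smooth_manifold_subspace_mfd[OF assms(1)] assms(2-4)]
  by (simp_all add: smooth_into_subspace_mfd)

lemma smooth_on_map_prod:
  fixes f :: "'a::euclidean_space \<Rightarrow> 'b::real_normed_vector" and g :: "'c::euclidean_space \<Rightarrow> 'd::real_normed_vector"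
  assumes "smooth_on S f" "smooth_on T g"
  shows "smooth_on (S \<times> T) (map_prod f g)"
proof -
  have "smooth_on (S \<times> T) (\<lambda>x. (f (fst x), g (snd x)))"
  proof (rule smooth_on_Pair)
    show "smooth_on (S \<times> T) (\<lambda>x. f (fst x))"
      by (rule smooth_on_compose[OF assms(1) smooth_on_bounded_linear[OF bounded_linear_fst]]) auto
    show "smooth_on (S \<times> T) (\<lambda>x. g (snd x))"
      by (rule smooth_on_compose[OF assms(2) smooth_on_bounded_linear[OF bounded_linear_snd]]) auto
  qed
  then show ?thesis by (simp add: map_prod_def case_prod_unfold)
qed

lemma second_countable_prod_topology:
  assumes "second_countable X" "second_countable Y"
  shows "second_countable (prod_topology X Y)"
proof -
  obtain \<B> where \<B>: "countable \<B>" "\<forall>V\<in>\<B>. openin X V"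
    "\<forall>U x. openin X U \<and> x \<in> U \<longrightarrow> (\<exists>V\<in>\<B>. x \<in> V \<and> V \<subseteq> U)"
    using assms(1) unfolding second_countable_def by (elim exE conjE)
  obtain \<C> where \<C>: "countable \<C>" "\<forall>V\<in>\<C>. openin Y V"
    "\<forall>U x. openin Y U \<and> x \<in> U \<longrightarrow> (\<exists>V\<in>\<C>. x \<in> V \<and> V \<subseteq> U)"
    using assms(2) unfolding second_countable_def by (elim exE conjE)
  let ?D = "(\<lambda>(V, W). V \<times> W) ` (\<B> \<times> \<C>)"
  have "\<exists>V\<in>?D. z \<in> V \<and> V \<subseteq> U" if U: "openin (prod_topology X Y) U" "z \<in> U" for U z
  proof -
    obtain x y where z: "z = (x, y)" by fastforce
    obtain A B where AB: "openin X A" "openin Y B" "x \<in> A" "y \<in> B" "A \<times> B \<subseteq> U"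
      using U unfolding openin_prod_topology_alt z by meson
    obtain V W where VW: "V \<in> \<B>" "x \<in> V" "V \<subseteq> A" "W \<in> \<C>" "y \<in> W" "W \<subseteq> B"
      using \<B>(3) \<C>(3) AB(1-4) by meson
    then have "V \<times> W \<in> ?D" "z \<in> V \<times> W" "V \<times> W \<subseteq> U"
      using AB(5) z by (auto intro!: image_eqI[of _ _ "(V, W)"])
    then show ?thesis by blast
  qed
  moreover have "countable ?D" using \<B>(1) \<C>(1) by auto
  moreover have "openin (prod_topology X Y) D" if "D \<in> ?D" for D
    using that \<B>(2) \<C>(2) by (auto simp: openin_prod_Times_iff)
  ultimately show ?thesis unfolding second_countable_def by (intro exI[of _ ?D]) auto
qed

lemma inv_into_map_prod:
  assumes "inj_on \<phi> U" "inj_on \<psi> V" "a \<in> \<phi> ` U" "b \<in> \<psi> ` V"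
  shows "inv_into (U \<times> V) (map_prod \<phi> \<psi>) (a, b) = (inv_into U \<phi> a, inv_into V \<psi> b)"
proof -
  obtain p q where pq: "a = \<phi> p" "p \<in> U" "b = \<psi> q" "q \<in> V" using assms by auto
  have "inj_on (map_prod \<phi> \<psi>) (U \<times> V)" using assms by (auto simp: inj_on_def)
  from inv_into_f_f[OF this, of "(p, q)"] show ?thesis using pq assms by simp
qed

lemma homeomorphic_map_prod_topology:
  assumes "homeomorphic_map X X' f" "homeomorphic_map Y Y' g"
  shows "homeomorphic_map (prod_topology X Y) (prod_topology X' Y') (map_prod f g)"
proof -
  obtain f' g' where "homeomorphic_maps X X' f f'" "homeomorphic_maps Y Y' g g'"
    using assms by (auto simp: homeomorphic_map_maps)
  then have "homeomorphic_maps (prod_topology X Y) (prod_topology X' Y')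
      (\<lambda>(x, y). (f x, g y)) (\<lambda>(x, y). (f' x, g' y))"
    by (simp add: homeomorphic_maps_prod)
  then show ?thesis by (auto simp: homeomorphic_map_maps map_prod_def)
qed

lemma smooth_manifold_prod_mfd:
  assumes "smooth_manifold M" "smooth_manifold N"
  shows "smooth_manifold (prod_mfd M N)"
proof -
  interpret M: smooth_mfd M by (rule smooth_mfd.intro) fact
  interpret N: smooth_mfd N by (rule smooth_mfd.intro) fact
  have atlas: "\<exists>U \<phi> V \<psi>. (U, \<phi>) \<in> matlas M \<and> (V, \<psi>) \<in> matlas N \<and> c = (U \<times> V, map_prod \<phi> \<psi>)"
    if "c \<in> matlas (prod_mfd M N)" for c
    using that by (auto simp: prod_mfd_def)
  have mem: "(U \<times> V, map_prod \<phi> \<psi>) \<in> matlas (prod_mfd M N)"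
    if "(U, \<phi>) \<in> matlas M" "(V, \<psi>) \<in> matlas N" for U \<phi> V \<psi>
    using that by (auto simp: prod_mfd_def)
  show ?thesis
    unfolding smooth_manifold_def
  proof (intro conjI)
    show "subspace (mmodel (prod_mfd M N))"
      using subspace_Times[OF M.model N.model] by (simp add: prod_mfd_def)
    show "Hausdorff_space (mtop (prod_mfd M N))"
      using M.Hausdorff N.Hausdorff by (simp add: prod_mfd_def Hausdorff_space_prod_topology)
    show "second_countable (mtop (prod_mfd M N))"
      using assms by (simp add: prod_mfd_def second_countable_prod_topology smooth_manifold_def)
    show "(\<Union>(U, \<phi>)\<in>matlas (prod_mfd M N). U) = pts (prod_mfd M N)"
    proof (intro equalityI subsetI)
      fix z assume "z \<in> (\<Union>(U, \<phi>)\<in>matlas (prod_mfd M N). U)"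
      then obtain c where c: "c \<in> matlas (prod_mfd M N)" "z \<in> fst c" by auto
      then show "z \<in> pts (prod_mfd M N)"
        using atlas[OF c(1)] M.chart_subset N.chart_subset by (fastforce simp: prod_mfd_def)
    next
      fix z assume "z \<in> pts (prod_mfd M N)"
      then have "fst z \<in> pts M" "snd z \<in> pts N" by (auto simp: prod_mfd_def)
      then obtain U \<phi> V \<psi> where "(U, \<phi>) \<in> matlas M" "fst z \<in> U" "(V, \<psi>) \<in> matlas N" "snd z \<in> V"
        by (metis M.chart_exists N.chart_exists)
      then show "z \<in> (\<Union>(U, \<phi>)\<in>matlas (prod_mfd M N). U)"
        by (intro UN_I[OF mem[of U \<phi> V \<psi>]]) (auto simp: mem_Times_iff)
    qed
    show "\<forall>(U, \<phi>)\<in>matlas (prod_mfd M N). openin (mtop (prod_mfd M N)) U \<and>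
      openin (top_of_set (mmodel (prod_mfd M N))) (\<phi> ` U) \<and>
      homeomorphic_map (subtopology (mtop (prod_mfd M N)) U) (top_of_set (\<phi> ` U)) \<phi>"
    proof
      fix c assume "c \<in> matlas (prod_mfd M N)"
      from atlas[OF this] obtain U \<phi> V \<psi> where c: "c = (U \<times> V, map_prod \<phi> \<psi>)"
        and U: "(U, \<phi>) \<in> matlas M" and V: "(V, \<psi>) \<in> matlas N" by blast
      have img: "map_prod \<phi> \<psi> ` (U \<times> V) = (\<phi> ` U) \<times> (\<psi> ` V)" by auto
      have "openin (prod_topology (mtop M) (mtop N)) (U \<times> V)"
        using M.chart_openin[OF U] N.chart_openin[OF V] by (simp add: openin_prod_Times_iff)
      moreover have "openin (top_of_set (mmodel M \<times> mmodel N)) (\<phi> ` U \<times> \<psi> ` V)"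
        using M.chart_image_openin[OF U] N.chart_image_openin[OF V] by (rule openin_Times)
      moreover have "homeomorphic_map (subtopology (prod_topology (mtop M) (mtop N)) (U \<times> V))
          (top_of_set (\<phi> ` U \<times> \<psi> ` V)) (map_prod \<phi> \<psi>)"
        using homeomorphic_map_prod_topology[OF M.chart_homeo[OF U] N.chart_homeo[OF V]]
        by (simp add: subtopology_Times euclidean_product_topology)
      ultimately show "case c of (U, \<phi>) \<Rightarrow> openin (mtop (prod_mfd M N)) U \<and>
          openin (top_of_set (mmodel (prod_mfd M N))) (\<phi> ` U) \<and>
          homeomorphic_map (subtopology (mtop (prod_mfd M N)) U) (top_of_set (\<phi> ` U)) \<phi>"
        unfolding c by (simp add: prod_mfd_def img)
    qed
    show "\<forall>(U, \<phi>)\<in>matlas (prod_mfd M N). \<forall>(V, \<psi>)\<in>matlas (prod_mfd M N).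
       smooth_on (\<phi> ` (U \<inter> V)) (\<psi> \<circ> inv_into U \<phi>)"
    proof
      fix c assume "c \<in> matlas (prod_mfd M N)"
      from atlas[OF this] obtain U \<phi> V \<psi> where c: "c = (U \<times> V, map_prod \<phi> \<psi>)"
        and U: "(U, \<phi>) \<in> matlas M" and V: "(V, \<psi>) \<in> matlas N" by blast
      have "case d of (W, \<kappa>) \<Rightarrow>
          smooth_on (map_prod \<phi> \<psi> ` (U \<times> V \<inter> W)) (\<kappa> \<circ> inv_into (U \<times> V) (map_prod \<phi> \<psi>))"
        if "d \<in> matlas (prod_mfd M N)" for d
      proof -
        from atlas[OF that] obtain U' \<phi>' V' \<psi>' where d: "d = (U' \<times> V', map_prod \<phi>' \<psi>')"
          and U': "(U', \<phi>') \<in> matlas M" and V': "(V', \<psi>') \<in> matlas N" by blast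
        have img: "map_prod \<phi> \<psi> ` ((U \<times> V) \<inter> (U' \<times> V')) = (\<phi> ` (U \<inter> U')) \<times> (\<psi> ` (V \<inter> V'))" by auto
        have "smooth_on ((\<phi> ` (U \<inter> U')) \<times> (\<psi> ` (V \<inter> V')))
            (map_prod (\<phi>' \<circ> inv_into U \<phi>) (\<psi>' \<circ> inv_into V \<psi>))"
          by (intro smooth_on_map_prod smooth_intoD[OF M.chart_smooth] smooth_intoD[OF N.chart_smooth] U V U' V')
        then have "smooth_on ((\<phi> ` (U \<inter> U')) \<times> (\<psi> ` (V \<inter> V')))
            (map_prod \<phi>' \<psi>' \<circ> inv_into (U \<times> V) (map_prod \<phi> \<psi>))"
          by (rule smooth_on_cong)
            (auto simp: inv_into_map_prod[OF M.chart_inj[OF U] N.chart_inj[OF V]])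
        then show ?thesis unfolding d by (simp only: prod.case img)
      qed
      then show "case c of (U, \<phi>) \<Rightarrow> \<forall>(V, \<psi>)\<in>matlas (prod_mfd M N).
          smooth_on (\<phi> ` (U \<inter> V)) (\<psi> \<circ> inv_into U \<phi>)"
        unfolding c by (simp only: prod.case) blast
    qed
  qed
qed

lemma pts_prod_mfd: "pts (prod_mfd M N) = pts M \<times> pts N"
  by (simp add: prod_mfd_def)

lemma (in smooth_mfd) smooth_into_Pair:
  assumes "smooth_into M W f" "smooth_into M W g"
  shows "smooth_into M W (\<lambda>p. (f p, g p))"
proof (rule smooth_intoI[OF smooth_into_openin[OF assms(1)]])
  fix U \<phi> assume U: "(U, \<phi>) \<in> matlas M"
  show "smooth_on (\<phi> ` (U \<inter> W)) ((\<lambda>p. (f p, g p)) \<circ> inv_into U \<phi>)"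
    using smooth_on_Pair[OF smooth_intoD[OF assms(1) U] smooth_intoD[OF assms(2) U]] by (simp add: comp_def)
qed

lemma smooth_map_Pair:
  assumes "smooth_manifold P" "smooth_manifold M" "smooth_manifold N"
    and "smooth_map P M F" "smooth_map P N G"
  shows "smooth_map P (prod_mfd M N) (\<lambda>p. (F p, G p))"
proof (rule smooth_mapI_smooth_into[OF assms(1)])
  interpret P: smooth_mfd P by (rule smooth_mfd.intro) fact
  show c: "continuous_map (mtop P) (mtop (prod_mfd M N)) (\<lambda>p. (F p, G p))"
    using smooth_mapD[OF assms(4)] smooth_mapD[OF assms(5)]
    by (simp add: prod_mfd_def continuous_map_pairedI)
  fix W \<kappa> assume "(W, \<kappa>) \<in> matlas (prod_mfd M N)"
  then obtain U \<phi> V \<psi> where W: "W = U \<times> V" "\<kappa> = map_prod \<phi> \<psi>"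
    and U: "(U, \<phi>) \<in> matlas M" and V: "(V, \<psi>) \<in> matlas N" by (auto simp: prod_mfd_def)
  have F: "smooth_into P (pts P \<inter> F -` U) (\<phi> \<circ> F)"
    by (rule smooth_map_smooth_into[OF assms(1,2,4) U])
  have G: "smooth_into P (pts P \<inter> G -` V) (\<psi> \<circ> G)"
    by (rule smooth_map_smooth_into[OF assms(1,3,5) V])
  have op: "openin (mtop P) ((pts P \<inter> F -` U) \<inter> (pts P \<inter> G -` V))"
    using smooth_into_openin[OF F] smooth_into_openin[OF G] by (rule openin_Int)
  have "smooth_into P ((pts P \<inter> F -` U) \<inter> (pts P \<inter> G -` V)) (\<lambda>p. ((\<phi> \<circ> F) p, (\<psi> \<circ> G) p))"
    by (intro P.smooth_into_Pair P.smooth_into_subset[OF F op] P.smooth_into_subset[OF G op]) auto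
  moreover have "(pts P \<inter> F -` U) \<inter> (pts P \<inter> G -` V) = pts P \<inter> (\<lambda>p. (F p, G p)) -` W"
    using W by auto
  ultimately show "smooth_into P (pts P \<inter> (\<lambda>p. (F p, G p)) -` W) (\<kappa> \<circ> (\<lambda>p. (F p, G p)))"
    using W by (simp add: comp_def)
qed

lemma smooth_map_const:
  assumes "smooth_manifold P" "c \<in> pts M"
  shows "smooth_map P M (\<lambda>p. c)"
proof (rule smooth_mapI_smooth_into[OF assms(1)])
  interpret P: smooth_mfd P by (rule smooth_mfd.intro) fact
  show "continuous_map (mtop P) (mtop M) (\<lambda>p. c)"
    using assms(2) by simp
  fix V \<psi> assume "(V, \<psi>) \<in> matlas M"
  have "openin (mtop P) (pts P \<inter> (\<lambda>p. c) -` V)" by (cases "c \<in> V") auto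
  from P.smooth_into_const[OF this, of "\<psi> c"]
  show "smooth_into P (pts P \<inter> (\<lambda>p. c) -` V) (\<psi> \<circ> (\<lambda>p. c))"
    by (simp only: comp_def)
qed

lemma smooth_map_id:
  assumes "smooth_manifold M"
  shows "smooth_map M M (\<lambda>p. p)"
proof (rule smooth_mapI_smooth_into[OF assms(1)])
  interpret smooth_mfd M by (rule smooth_mfd.intro) fact
  show "continuous_map (mtop M) (mtop M) (\<lambda>p. p)"
    using continuous_map_id[of "mtop M"] by (simp add: id_def)
  fix V \<psi> assume V: "(V, \<psi>) \<in> matlas M"
  then have "pts M \<inter> (\<lambda>p. p) -` V = V" using chart_subset by auto
  then show "smooth_into M (pts M \<inter> (\<lambda>p. p) -` V) (\<psi> \<circ> (\<lambda>p. p))"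
    using chart_smooth[OF V] by (simp add: comp_def)
qed

section \<open>Tangent vectors in a chart\<close>

text \<open>Only differentiability at 0 is asked, so that coordinate lines qualify although they may
  leave the chart after a short time.\<close>

definition chart_deriv ::
    "'m set \<Rightarrow> ('m \<Rightarrow> 'e::euclidean_space) \<Rightarrow> (real \<Rightarrow> 'm) \<Rightarrow> 'e \<Rightarrow> bool" where
  "chart_deriv U \<phi> \<gamma> v \<longleftrightarrow>
     (\<forall>\<^sub>F t in nhds 0. \<gamma> t \<in> U) \<and> ((\<lambda>t. \<phi> (\<gamma> t)) has_vector_derivative v) (at 0)"

lemma chart_deriv_mem: "chart_deriv U \<phi> \<gamma> v \<Longrightarrow> \<gamma> 0 \<in> U"
  unfolding chart_deriv_def by (auto dest: eventually_nhds_x_imp_x)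

text \<open>For \<open>v\<close> in the model space this is the tangent vector with coordinates
  \<open>v\<close>. Where the line has left the image of the chart, \<open>inv_into\<close> is
  arbitrary, but the velocity sees only small times.\<close>

definition chart_vec ::
    "('m, 'e::euclidean_space) mfd \<Rightarrow> 'm set \<Rightarrow> ('m \<Rightarrow> 'e) \<Rightarrow> 'm \<Rightarrow> 'e \<Rightarrow> 'm tvec" where
  "chart_vec M U \<phi> p v = velocity M (\<lambda>t. inv_into U \<phi> (\<phi> p + t *\<^sub>R v))"

context smooth_mfd
begin

text \<open>\<open>D\<close> is the derivative of a local extension of \<open>f\<close> read in the
  chart. It is fixed before the curve is chosen, which is what makes velocities depend on
  \<open>v\<close> alone, and linearly.\<close>

lemma chart_deriv_smooth_at:
  assumes U: "(U, \<phi>) \<in> matlas M" "p \<in> U" and f: "smooth_at M p f"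
  obtains D where "linear D"
    "\<forall>\<gamma> v. \<gamma> 0 = p \<and> chart_deriv U \<phi> \<gamma> v \<longrightarrow> ((\<lambda>t. f (\<gamma> t)) has_real_derivative D v) (at 0)"
proof -
  obtain W where W: "p \<in> W" "smooth_into M W f"
    using f unfolding smooth_at_def smooth_fun_iff by (elim exE conjE)
  have "\<phi> p \<in> \<phi> ` (U \<inter> W)" using U W by auto
  from smooth_onE[OF smooth_intoD[OF W(2) U(1)] this] obtain G g
    where G: "open G" "\<phi> p \<in> G" "\<forall>k. Ck_on k g G"
      "\<forall>y\<in>\<phi> ` (U \<inter> W) \<inter> G. g y = (f \<circ> inv_into U \<phi>) y" by blast
  obtain T where T: "open T" "\<phi> ` (U \<inter> W) = mmodel M \<inter> T"
    by (rule chart_image_Int_open[OF U(1) smooth_into_openin[OF W(2)]])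
  define D where "D = frechet_derivative g (at (\<phi> p))"
  have D: "(g has_derivative D) (at (\<phi> p))"
    unfolding D_def by (rule Ck_on_has_derivative[OF G(3)[THEN spec, of "Suc 0"] G(2)])
  have lin: "linear D" using D by (rule has_derivative_linear)
  have "((\<lambda>t. f (\<gamma> t)) has_real_derivative D v) (at 0)" if g0: "\<gamma> 0 = p" and c: "chart_deriv U \<phi> \<gamma> v" for \<gamma> v
  proof -
    have ev: "\<forall>\<^sub>F t in nhds 0. \<gamma> t \<in> U" and d: "((\<lambda>t. \<phi> (\<gamma> t)) has_vector_derivative v) (at 0)"
      using c by (auto simp: chart_deriv_def)
    have "isCont (\<lambda>t. \<phi> (\<gamma> t)) 0" using d by (rule has_vector_derivative_continuous)
    then have tend: "((\<lambda>t. \<phi> (\<gamma> t)) \<longlongrightarrow> \<phi> p) (nhds 0)"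
      using g0 tendsto_at_iff_tendsto_nhds[of "\<lambda>t. \<phi> (\<gamma> t)" 0] by (simp add: isCont_def)
    have "open (T \<inter> G)" "\<phi> p \<in> T \<inter> G" using T G \<open>\<phi> p \<in> \<phi> ` (U \<inter> W)\<close> by auto
    from topological_tendstoD[OF tend this] have "\<forall>\<^sub>F t in nhds 0. \<phi> (\<gamma> t) \<in> T \<inter> G" .
    with ev have "\<forall>\<^sub>F t in nhds 0. f (\<gamma> t) = g (\<phi> (\<gamma> t))"
    proof eventually_elim
      case (elim t)
      then have "\<phi> (\<gamma> t) \<in> \<phi> ` (U \<inter> W) \<inter> G" using T(2) chart_model[OF U(1)] by auto
      then have "g (\<phi> (\<gamma> t)) = (f \<circ> inv_into U \<phi>) (\<phi> (\<gamma> t))" using G(4) by blast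
      then show ?case using chart_inv[OF U(1)] elim by simp
    qed
    moreover have "((\<lambda>t. g (\<phi> (\<gamma> t))) has_real_derivative D v) (at 0)"
    proof -
      have "((\<lambda>t. g (\<phi> (\<gamma> t))) has_derivative (\<lambda>h. D (h *\<^sub>R v))) (at 0)"
        by (rule has_derivative_compose[OF d[unfolded has_vector_derivative_def]]) (use D g0 in simp)
      moreover have "(\<lambda>h. D (h *\<^sub>R v)) = (\<lambda>h. D v * h)"
        using linear_cmul[OF lin] by (simp add: mult.commute)
      ultimately show ?thesis by (simp add: has_field_derivative_def)
    qed
    ultimately show ?thesis by (subst DERIV_cong_ev[OF refl _ refl]) auto
  qed
  with lin show thesis by (intro that[of D]) auto
qed

lemma chart_deriv_line:
  assumes U: "(U, \<phi>) \<in> matlas M" "p \<in> U" and v: "v \<in> mmodel M"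
  shows "chart_deriv U \<phi> (\<lambda>t. inv_into U \<phi> (\<phi> p + t *\<^sub>R v)) v"
proof -
  obtain T where T: "open T" "\<phi> ` (U \<inter> pts M) = mmodel M \<inter> T"
    by (rule chart_image_Int_open[OF U(1) openin_topspace])
  have img: "\<phi> ` U = mmodel M \<inter> T" using T(2) chart_subset[OF U(1)] by (simp add: Int_absorb2)
  have tend: "((\<lambda>t. \<phi> p + t *\<^sub>R v) \<longlongrightarrow> \<phi> p + 0 *\<^sub>R v) (nhds 0)"
    by (intro tendsto_intros) (simp add: filterlim_ident)
  have ev: "\<forall>\<^sub>F t in nhds 0. \<phi> p + t *\<^sub>R v \<in> T"
    by (rule topological_tendstoD[OF tend T(1)]) (use U img in auto)
  have mem: "\<phi> p + t *\<^sub>R v \<in> \<phi> ` U" if "\<phi> p + t *\<^sub>R v \<in> T" for t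
    unfolding img using that chart_model[OF U] v model by (simp add: subspace_add subspace_scale)
  have e1: "\<forall>\<^sub>F t in nhds 0. inv_into U \<phi> (\<phi> p + t *\<^sub>R v) \<in> U"
    using ev by eventually_elim (rule inv_into_into[OF mem])
  have e2: "\<forall>\<^sub>F t in nhds 0. \<phi> p + t *\<^sub>R v = \<phi> (inv_into U \<phi> (\<phi> p + t *\<^sub>R v))"
    using ev by eventually_elim (simp add: f_inv_into_f[OF mem])
  have "((\<lambda>t. \<phi> p + t *\<^sub>R v) has_vector_derivative v) (at 0)"
    by (auto intro!: derivative_eq_intros)
  then have "((\<lambda>t. \<phi> (inv_into U \<phi> (\<phi> p + t *\<^sub>R v))) has_vector_derivative v) (at 0)"
    using has_vector_derivative_cong_ev[where x = 0 and S = UNIV and f' = v and f = "\<lambda>t. \<phi> p + t *\<^sub>R v"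
        and g = "\<lambda>t. \<phi> (inv_into U \<phi> (\<phi> p + t *\<^sub>R v))"] e2 eventually_nhds_x_imp_x[OF e2] by simp
  with e1 show ?thesis by (simp add: chart_deriv_def)
qed

lemma velocity_eq_chart_vec:
  assumes U: "(U, \<phi>) \<in> matlas M" and "\<gamma> 0 = p" "chart_deriv U \<phi> \<gamma> v" "v \<in> mmodel M"
  shows "velocity M \<gamma> = chart_vec M U \<phi> p v"
proof
  fix f
  have p: "p \<in> U" using chart_deriv_mem[OF assms(3)] assms(2) by simp
  let ?l = "\<lambda>t. inv_into U \<phi> (\<phi> p + t *\<^sub>R v)"
  have l: "?l 0 = p" "chart_deriv U \<phi> ?l v"
    using chart_deriv_line[OF U p assms(4)] p U by simp_all
  show "velocity M \<gamma> f = chart_vec M U \<phi> p v f"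
  proof (cases "smooth_at M p f")
    case True
    obtain D where D: "linear D"
      "\<forall>\<gamma> v. \<gamma> 0 = p \<and> chart_deriv U \<phi> \<gamma> v \<longrightarrow> ((\<lambda>t. f (\<gamma> t)) has_real_derivative D v) (at 0)"
      by (rule chart_deriv_smooth_at[OF U p True])
    have "deriv (\<lambda>t. f (\<gamma> t)) 0 = D v" "deriv (\<lambda>t. f (?l t)) 0 = D v"
      using D(2) assms l by (auto intro: DERIV_imp_deriv)
    then show ?thesis using True assms l by (simp add: velocity_def chart_vec_def)
  next
    case False
    then show ?thesis using assms l by (simp add: velocity_def chart_vec_def)
  qed
qed

lemma chart_vec_eq_0: "(U, \<phi>) \<in> matlas M \<Longrightarrow> p \<in> U \<Longrightarrow> \<not> smooth_at M p f \<Longrightarrow> chart_vec M U \<phi> p v f = 0"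
  by (simp add: velocity_def chart_vec_def)

lemma chart_vec_linear:
  assumes U: "(U, \<phi>) \<in> matlas M" "p \<in> U" and "v \<in> mmodel M" "w \<in> mmodel M"
  shows "chart_vec M U \<phi> p (a *\<^sub>R v + b *\<^sub>R w)
    = (\<lambda>f. a * chart_vec M U \<phi> p v f + b * chart_vec M U \<phi> p w f)"
proof
  fix f
  show "chart_vec M U \<phi> p (a *\<^sub>R v + b *\<^sub>R w) f
    = a * chart_vec M U \<phi> p v f + b * chart_vec M U \<phi> p w f"
  proof (cases "smooth_at M p f")
    case True
    obtain D where D: "linear D"
      "\<forall>\<gamma> v. \<gamma> 0 = p \<and> chart_deriv U \<phi> \<gamma> v \<longrightarrow> ((\<lambda>t. f (\<gamma> t)) has_real_derivative D v) (at 0)"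
      by (rule chart_deriv_smooth_at[OF U True])
    have "chart_vec M U \<phi> p u f = D u" if "u \<in> mmodel M" for u
    proof -
      have "deriv (\<lambda>t. f (inv_into U \<phi> (\<phi> p + t *\<^sub>R u))) 0 = D u"
        using D(2) chart_deriv_line[OF U that] U by (intro DERIV_imp_deriv) simp
      then show ?thesis using True U by (simp add: chart_vec_def velocity_def)
    qed
    then show ?thesis
      using assms model D(1) by (simp add: subspace_add subspace_scale linear_add linear_cmul)
  qed (simp add: chart_vec_eq_0[OF U])
qed

lemma chart_vec_inj:
  assumes U: "(U, \<phi>) \<in> matlas M" "p \<in> U"
  shows "inj_on (chart_vec M U \<phi> p) (mmodel M)"
proof (rule inj_onI, rule euclidean_eqI)
  fix v w and i :: 'e
  assume vw: "v \<in> mmodel M" "w \<in> mmodel M" and eq: "chart_vec M U \<phi> p v = chart_vec M U \<phi> p w"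
  \<comment> \<open>The coordinate functions of the chart, used as test functions, recover the
    components of the vector.\<close>
  let ?f = "\<lambda>q. \<phi> q \<bullet> i"
  have "smooth_into M U ?f"
    by (rule smooth_into_compose_left[OF chart_smooth[OF U(1)]
          smooth_on_bounded_linear[OF bounded_linear_inner_left]])
  then have s: "smooth_at M p ?f"
    using U(2) unfolding smooth_at_def smooth_fun_iff by blast
  have "chart_vec M U \<phi> p u ?f = u \<bullet> i" if u: "u \<in> mmodel M" for u
  proof -
    have "((\<lambda>t. \<phi> (inv_into U \<phi> (\<phi> p + t *\<^sub>R u))) has_vector_derivative u) (at 0)"
      using chart_deriv_line[OF U u] by (simp add: chart_deriv_def)
    then have "((\<lambda>t. \<phi> (inv_into U \<phi> (\<phi> p + t *\<^sub>R u)) \<bullet> i) has_vector_derivative u \<bullet> i) (at 0)"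
      by (rule bounded_linear.has_vector_derivative[OF bounded_linear_inner_left])
    then show ?thesis
      using s U by (simp add: chart_vec_def velocity_def DERIV_imp_deriv
          has_real_derivative_iff_has_vector_derivative)
  qed
  then show "v \<bullet> i = w \<bullet> i" using eq vw by metis
qed

lemma smooth_curve_chart_deriv:
  assumes U: "(U, \<phi>) \<in> matlas M" and \<gamma>: "smooth_map (subspace_mfd (UNIV :: real set)) M \<gamma>" "\<gamma> 0 \<in> U"
  obtains v where "v \<in> mmodel M" "chart_deriv U \<phi> \<gamma> v"
proof -
  let ?A = "UNIV \<inter> \<gamma> -` U"
  have A: "open ?A" "smooth_on ?A (\<phi> \<circ> \<gamma>)"
    using smooth_map_subspaceD[OF subspace_UNIV mfd \<gamma>(1) U] by simp_all
  have mem: "0 \<in> ?A" using \<gamma>(2) by simp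
  from Ck_on_has_derivative[OF smooth_on_open_Ck[OF A(2,1), of "Suc 0"] mem]
  have "(\<lambda>t. \<phi> (\<gamma> t)) differentiable (at 0)"
    unfolding comp_def by (rule differentiableI)
  then obtain v where v: "((\<lambda>t. \<phi> (\<gamma> t)) has_vector_derivative v) (at 0)"
    unfolding vector_derivative_works by blast
  have ev: "\<forall>\<^sub>F t in nhds 0. \<gamma> t \<in> U"
    using eventually_nhds_in_open[OF A(1) mem] by simp
  \<comment> \<open>The derivative is rewritten as a limit of difference quotients because these lie
    in the model space, which is closed as a subspace; so the limit lies in it too.\<close>
  have "((\<lambda>t. norm (\<phi> (\<gamma> t) - \<phi> (\<gamma> 0) - t *\<^sub>R v) / norm t) \<longlongrightarrow> 0) (at 0)"
    using v[unfolded has_vector_derivative_def has_derivative_at] by simp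
  moreover have "\<forall>\<^sub>F t in at 0. norm (\<phi> (\<gamma> t) - \<phi> (\<gamma> 0) - t *\<^sub>R v) / norm t
      = norm ((\<phi> (\<gamma> t) - \<phi> (\<gamma> 0)) /\<^sub>R t - v)"
    unfolding eventually_at_filter
  proof (intro always_eventually allI impI)
    fix t :: real assume "t \<noteq> 0"
    then have "(\<phi> (\<gamma> t) - \<phi> (\<gamma> 0)) /\<^sub>R t - v = (\<phi> (\<gamma> t) - \<phi> (\<gamma> 0) - t *\<^sub>R v) /\<^sub>R t"
      by (simp add: scaleR_right_diff_distrib)
    then show "norm (\<phi> (\<gamma> t) - \<phi> (\<gamma> 0) - t *\<^sub>R v) / norm t
        = norm ((\<phi> (\<gamma> t) - \<phi> (\<gamma> 0)) /\<^sub>R t - v)"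
      by (simp add: divide_inverse_commute)
  qed
  ultimately have "((\<lambda>t. norm ((\<phi> (\<gamma> t) - \<phi> (\<gamma> 0)) /\<^sub>R t - v)) \<longlongrightarrow> 0) (at 0)"
    by (rule Lim_transform_eventually)
  then have "((\<lambda>t. (\<phi> (\<gamma> t) - \<phi> (\<gamma> 0)) /\<^sub>R t) \<longlongrightarrow> v) (at 0)"
    by (rule LIM_zero_cancel[OF tendsto_norm_zero_cancel])
  moreover have "\<forall>\<^sub>F t in at 0. (\<phi> (\<gamma> t) - \<phi> (\<gamma> 0)) /\<^sub>R t \<in> mmodel M"
  proof -
    have "\<forall>\<^sub>F t in at 0. \<gamma> t \<in> U" using ev by (simp add: eventually_at_filter eventually_mono)
    then show ?thesis
      by eventually_elim (use chart_model[OF U] \<gamma>(2) model in \<open>auto intro!: subspace_scale subspace_diff\<close>)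
  qed
  ultimately have "v \<in> mmodel M"
    using closed_subspace[OF model] by (intro Lim_in_closed_set[of "mmodel M" _ "at 0"]) auto
  then show thesis using ev v by (intro that) (auto simp: chart_deriv_def)
qed

lemma smooth_curve_exists:
  assumes U: "(U, \<phi>) \<in> matlas M" "p \<in> U" and v: "v \<in> mmodel M"
  obtains \<gamma> where "smooth_map (subspace_mfd (UNIV :: real set)) M \<gamma>" "\<gamma> 0 = p" "chart_deriv U \<phi> \<gamma> v"
proof -
  obtain T where T: "open T" "\<phi> ` (U \<inter> pts M) = mmodel M \<inter> T"
    by (rule chart_image_Int_open[OF U(1) openin_topspace])
  have img: "\<phi> ` U = mmodel M \<inter> T" using T(2) chart_subset[OF U(1)] by (simp add: Int_absorb2)
  have "\<phi> p \<in> T" using U img by auto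
  then obtain r where r: "r > 0" "ball (\<phi> p) r \<subseteq> T" using T(1) open_contains_ball by blast
  \<comment> \<open>This amplitude gives \<open>e * norm v < r\<close>, also when
    \<open>v = 0\<close>, and so keeps the curve in the ball of radius \<open>r\<close>. Dividing
    the time by \<open>e\<close> inside the sine restores the initial velocity
    \<open>v\<close>.\<close>
  define e where "e = r / (norm v + 1)"
  have nv: "norm v + 1 > 0" by (simp add: add_nonneg_pos)
  have e: "e > 0" using r nv by (simp add: e_def)
  have ev: "e * norm v < r" using r nv by (simp add: e_def field_simps)
  \<comment> \<open>a bounded reparametrization of the line, so that the curve is defined on all of the reals\<close>
  define s where "s = (\<lambda>t. \<phi> p + (e * sin (t / e)) *\<^sub>R v)"
  define \<gamma> where "\<gamma> = (\<lambda>t. inv_into U \<phi> (s t))"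
  have sU: "s t \<in> \<phi> ` U" for t
  proof -
    have "dist (\<phi> p) (s t) = e * \<bar>sin (t / e)\<bar> * norm v"
      using e by (simp add: s_def dist_norm abs_mult)
    also have "\<dots> \<le> e * 1 * norm v" using e by (intro mult_right_mono mult_left_mono) auto
    also have "\<dots> < r" using ev by simp
    finally have "s t \<in> T" using r(2) by auto
    moreover have "s t \<in> mmodel M"
      unfolding s_def using chart_model[OF U] v model by (intro subspace_add subspace_scale)
    ultimately show ?thesis using img by auto
  qed
  have \<gamma>U: "\<gamma> t \<in> U" "\<phi> (\<gamma> t) = s t" for t
    unfolding \<gamma>_def using sU[of t] by (auto intro: inv_into_into f_inv_into_f)
  have sin: "smooth_on UNIV (sin :: real \<Rightarrow> real)"
    by (rule smooth_onI_Ck[OF open_UNIV]) (use Ck_on_sin in auto)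
  have "smooth_on UNIV (\<lambda>t. sin (t / e))"
    by (rule smooth_on_compose[OF sin smooth_on_bounded_linear[OF bounded_linear_divide]]) auto
  then have s_smooth: "smooth_on UNIV s"
    unfolding s_def by (intro smooth_on_add smooth_on_const smooth_on_scaleR smooth_on_mult)
  have "smooth_map (subspace_mfd UNIV) M \<gamma>"
  proof (rule smooth_map_subspaceI[OF subspace_UNIV mfd])
    have "continuous_map euclidean (top_of_set (\<phi> ` U)) s"
      using smooth_on_continuous_on[OF s_smooth] sU
      by (auto simp: continuous_map_in_subtopology)
    from continuous_map_compose[OF this chart_inv_continuous[OF U(1)]]
    show "continuous_map (top_of_set UNIV) (mtop M) \<gamma>"
      by (simp add: \<gamma>_def comp_def)
  next
    fix V \<psi> assume V: "(V, \<psi>) \<in> matlas M"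
    have "smooth_on (UNIV \<inter> \<gamma> -` V) (\<lambda>t. (\<psi> \<circ> inv_into U \<phi>) (s t))"
    proof (rule smooth_on_compose[OF smooth_intoD[OF chart_smooth[OF V] U(1)]])
      show "smooth_on (UNIV \<inter> \<gamma> -` V) s" by (rule smooth_on_subset[OF s_smooth]) simp
      show "s t \<in> \<phi> ` (U \<inter> V)" if "t \<in> UNIV \<inter> \<gamma> -` V" for t
        using that \<gamma>U[of t] by (intro image_eqI[of _ _ "\<gamma> t"]) auto
    qed
    then show "smooth_on (UNIV \<inter> \<gamma> -` V) (\<psi> \<circ> \<gamma>)" by (simp add: \<gamma>_def comp_def)
  qed
  moreover have "\<gamma> 0 = p" using U by (simp add: \<gamma>_def s_def)
  moreover have "chart_deriv U \<phi> \<gamma> v"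
  proof -
    have "(s has_vector_derivative v) (at 0)"
      unfolding s_def using e by (auto intro!: derivative_eq_intros)
    then show ?thesis using \<gamma>U by (simp add: chart_deriv_def)
  qed
  ultimately show thesis by (rule that)
qed

text \<open>Transfers the linear structure of the model space to tangent vectors. That sums of
  velocities are again velocities is not visible from the definition by curves.\<close>

lemma tangent_eq_chart_vec:
  assumes U: "(U, \<phi>) \<in> matlas M" "p \<in> U"
  shows "tangent M p = chart_vec M U \<phi> p ` mmodel M"
proof (intro equalityI subsetI)
  fix X assume "X \<in> tangent M p"
  then obtain \<gamma> where \<gamma>: "X = velocity M \<gamma>" "smooth_map (subspace_mfd (UNIV :: real set)) M \<gamma>" "\<gamma> 0 = p"
    unfolding tangent_def by blast
  have "\<gamma> 0 \<in> U" using \<gamma> U by simp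
  then obtain v where "v \<in> mmodel M" "chart_deriv U \<phi> \<gamma> v"
    by (rule smooth_curve_chart_deriv[OF U(1) \<gamma>(2)])
  then show "X \<in> chart_vec M U \<phi> p ` mmodel M"
    using velocity_eq_chart_vec[OF U(1), of \<gamma> p] \<gamma>(1,3) by auto
next
  fix X assume "X \<in> chart_vec M U \<phi> p ` mmodel M"
  then obtain v where v: "v \<in> mmodel M" "X = chart_vec M U \<phi> p v" by blast
  obtain \<gamma> where \<gamma>: "smooth_map (subspace_mfd (UNIV :: real set)) M \<gamma>" "\<gamma> 0 = p" "chart_deriv U \<phi> \<gamma> v"
    by (rule smooth_curve_exists[OF U v(1)])
  then show "X \<in> tangent M p"
    using velocity_eq_chart_vec[OF U(1), of \<gamma> p v] \<gamma> v unfolding tangent_def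
    by (auto intro!: exI[of _ \<gamma>])
qed

lemma tangent_lincomb:
  assumes "p \<in> pts M" "X \<in> tangent M p" "Y \<in> tangent M p"
  shows "(\<lambda>f. a * X f + b * Y f) \<in> tangent M p"
proof -
  obtain U \<phi> where U: "(U, \<phi>) \<in> matlas M" "p \<in> U" by (rule chart_exists[OF assms(1)])
  obtain v w where vw: "v \<in> mmodel M" "X = chart_vec M U \<phi> p v" "w \<in> mmodel M" "Y = chart_vec M U \<phi> p w"
    using assms(2,3) unfolding tangent_eq_chart_vec[OF U] by blast
  have "a *\<^sub>R v + b *\<^sub>R w \<in> mmodel M" using vw model by (intro subspace_add subspace_scale)
  then show ?thesis
    unfolding tangent_eq_chart_vec[OF U] vw(2,4) chart_vec_linear[OF U vw(1,3), symmetric] by blast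
qed

lemma differential_cotangent:
  assumes "p \<in> pts M"
  shows "differential M p f \<in> cotangent M p"
  using tangent_lincomb[OF assms] by (simp add: cotangent_def differential_def)

text \<open>Differentials serve as test covectors. \<open>differential M p f\<close> is a covector
  for every \<open>f\<close>, since linear operations on tangent vectors are pointwise in
  \<open>f\<close>.\<close>

lemma cotangent_separates:
  assumes "p \<in> pts M" "X \<in> tangent M p" "Y \<in> tangent M p" "\<forall>\<eta>\<in>cotangent M p. \<eta> X = \<eta> Y"
  shows "X = Y"
proof
  fix f
  have "differential M p f X = differential M p f Y"
    using assms differential_cotangent by blast
  then show "X f = Y f" using assms by (simp add: differential_def)
qed

end

section \<open>Push-forward of tangent vectors and pull-back of covectors\<close>

lemma cotangent_lincomb:
  "\<xi> \<in> cotangent M p \<Longrightarrow> \<eta> \<in> cotangent M p \<Longrightarrow> (\<lambda>X. a * \<xi> X + b * \<eta> X) \<in> cotangent M p"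
  by (simp add: cotangent_def algebra_simps)

text \<open>If \<open>f\<close> is smooth at the image point, its composite with \<open>F\<close> is
  smooth at \<open>\<gamma> 0\<close>, and both sides differentiate the same real function.
  Otherwise both are 0 by convention.\<close>

lemma push_velocity:
  assumes "smooth_manifold M" "smooth_manifold N" "smooth_map M N F" "\<gamma> 0 \<in> pts M"
  shows "push M N F (\<gamma> 0) (velocity M \<gamma>) = velocity N (\<lambda>t. F (\<gamma> t))"
  using smooth_at_compose[OF assms] by (auto simp: push_def velocity_def fun_eq_iff)

lemma push_tangent:
  assumes "smooth_manifold M" "smooth_manifold N" "smooth_map M N F" "p \<in> pts M" "X \<in> tangent M p"
  shows "push M N F p X \<in> tangent N (F p)"
proof -
  obtain \<gamma> where \<gamma>: "X = velocity M \<gamma>" "smooth_map (subspace_mfd (UNIV :: real set)) M \<gamma>" "\<gamma> 0 = p"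
    using assms(5) unfolding tangent_def by blast
  have "smooth_map (subspace_mfd (UNIV :: real set)) N (F \<circ> \<gamma>)"
    by (rule smooth_map_compose[OF smooth_manifold_subspace_mfd[OF subspace_UNIV] assms(1,2) \<gamma>(2) assms(3)])
  then show ?thesis
    using push_velocity[OF assms(1-3), of \<gamma>] \<gamma> assms(4)
    unfolding tangent_def by (auto simp: comp_def)
qed

lemma push_linear: "push M N F p (\<lambda>f. a * X f + b * Y f) = (\<lambda>f. a * push M N F p X f + b * push M N F p Y f)"
  by (auto simp: push_def)

lemma pull_cotangent:
  assumes "smooth_manifold M" "smooth_manifold N" "smooth_map M N F" "p \<in> pts M" "\<xi> \<in> cotangent N (F p)"
  shows "pull M N F p \<xi> \<in> cotangent M p"
proof -
  interpret smooth_mfd M by (rule smooth_mfd.intro) fact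
  show ?thesis
    using tangent_lincomb[OF assms(4)] push_tangent[OF assms(1-4)] assms(5)
    by (simp add: cotangent_def pull_def push_linear)
qed

section \<open>Smooth actions of a vector space\<close>

lemma smooth_map_subspace_UNIV:
  fixes L :: "'a::euclidean_space \<Rightarrow> 'b::euclidean_space"
  assumes "smooth_on UNIV L"
  shows "smooth_map (subspace_mfd UNIV) (subspace_mfd UNIV) L"
proof (rule smooth_map_subspaceI[OF subspace_UNIV smooth_manifold_subspace_mfd[OF subspace_UNIV]])
  show "continuous_map (top_of_set UNIV) (mtop (subspace_mfd UNIV)) L"
    using smooth_on_continuous_on[OF assms] by (simp add: subspace_mfd_def)
  fix V :: "'b set" and \<psi> :: "'b \<Rightarrow> 'b" assume "(V, \<psi>) \<in> matlas (subspace_mfd UNIV)"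
  then have "\<psi> = id" by (simp add: subspace_mfd_def)
  then show "smooth_on (UNIV \<inter> L -` V) (\<psi> \<circ> L)"
    using smooth_on_subset[OF assms, of "UNIV \<inter> L -` V"] by simp
qed

text \<open>Collects what follows from smoothness of the action; holomorphy enters later, through
  \<open>stab_complex\<close>.\<close>

locale smooth_action = smooth_mfd M
  for M :: "('m, 'e::euclidean_space) mfd" +
  fixes \<alpha> :: "'a::euclidean_space \<Rightarrow> 'm \<Rightarrow> 'm"
  assumes act: "smooth_map (prod_mfd (subspace_mfd UNIV) M) M (\<lambda>(a, x). \<alpha> a x)"
    and act_0: "x \<in> pts M \<Longrightarrow> \<alpha> 0 x = x"
    and act_add: "x \<in> pts M \<Longrightarrow> \<alpha> (a + b) x = \<alpha> a (\<alpha> b x)"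
begin

abbreviation "\<rho> \<equiv> infinitesimal M \<alpha>"

lemmas vec_mfd = smooth_manifold_subspace_mfd[OF subspace_UNIV]

lemma prod_mfd: "smooth_manifold (prod_mfd (subspace_mfd (UNIV :: 'a set)) M)"
  by (rule smooth_manifold_prod_mfd[OF vec_mfd mfd])

lemma act_pts: "x \<in> pts M \<Longrightarrow> \<alpha> a x \<in> pts M"
  using smooth_map_pts[OF act, of "(a, x)"] by (simp add: pts_prod_mfd)

lemma act_uminus: "x \<in> pts M \<Longrightarrow> \<alpha> (- a) (\<alpha> a x) = x"
  using act_add[of x "- a" a] act_0 by simp

lemma act_smooth_right: "smooth_map M M (\<alpha> a)"
proof -
  have "smooth_map M (prod_mfd (subspace_mfd (UNIV :: 'a set)) M) (\<lambda>x. (a, x))"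
    by (rule smooth_map_Pair[OF mfd vec_mfd mfd smooth_map_const[OF mfd] smooth_map_id[OF mfd]]) simp
  from smooth_map_compose[OF mfd prod_mfd mfd this act] show ?thesis by (simp add: comp_def)
qed

lemma act_smooth_left:
  assumes "x \<in> pts M"
  shows "smooth_map (subspace_mfd UNIV) M (\<lambda>a. \<alpha> a x)"
proof -
  have "smooth_map (subspace_mfd (UNIV :: 'a set)) (prod_mfd (subspace_mfd (UNIV :: 'a set)) M) (\<lambda>a. (a, x))"
    by (rule smooth_map_Pair[OF vec_mfd vec_mfd mfd smooth_map_id[OF vec_mfd] smooth_map_const[OF vec_mfd assms]])
  from smooth_map_compose[OF vec_mfd prod_mfd mfd this act] show ?thesis by (simp add: comp_def)
qed

lemma act_smooth_curve:
  assumes "x \<in> pts M" "smooth_on UNIV (L :: real \<Rightarrow> 'a)"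
  shows "smooth_map (subspace_mfd UNIV) M (\<lambda>t. \<alpha> (L t) x)"
  using smooth_map_compose[OF vec_mfd vec_mfd mfd smooth_map_subspace_UNIV[OF assms(2)] act_smooth_left[OF assms(1)]]
  by (simp add: comp_def)

lemma act_continuous: "x \<in> pts M \<Longrightarrow> continuous_map euclidean (mtop M) (\<lambda>a. \<alpha> a x)"
  using smooth_mapD[OF act_smooth_left] by (simp add: subspace_mfd_def)

lemma act_vimage_open: "x \<in> pts M \<Longrightarrow> openin (mtop M) W \<Longrightarrow> open {a. \<alpha> a x \<in> W}"
  using openin_continuous_map_preimage[OF act_continuous] by fastforce

lemma act_chart:
  assumes "(U, \<phi>) \<in> matlas M" "x \<in> pts M"
  shows "smooth_on {a. \<alpha> a x \<in> U} (\<lambda>a. \<phi> (\<alpha> a x))"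
  using smooth_map_subspaceD(2)[OF subspace_UNIV mfd act_smooth_left[OF assms(2)] assms(1)]
  by (simp add: comp_def vimage_def)

lemma smooth_on_line: "smooth_on UNIV (\<lambda>t. c + t *\<^sub>R v)"
  by (intro smooth_on_add smooth_on_const smooth_on_bounded_linear[OF bounded_linear_scaleR_left])

text \<open>\<open>A\<close> is the derivative of the orbit map at 0, read in a chart. The minus
  sign in the last clause comes from the convention that \<open>\<rho> v\<close> is the velocity of
  the action of \<open>- t v\<close>.\<close>

lemma orbit_deriv:
  assumes U: "(U, \<phi>) \<in> matlas M" "x \<in> U"
  obtains A where "linear A" "((\<lambda>a. \<phi> (\<alpha> a x)) has_derivative A) (at 0)"
    "\<forall>v. A v \<in> mmodel M" "\<forall>v. chart_deriv U \<phi> (\<lambda>t. \<alpha> (t *\<^sub>R v) x) (A v)"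
    "\<forall>v. \<rho> v x = chart_vec M U \<phi> x (- A v)"
proof -
  have x: "x \<in> pts M" using U chart_subset by auto
  let ?S = "{a. \<alpha> a x \<in> U}"
  have S: "open ?S" by (rule act_vimage_open[OF x chart_openin[OF U(1)]])
  have S0: "0 \<in> ?S" using act_0[OF x] U by simp
  define A where "A = frechet_derivative (\<lambda>a. \<phi> (\<alpha> a x)) (at 0)"
  have A: "((\<lambda>a. \<phi> (\<alpha> a x)) has_derivative A) (at 0)"
    unfolding A_def by (rule Ck_on_has_derivative[OF smooth_on_open_Ck[OF act_chart[OF U(1) x] S, of "Suc 0"] S0])
  have lin: "linear A" using A by (rule has_derivative_linear)
  have cd: "chart_deriv U \<phi> (\<lambda>t. \<alpha> (t *\<^sub>R v) x) (A v)" for v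
  proof -
    have tend: "((\<lambda>t. t *\<^sub>R v) \<longlongrightarrow> 0 *\<^sub>R v) (nhds 0)"
      by (intro tendsto_intros) (simp add: filterlim_ident)
    have "\<forall>\<^sub>F t in nhds 0. t *\<^sub>R v \<in> ?S"
      by (rule topological_tendstoD[OF tend S]) (use S0 in simp)
    moreover have "((\<lambda>t. \<phi> (\<alpha> (t *\<^sub>R v) x)) has_vector_derivative A v) (at 0)"
    proof -
      have l: "((\<lambda>t. t *\<^sub>R v) has_derivative (\<lambda>t. t *\<^sub>R v)) (at 0)"
        by (rule bounded_linear_imp_has_derivative[OF bounded_linear_scaleR_left])
      have "((\<lambda>t. \<phi> (\<alpha> (t *\<^sub>R v) x)) has_derivative (\<lambda>t. A (t *\<^sub>R v))) (at 0)"
        by (rule has_derivative_compose[OF l]) (use A in simp)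
      then show ?thesis unfolding has_vector_derivative_def linear_cmul[OF lin] .
    qed
    ultimately show ?thesis by (simp add: chart_deriv_def)
  qed
  have mem: "A v \<in> mmodel M" for v
  proof -
    have \<gamma>: "smooth_map (subspace_mfd UNIV) M (\<lambda>t. \<alpha> (t *\<^sub>R v) x)"
      using act_smooth_curve[OF x smooth_on_line[of 0 v]] by simp
    obtain w where w: "w \<in> mmodel M" "chart_deriv U \<phi> (\<lambda>t. \<alpha> (t *\<^sub>R v) x) w"
      by (rule smooth_curve_chart_deriv[OF U(1) \<gamma>]) (use S0 in simp)
    have "w = A v"
      using w(2) cd[of v] unfolding chart_deriv_def by (blast intro: vector_derivative_unique_at)
    then show ?thesis using w by simp
  qed
  have "\<rho> v x = chart_vec M U \<phi> x (- A v)" for v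
  proof -
    have "chart_deriv U \<phi> (\<lambda>t. \<alpha> (t *\<^sub>R (- v)) x) (A (- v))" by (rule cd)
    then have "chart_deriv U \<phi> (\<lambda>t. \<alpha> (- (t *\<^sub>R v)) x) (- A v)" using linear_neg[OF lin] by simp
    moreover have "- A v \<in> mmodel M" using mem model by (simp add: subspace_neg)
    ultimately show ?thesis
      unfolding infinitesimal_def using act_0[OF x]
      by (intro velocity_eq_chart_vec[OF U(1)]) simp_all
  qed
  then show thesis using that lin A cd mem by blast
qed

lemma infinitesimal_linear:
  assumes "x \<in> pts M"
  shows "\<rho> (a *\<^sub>R u + b *\<^sub>R v) x = (\<lambda>f. a * \<rho> u x f + b * \<rho> v x f)"
proof -
  obtain U \<phi> where U: "(U, \<phi>) \<in> matlas M" "x \<in> U" by (rule chart_exists[OF assms])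
  obtain A where A: "linear A" "\<forall>v. A v \<in> mmodel M" "\<forall>v. \<rho> v x = chart_vec M U \<phi> x (- A v)"
    by (rule orbit_deriv[OF U]) blast
  have m: "- A v \<in> mmodel M" for v using A(2) model by (simp add: subspace_neg)
  have "- A (a *\<^sub>R u + b *\<^sub>R v) = a *\<^sub>R (- A u) + b *\<^sub>R (- A v)"
    using A(1) by (simp add: linear_add linear_cmul)
  then show ?thesis
    using chart_vec_linear[OF U m m] A(3) by simp
qed

lemma infinitesimal_tangent:
  assumes "x \<in> pts M"
  shows "\<rho> v x \<in> tangent M x"
proof -
  have "smooth_map (subspace_mfd UNIV) M (\<lambda>t. \<alpha> (- (t *\<^sub>R v)) x)"
    using act_smooth_curve[OF assms smooth_on_line[of 0 "- v"]] by simp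
  then show ?thesis
    unfolding infinitesimal_def tangent_def using act_0[OF assms]
    by (auto intro!: exI[of _ "\<lambda>t. \<alpha> (- (t *\<^sub>R v)) x"])
qed

lemma push_infinitesimal:
  assumes "x \<in> pts M"
  shows "push M M (\<alpha> a) x (\<rho> v x) = \<rho> v (\<alpha> a x)"
proof -
  have "\<alpha> a (\<alpha> (- (t *\<^sub>R v)) x) = \<alpha> (- (t *\<^sub>R v)) (\<alpha> a x)" for t
    using assms by (metis act_add add.commute)
  then show ?thesis
    using push_velocity[OF mfd mfd act_smooth_right, of "\<lambda>t. \<alpha> (- (t *\<^sub>R v)) x" a] act_0[OF assms] assms
    by (simp add: infinitesimal_def)
qed

lemma velocity_act:
  assumes "x \<in> pts M"
  shows "velocity M (\<lambda>t. \<alpha> (c + t *\<^sub>R v) x) = \<rho> (- v) (\<alpha> c x)"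
proof -
  have "\<alpha> (c + t *\<^sub>R v) x = \<alpha> (- (t *\<^sub>R (- v))) (\<alpha> c x)" for t
    using act_add[OF assms, of "t *\<^sub>R v" c] by (simp add: add.commute)
  then show ?thesis by (simp add: infinitesimal_def)
qed

lemma infinitesimal_apply:
  "x \<in> pts M \<Longrightarrow> smooth_at M x f \<Longrightarrow> \<rho> v x f = deriv (\<lambda>t. f (\<alpha> (- (t *\<^sub>R v)) x)) 0"
  by (simp add: infinitesimal_def velocity_def act_0)

text \<open>Along an orbit \<open>\<rho> v\<close> becomes minus a directional derivative on the
  acting space. The two minus signs cancel in a bracket, so brackets on \<open>M\<close> turn into
  brackets with constant coefficients.\<close>

lemma infinitesimal_orbit:
  assumes x: "x \<in> pts M" and f: "smooth_fun M (pts M) f"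
  shows "smooth_on UNIV (\<lambda>a. f (\<alpha> a x))"
    and "\<rho> v (\<alpha> a x) f = - frechet_derivative (\<lambda>a. f (\<alpha> a x)) (at a) v"
proof -
  have "smooth_into (subspace_mfd UNIV) (UNIV \<inter> (\<lambda>a. \<alpha> a x) -` pts M) (f \<circ> (\<lambda>a. \<alpha> a x))"
    using smooth_into_compose[OF vec_mfd mfd act_smooth_left[OF x]] f by (simp add: smooth_fun_iff)
  moreover have "UNIV \<inter> (\<lambda>a. \<alpha> a x) -` pts M = UNIV" using act_pts[OF x] by auto
  ultimately show s: "smooth_on UNIV (\<lambda>a. f (\<alpha> a x))"
    by (simp add: smooth_into_subspace_mfd comp_def)
  let ?F = "\<lambda>a. f (\<alpha> a x)"
  have d: "(?F has_derivative frechet_derivative ?F (at a)) (at a)"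
    using Ck_on_has_derivative[OF smooth_on_open_Ck[OF s open_UNIV, of "Suc 0"]] by simp
  have l: "((\<lambda>t. a + t *\<^sub>R (- v)) has_derivative (\<lambda>t. t *\<^sub>R (- v))) (at 0)"
    by (auto intro!: derivative_eq_intros)
  have "((\<lambda>t. ?F (a + t *\<^sub>R (- v))) has_derivative (\<lambda>t. frechet_derivative ?F (at a) (t *\<^sub>R (- v)))) (at 0)"
    by (rule has_derivative_compose[OF l]) (use d in simp)
  moreover have "(\<lambda>t. frechet_derivative ?F (at a) (t *\<^sub>R (- v))) = (*) (- frechet_derivative ?F (at a) v)"
    unfolding linear_cmul[OF has_derivative_linear[OF d]] linear_neg[OF has_derivative_linear[OF d]]
    by (simp add: fun_eq_iff)
  ultimately have "((\<lambda>t. ?F (a + t *\<^sub>R (- v))) has_real_derivative - frechet_derivative ?F (at a) v) (at 0)"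
    unfolding has_field_derivative_def by (simp only:)
  moreover have "f (\<alpha> (- (t *\<^sub>R v)) (\<alpha> a x)) = ?F (a + t *\<^sub>R (- v))" for t
    using act_add[OF x, of "- (t *\<^sub>R v)" a] by (simp add: add.commute)
  moreover have "smooth_at M (\<alpha> a x) f" using act_pts[OF x] f unfolding smooth_at_def by blast
  ultimately show "\<rho> v (\<alpha> a x) f = - frechet_derivative ?F (at a) v"
    using infinitesimal_apply[OF act_pts[OF x]] by (simp add: DERIV_imp_deriv)
qed

text \<open>The function is the partial derivative of \<open>f (\<alpha> a q)\<close> in
  \<open>a\<close> at \<open>a = 0\<close>, with \<open>q\<close> as a parameter; the joint
  smoothness of the action map gives smoothness in \<open>q\<close>.\<close>

lemma infinitesimal_smooth:
  assumes f: "smooth_fun M W f"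
  shows "smooth_fun M W (\<lambda>x. \<rho> v x f)"
  unfolding smooth_fun_iff
proof (rule smooth_intoI)
  have fW: "smooth_into M W f" using f by (simp add: smooth_fun_iff)
  show W: "openin (mtop M) W" using fW by (rule smooth_into_openin)
  fix U \<phi> assume U: "(U, \<phi>) \<in> matlas M"
  let ?P = "prod_mfd (subspace_mfd (UNIV :: 'a set)) M"
  let ?act = "\<lambda>(a, x). \<alpha> a x"
  \<comment> \<open>The domain of the local expression \<open>h\<close> of
    \<open>f (\<alpha> a q)\<close>, with only \<open>q\<close> put into coordinates. It need not be
    open in the Euclidean space, so an extension \<open>g\<close> of \<open>h\<close> is
    differentiated below.\<close>
  define S where "S = {(a, y). y \<in> \<phi> ` U \<and> \<alpha> a (inv_into U \<phi> y) \<in> W}"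
  define h where "h = (\<lambda>(a, y). f (\<alpha> a (inv_into U \<phi> y)))"
  have chartP: "(UNIV \<times> U, map_prod id \<phi>) \<in> matlas ?P"
    using U by (auto simp: prod_mfd_def subspace_mfd_def)
  have inv: "inv_into (UNIV \<times> U) (map_prod id \<phi>) (a, y) = (a, inv_into U \<phi> y)" if "y \<in> \<phi> ` U" for a :: 'a and y
    using inv_into_map_prod[of id UNIV \<phi> U a y] chart_inj[OF U] that by (simp add: inv_id[unfolded id_def] id_def)
  have "smooth_into ?P (pts ?P \<inter> ?act -` W) (f \<circ> ?act)"
    by (rule smooth_into_compose[OF prod_mfd mfd act fW])
  from smooth_intoD[OF this chartP]
  have "smooth_on (map_prod id \<phi> ` (UNIV \<times> U \<inter> (pts ?P \<inter> ?act -` W)))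
    (f \<circ> ?act \<circ> inv_into (UNIV \<times> U) (map_prod id \<phi>))" .
  moreover have "S \<subseteq> map_prod id \<phi> ` (UNIV \<times> U \<inter> (pts ?P \<inter> ?act -` W))"
  proof
    fix z assume "z \<in> S"
    then obtain a q where z: "z = (a, \<phi> q)" "q \<in> U" "\<alpha> a q \<in> W"
      using chart_inv[OF U] by (auto simp: S_def)
    then show "z \<in> map_prod id \<phi> ` (UNIV \<times> U \<inter> (pts ?P \<inter> ?act -` W))"
      using chart_subset[OF U] by (intro image_eqI[of _ _ "(a, q)"]) (auto simp: pts_prod_mfd)
  qed
  ultimately have "smooth_on S (f \<circ> ?act \<circ> inv_into (UNIV \<times> U) (map_prod id \<phi>))"
    by (rule smooth_on_subset)
  then have h: "smooth_on S h"
    by (rule smooth_on_cong) (auto simp: S_def h_def inv)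
  show "smooth_on (\<phi> ` (U \<inter> W)) ((\<lambda>x. \<rho> v x f) \<circ> inv_into U \<phi>)"
  proof (rule smooth_on_local)
    fix y assume "y \<in> \<phi> ` (U \<inter> W)"
    then obtain p where p: "p \<in> U" "p \<in> W" "y = \<phi> p" by blast
    then have "(0, y) \<in> S" using U act_0 chart_subset[OF U] by (auto simp: S_def)
    from smooth_onE[OF h this] obtain G g where G: "open G" "(0, y) \<in> G" "\<forall>k. Ck_on k g G"
      "\<forall>z\<in>S \<inter> G. g z = h z" by blast
    let ?N = "(\<lambda>y'. (0 :: 'a, y')) -` G"
    have "continuous_on UNIV (\<lambda>y'. (0 :: 'a, y'))" by (intro continuous_intros)
    from open_vimage[OF G(1) this] have N: "open ?N" .
    have "smooth_on ?N (\<lambda>y'. frechet_derivative g (at (0, y')) (- v, 0))"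
      by (rule smooth_on_compose[OF smooth_on_partial[OF G(1)] smooth_on_Pair[OF smooth_on_const smooth_on_id]])
        (use G(3) in auto)
    then have s: "smooth_on (\<phi> ` (U \<inter> W) \<inter> ?N) (\<lambda>y'. frechet_derivative g (at (0, y')) (- v, 0))"
      by (rule smooth_on_subset) simp
    \<comment> \<open>The curve in direction \<open>(- v, 0)\<close> stays in \<open>S\<close> for
      small times, so this derivative of the extension \<open>g\<close> is already determined by
      \<open>h\<close>.\<close>
    have eq: "frechet_derivative g (at (0, y')) (- v, 0) = ((\<lambda>x. \<rho> v x f) \<circ> inv_into U \<phi>) y'"
      if y': "y' \<in> \<phi> ` (U \<inter> W) \<inter> ?N" for y'
    proof -
      obtain q where q: "q \<in> U" "q \<in> W" "y' = \<phi> q" "(0, \<phi> q) \<in> G" using y' by blast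
      then have qM: "q \<in> pts M" using chart_subset[OF U] by auto
      let ?c = "\<lambda>t. (- (t *\<^sub>R v), \<phi> q)"
      have tend: "((\<lambda>t. - (t *\<^sub>R v)) \<longlongrightarrow> - (0 *\<^sub>R v)) (nhds 0)"
        by (intro tendsto_intros) (simp add: filterlim_ident)
      have tend': "(?c \<longlongrightarrow> (- (0 *\<^sub>R v), \<phi> q)) (nhds 0)"
        by (rule tendsto_Pair[OF tend tendsto_const])
      have e1: "\<forall>\<^sub>F t in nhds 0. - (t *\<^sub>R v) \<in> {a. \<alpha> a q \<in> W}"
        by (rule topological_tendstoD[OF tend act_vimage_open[OF qM W]]) (use act_0[OF qM] q in simp)
      have e2: "\<forall>\<^sub>F t in nhds 0. ?c t \<in> G"
        by (rule topological_tendstoD[OF tend' G(1)]) (use q in simp)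
      from e1 e2 have ev: "\<forall>\<^sub>F t in nhds 0. f (\<alpha> (- (t *\<^sub>R v)) q) = g (?c t)"
      proof eventually_elim
        case (elim t)
        then have "?c t \<in> S \<inter> G" using q U by (simp add: S_def)
        then have "g (?c t) = h (?c t)" using G(4) by blast
        then show ?case using q U by (simp add: h_def)
      qed
      have d: "(g has_derivative frechet_derivative g (at (0, \<phi> q))) (at (0, \<phi> q))"
        by (rule Ck_on_has_derivative[OF G(3)[THEN spec, of "Suc 0"] q(4)])
      have l: "(?c has_derivative (\<lambda>t. t *\<^sub>R (- v, 0))) (at 0)"
        by (auto intro!: derivative_eq_intros)
      have "((\<lambda>t. g (?c t)) has_derivative (\<lambda>t. frechet_derivative g (at (0, \<phi> q)) (t *\<^sub>R (- v, 0)))) (at 0)"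
        by (rule has_derivative_compose[OF l]) (use d in simp)
      then have "((\<lambda>t. g (?c t)) has_real_derivative frechet_derivative g (at (0, \<phi> q)) (- v, 0)) (at 0)"
        unfolding has_field_derivative_def linear_cmul[OF has_derivative_linear[OF d]]
          real_scaleR_def mult.commute[of _ "frechet_derivative g (at (0, \<phi> q)) (- v, 0)"] .
      then have "((\<lambda>t. f (\<alpha> (- (t *\<^sub>R v)) q)) has_real_derivative
          frechet_derivative g (at (0, \<phi> q)) (- v, 0)) (at 0)"
        by (subst DERIV_cong_ev[OF refl ev refl])
      moreover have "smooth_at M q f" using q f unfolding smooth_at_def by blast
      ultimately show ?thesis
        using infinitesimal_apply[OF qM] q U by (simp add: DERIV_imp_deriv)
    qed
    have "smooth_on (\<phi> ` (U \<inter> W) \<inter> ?N) ((\<lambda>x. \<rho> v x f) \<circ> inv_into U \<phi>)"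
      by (rule smooth_on_cong[OF s eq])
    then show "\<exists>N. open N \<and> y \<in> N \<and> smooth_on (\<phi> ` (U \<inter> W) \<inter> N) ((\<lambda>x. \<rho> v x f) \<circ> inv_into U \<phi>)"
      using N G(2) by (intro exI[of _ ?N]) simp
  qed
qed

end

section \<open>The induced Poisson structure\<close>

text \<open>At \<open>a\<close>, \<open>X F\<close> lists the components of the Hamiltonian vector
  field of \<open>F\<close>, and \<open>B G F H\<close> is the Hessian of \<open>G\<close> on the
  fields of \<open>F\<close> and \<open>H\<close>. Because the coefficients are constant,
  \<open>{F,{G,H}} = Hess H (X F, X G) - Hess G (X F, X H)\<close>, and the six Hessian terms of the
  cyclic sum cancel in pairs.\<close>

lemma jacobi_constant_coefficients:
  fixes F G H :: "'a::euclidean_space \<Rightarrow> real" and c :: "'a \<Rightarrow> 'a \<Rightarrow> real"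
  assumes C2: "Ck_on 2 F UNIV" "Ck_on 2 G UNIV" "Ck_on 2 H UNIV"
    and anti: "\<And>i j. c i j = - c j i"
  defines "Q \<equiv> \<lambda>F G a. \<Sum>i\<in>Basis. \<Sum>j\<in>Basis.
    frechet_derivative F (at a) i * frechet_derivative G (at a) j * c i j"
  shows "Q F (Q G H) a + Q G (Q H F) a + Q H (Q F G) a = 0"
proof -
  define d where "d = (\<lambda>(v::'a) (F::'a \<Rightarrow> real) a. frechet_derivative F (at a) v)"
  define X where "X = (\<lambda>F l. \<Sum>k\<in>Basis. d k F a * c k l)"
  define B where "B = (\<lambda>G F H. \<Sum>l\<in>Basis. \<Sum>i\<in>Basis. X F l * X H i * d l (d i G) a)"
  have Bsym: "B G F H = B G H F" if "Ck_on 2 G UNIV" for F G H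
  proof -
    have "d l (d i G) a = d i (d l G) a" for l i
      using second_derivative_symmetric[OF that] by (simp add: d_def)
    then show ?thesis unfolding B_def by (subst sum.swap) (simp add: mult.commute mult.left_commute)
  qed
  have main: "Q F (Q G H) a = B H F G - B G F H" if "Ck_on 2 G UNIV" "Ck_on 2 H UNIV" for F G H
  proof -
    have C1: "Ck_on (Suc 0) (d i G) UNIV" "Ck_on (Suc 0) (d i H) UNIV" for i
      using that unfolding numeral_2_eq_2 d_def by simp_all
    have dd: "(d i G has_derivative frechet_derivative (d i G) (at b)) (at b)"
      "(d i H has_derivative frechet_derivative (d i H) (at b)) (at b)" for i b
      by (simp_all add: Ck_on_has_derivative[OF C1(1)] Ck_on_has_derivative[OF C1(2)])
    have fd: "frechet_derivative F (at b) v = d v F b" for F v b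
      by (simp only: d_def)
    have QGH: "Q G H = (\<lambda>b. \<Sum>i\<in>Basis. \<Sum>j\<in>Basis. d i G b * d j H b * c i j)"
      by (simp add: Q_def d_def)
    have "(Q G H has_derivative (\<lambda>v. \<Sum>i\<in>Basis. \<Sum>j\<in>Basis.
        (d i G a * frechet_derivative (d j H) (at a) v
          + frechet_derivative (d i G) (at a) v * d j H a) * c i j)) (at a)"
      unfolding QGH by (intro has_derivative_sum has_derivative_mult_left has_derivative_mult dd)
    from fun_cong[OF frechet_derivative_at[OF this], symmetric]
    have dQ1: "d v (Q G H) a = (\<Sum>i\<in>Basis. \<Sum>j\<in>Basis.
        (d i G a * d v (d j H) a + d v (d i G) a * d j H a) * c i j)" for v
      unfolding fd .
    \<comment> \<open>Antisymmetry of \<open>c\<close> turns the terms that contain second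
      derivatives of \<open>G\<close> into minus a contraction with the field of
      \<open>H\<close>.\<close>
    have dQ2: "(\<Sum>i\<in>Basis. \<Sum>j\<in>Basis. (d i G a * d v (d j H) a + d v (d i G) a * d j H a) * c i j)
      = (\<Sum>j\<in>Basis. X G j * d v (d j H) a) - (\<Sum>i\<in>Basis. X H i * d v (d i G) a)" for v
    proof -
      have "(\<Sum>i\<in>Basis. \<Sum>j\<in>Basis. (d i G a * d v (d j H) a + d v (d i G) a * d j H a) * c i j)
        = (\<Sum>i\<in>Basis. \<Sum>j\<in>Basis. d i G a * c i j * d v (d j H) a)
        - (\<Sum>i\<in>Basis. \<Sum>j\<in>Basis. d j H a * c j i * d v (d i G) a)"
        unfolding sum_subtractf[symmetric]
      proof (intro sum.cong refl)
        fix i j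
        show "(d i G a * d v (d j H) a + d v (d i G) a * d j H a) * c i j
          = d i G a * c i j * d v (d j H) a - d j H a * c j i * d v (d i G) a"
          using anti[of j i] by (simp add: algebra_simps)
      qed
      also have "(\<Sum>i\<in>Basis. \<Sum>j\<in>Basis. d i G a * c i j * d v (d j H) a)
        = (\<Sum>j\<in>Basis. X G j * d v (d j H) a)"
        unfolding X_def sum_distrib_right by (rule sum.swap)
      finally show ?thesis unfolding X_def sum_distrib_right .
    qed
    note dQ = trans[OF dQ1 dQ2]
    have "Q F (Q G H) a = (\<Sum>k\<in>Basis. \<Sum>l\<in>Basis. d k F a * d l (Q G H) a * c k l)"
      by (simp add: Q_def d_def)
    also have "\<dots> = (\<Sum>l\<in>Basis. X F l * d l (Q G H) a)"
      unfolding X_def sum_distrib_right by (subst sum.swap) (simp add: mult.commute mult.left_commute)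
    also have "\<dots> = B H F G - B G F H"
      unfolding dQ B_def by (simp add: right_diff_distrib sum_distrib_left sum_subtractf mult.assoc)
    finally show ?thesis .
  qed
  show ?thesis
    unfolding main[OF C2(2,3)] main[OF C2(3,1)] main[OF C2(1,2)]
    using Bsym[OF C2(1)] Bsym[OF C2(2)] Bsym[OF C2(3)] by simp
qed

lemma blinfun_expansion:
  fixes \<xi> :: "'a::euclidean_space \<Rightarrow>\<^sub>L real"
  shows "\<xi> = (\<Sum>i\<in>Basis. blinfun_apply \<xi> i *\<^sub>R blinfun_inner_left i)"
proof (rule blinfun_eqI)
  fix v
  have "blinfun_apply \<xi> v = blinfun_apply \<xi> (\<Sum>i\<in>Basis. (v \<bullet> i) *\<^sub>R i)"
    by (simp add: euclidean_representation)
  also have "\<dots> = blinfun_apply (\<Sum>i\<in>Basis. blinfun_apply \<xi> i *\<^sub>R blinfun_inner_left i) v"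
    by (simp add: blinfun.sum_right blinfun.sum_left blinfun.scaleR_right blinfun.scaleR_left
        mult.commute inner_commute)
  finally show "blinfun_apply \<xi> v = blinfun_apply (\<Sum>i\<in>Basis. blinfun_apply \<xi> i *\<^sub>R blinfun_inner_left i) v" .
qed

lemma bivector_antisym:
  assumes "bivector P"
  shows "P \<xi> \<eta> = - P \<eta> \<xi>"
proof -
  have bl: "bilinear P" and z: "P \<zeta> \<zeta> = 0" for \<zeta> using assms by (auto simp: bivector_def)
  have "P (\<xi> + \<eta>) (\<xi> + \<eta>) = P \<xi> \<xi> + P \<xi> \<eta> + (P \<eta> \<xi> + P \<eta> \<eta>)"
    by (simp add: bilinear_ladd[OF bl] bilinear_radd[OF bl])
  then show ?thesis by (simp add: z)
qed

context smooth_action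
begin

text \<open>The transpose of \<open>\<rho>\<close> at \<open>x\<close>, from covectors of
  \<open>M\<close> to the dual of the acting space. \<open>Blinfun\<close> has its meaning only on
  bounded linear functions, so \<open>comoment_apply\<close> is stated for genuine
  covectors.\<close>

definition comoment :: "'m \<Rightarrow> 'm cvec \<Rightarrow> 'a \<Rightarrow>\<^sub>L real" where
  "comoment x \<xi> = Blinfun (\<lambda>v. \<xi> (\<rho> v x))"

lemma induced_bivector_eq: "induced_bivector M \<alpha> P x \<xi> \<eta> = P (comoment x \<xi>) (comoment x \<eta>)"
  by (simp add: induced_bivector_def comoment_def)

lemma comoment_apply:
  assumes "x \<in> pts M" "\<xi> \<in> cotangent M x"
  shows "blinfun_apply (comoment x \<xi>) v = \<xi> (\<rho> v x)"
proof -
  have lin: "\<xi> (\<rho> (a *\<^sub>R u + b *\<^sub>R w) x) = a * \<xi> (\<rho> u x) + b * \<xi> (\<rho> w x)" for a b u w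
    unfolding infinitesimal_linear[OF assms(1)]
    using assms(2) infinitesimal_tangent[OF assms(1)] by (simp add: cotangent_def)
  have "linear (\<lambda>v. \<xi> (\<rho> v x))"
    by (rule linearI) (use lin[of 1 _ 1] lin[of _ _ 0] in simp_all)
  then show ?thesis
    unfolding comoment_def by (simp add: bounded_linear_Blinfun_apply linear_linear)
qed

lemma comoment_lincomb:
  assumes "x \<in> pts M" "\<xi> \<in> cotangent M x" "\<eta> \<in> cotangent M x"
  shows "comoment x (\<lambda>X. a * \<xi> X + b * \<eta> X) = a *\<^sub>R comoment x \<xi> + b *\<^sub>R comoment x \<eta>"
  using assms by (intro blinfun_eqI)
    (simp add: comoment_apply cotangent_lincomb blinfun.add_left blinfun.scaleR_left)

lemma comoment_differential:
  assumes "x \<in> pts M"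
  shows "blinfun_apply (comoment x (differential M x f)) v = \<rho> v x f"
  using comoment_apply[OF assms differential_cotangent[OF assms]] infinitesimal_tangent[OF assms]
  by (simp add: differential_def)

text \<open>Both sides are \<open>Blinfun\<close> of the same function, since
  \<open>\<alpha> a\<close> carries the fundamental vector of \<open>v\<close> at \<open>x\<close>
  to the one at \<open>\<alpha> a x\<close>. Invariance of the bivector is then immediate.\<close>

lemma comoment_pull:
  assumes "x \<in> pts M"
  shows "comoment x (pull M M (\<alpha> a) x \<xi>) = comoment (\<alpha> a x) \<xi>"
  unfolding comoment_def pull_def
  by (simp add: infinitesimal_tangent[OF assms] push_infinitesimal[OF assms])

lemma invariant_induced: "invariant_bivector M \<alpha> (induced_bivector M \<alpha> P)"
  unfolding invariant_bivector_def bivectors_related_def induced_bivector_eq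
  by (simp add: comoment_pull)

context
  fixes P :: "'a \<Rightarrow>\<^sub>L real \<Rightarrow> 'a \<Rightarrow>\<^sub>L real \<Rightarrow> real"
  assumes P: "bivector P"
begin

lemma induced_bivector_at:
  assumes "x \<in> pts M"
  shows "bivector_at M x (induced_bivector M \<alpha> P x)"
proof -
  have bl: "bilinear P" and z: "P \<zeta> \<zeta> = 0" for \<zeta> using P by (auto simp: bivector_def)
  show ?thesis
    unfolding bivector_at_def induced_bivector_eq
    by (simp add: comoment_lincomb[OF assms] bilinear_ladd[OF bl] bilinear_radd[OF bl]
        bilinear_lmul[OF bl] bilinear_rmul[OF bl] z)
qed

text \<open>Both differentials are expanded in the dual basis. As the coefficients are constants,
  smoothness of the bracket reduces to that of \<open>\<rho> i x f\<close>, and the Jacobi identity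
  to the flat case.\<close>

lemma bracket_eq:
  assumes "x \<in> pts M"
  shows "bracket M (induced_bivector M \<alpha> P) f g x = (\<Sum>i\<in>Basis. \<Sum>j\<in>Basis.
    \<rho> i x f * \<rho> j x g * P (blinfun_inner_left i) (blinfun_inner_left j))"
proof -
  have bl: "bilinear P" using P by (simp add: bivector_def)
  have exp: "comoment x (differential M x f) = (\<Sum>i\<in>Basis. \<rho> i x f *\<^sub>R blinfun_inner_left i)" for f
    by (subst blinfun_expansion) (simp add: comoment_differential[OF assms])
  show ?thesis
    unfolding bracket_def induced_bivector_eq exp bilinear_sum[OF bl]
    by (simp add: sum.cartesian_product bilinear_lmul[OF bl] bilinear_rmul[OF bl] mult_ac)
qed

lemma bracket_smooth:
  assumes "smooth_fun M W f" "smooth_fun M W g"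
  shows "smooth_fun M W (bracket M (induced_bivector M \<alpha> P) f g)"
proof -
  have W: "openin (mtop M) W" using assms(1) by (simp add: smooth_fun_def)
  have "smooth_into M W (\<lambda>x. \<Sum>i\<in>Basis. \<Sum>j\<in>Basis.
    \<rho> i x f * \<rho> j x g * P (blinfun_inner_left i) (blinfun_inner_left j))"
    using infinitesimal_smooth[OF assms(1)] infinitesimal_smooth[OF assms(2)]
    by (intro smooth_into_sum smooth_into_mult smooth_into_const W) (simp_all add: smooth_fun_iff)
  then show ?thesis
    unfolding smooth_fun_iff
    by (rule smooth_into_cong) (use bracket_eq openin_subset[OF W] in auto)
qed

lemma poisson_structure_induced: "poisson_structure M (induced_bivector M \<alpha> P)"
  unfolding poisson_structure_def bivector_field_def
proof (intro conjI allI impI ballI)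
  fix f g h p
  let ?b = "bracket M (induced_bivector M \<alpha> P)"
  assume "smooth_fun M (pts M) f \<and> smooth_fun M (pts M) g \<and> smooth_fun M (pts M) h" and p: "p \<in> pts M"
  then have f: "smooth_fun M (pts M) f" and g: "smooth_fun M (pts M) g" and h: "smooth_fun M (pts M) h"
    by auto
  define c where "c = (\<lambda>i j. P (blinfun_inner_left i) (blinfun_inner_left j))"
  define Q where "Q = (\<lambda>F G (a::'a). \<Sum>i\<in>Basis. \<Sum>j\<in>Basis.
    frechet_derivative F (at a) i * frechet_derivative G (at a) j * c i j)"
  \<comment> \<open>Pull-back along the orbit map of \<open>p\<close>. It turns brackets into
    \<open>Q\<close>, and evaluation at 0 returns the value at \<open>p\<close>.\<close>
  define pb where "pb = (\<lambda>(f :: 'm \<Rightarrow> real) a. f (\<alpha> a p))"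
  have br: "pb (?b f g) = Q (pb f) (pb g)"
    if "smooth_fun M (pts M) f" "smooth_fun M (pts M) g" for f g
  proof
    fix a
    have "pb (?b f g) a = (\<Sum>i\<in>Basis. \<Sum>j\<in>Basis. \<rho> i (\<alpha> a p) f * \<rho> j (\<alpha> a p) g * c i j)"
      unfolding pb_def bracket_eq[OF act_pts[OF p]] c_def ..
    also have "\<dots> = Q (pb f) (pb g) a"
      unfolding infinitesimal_orbit(2)[OF p that(1)] infinitesimal_orbit(2)[OF p that(2)] Q_def pb_def
      by simp
    finally show "pb (?b f g) a = Q (pb f) (pb g) a" .
  qed
  have C2: "Ck_on 2 (pb f) UNIV" if "smooth_fun M (pts M) f" for f
    unfolding pb_def by (rule smooth_on_open_Ck[OF infinitesimal_orbit(1)[OF p that] open_UNIV])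
  have eq: "?b f (?b g h) p = Q (pb f) (Q (pb g) (pb h)) 0"
    if "smooth_fun M (pts M) f" "smooth_fun M (pts M) g" "smooth_fun M (pts M) h" for f g h
    using fun_cong[OF br[OF that(1) bracket_smooth[OF that(2,3)]], of 0]
    unfolding br[OF that(2,3)] by (simp add: pb_def act_0[OF p])
  have "c i j = - c j i" for i j unfolding c_def by (rule bivector_antisym[OF P])
  from jacobi_constant_coefficients[OF C2[OF f] C2[OF g] C2[OF h] this, of 0]
  show "?b f (?b g h) p + ?b g (?b h f) p + ?b h (?b f g) p = 0"
    unfolding eq[OF f g h] eq[OF g h f] eq[OF h f g] Q_def .
qed (use induced_bivector_at bracket_smooth in auto)

end

section \<open>The Poisson property of the action of a subspace\<close>

lemma act_smooth_restrict:
  assumes B: "subspace B"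
  shows "smooth_map (prod_mfd (subspace_mfd B) M) M (\<lambda>(b, x). \<alpha> b x)"
proof (rule smooth_mapI)
  let ?F = "\<lambda>(b, x). \<alpha> b x"
  have "continuous_map (subtopology (prod_topology euclidean (mtop M)) (B \<times> pts M)) (mtop M) ?F"
    using smooth_mapD[OF act] by (intro continuous_map_from_subtopology) (simp add: prod_mfd_def subspace_mfd_def)
  then show "continuous_map (mtop (prod_mfd (subspace_mfd B) M)) (mtop M) ?F"
    by (simp add: prod_mfd_def subspace_mfd_def subtopology_Times)
  fix W \<kappa> V \<psi> assume W: "(W, \<kappa>) \<in> matlas (prod_mfd (subspace_mfd B) M)" and V: "(V, \<psi>) \<in> matlas M"
  from W obtain U \<phi> where W: "W = B \<times> U" "\<kappa> = map_prod id \<phi>" and U: "(U, \<phi>) \<in> matlas M"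
    by (auto simp: prod_mfd_def subspace_mfd_def)
  have chartP: "(UNIV \<times> U, map_prod id \<phi>) \<in> matlas (prod_mfd (subspace_mfd UNIV) M)"
    using U by (auto simp: prod_mfd_def subspace_mfd_def)
  have "smooth_on (map_prod id \<phi> ` (UNIV \<times> U \<inter> ?F -` V)) (\<psi> \<circ> ?F \<circ> inv_into (UNIV \<times> U) (map_prod id \<phi>))"
    by (rule smooth_map_chart[OF act chartP V])
  then have "smooth_on (map_prod id \<phi> ` (B \<times> U \<inter> ?F -` V)) (\<psi> \<circ> ?F \<circ> inv_into (UNIV \<times> U) (map_prod id \<phi>))"
    by (rule smooth_on_subset) auto
  then show "smooth_on (\<kappa> ` (W \<inter> ?F -` V)) (\<psi> \<circ> ?F \<circ> inv_into W \<kappa>)"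
    unfolding W
  proof (rule smooth_on_cong)
    fix z assume "z \<in> map_prod id \<phi> ` (B \<times> U \<inter> ?F -` V)"
    then obtain b q where z: "z = (id b, \<phi> q)" "b \<in> B" "q \<in> U" by auto
    have "inv_into (UNIV \<times> U) (map_prod id \<phi>) z = (inv_into UNIV id (id b), inv_into U \<phi> (\<phi> q))"
      unfolding z(1) using z(2,3) chart_inj[OF U] by (intro inv_into_map_prod) auto
    moreover have "inv_into (B \<times> U) (map_prod id \<phi>) z = (inv_into B id (id b), inv_into U \<phi> (\<phi> q))"
      unfolding z(1) using z(2,3) chart_inj[OF U] by (intro inv_into_map_prod) auto
    moreover have "inv_into B id (id b) = b" "inv_into UNIV id (id b) = b"
      using z(2) by (simp_all only: inv_into_f_f inj_on_id UNIV_I)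
    ultimately show "(\<psi> \<circ> ?F \<circ> inv_into (UNIV \<times> U) (map_prod id \<phi>)) z
      = (\<psi> \<circ> ?F \<circ> inv_into (B \<times> U) (map_prod id \<phi>)) z" by simp
  qed
qed

text \<open>With the zero structure on \<open>B\<close> only the slice through \<open>b\<close>
  parallel to \<open>M\<close> contributes to the product bivector. On it the action map is
  \<open>\<alpha> b\<close>, so the claim comes down to comparing the transposes of
  \<open>\<rho>\<close> at \<open>x\<close> and at \<open>\<alpha> b x\<close>.\<close>

lemma poisson_action_induced:
  assumes B: "subspace B"
  shows "poisson_action B zero_bivector M (induced_bivector M \<alpha> P) \<alpha>"
  unfolding poisson_action_def poisson_map_def
proof
  let ?P = "prod_mfd (subspace_mfd B) M"
  let ?F = "\<lambda>(b, x). \<alpha> b x"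
  show F: "smooth_map ?P M ?F" by (rule act_smooth_restrict[OF B])
  have Bm: "smooth_manifold (subspace_mfd B)" by (rule smooth_manifold_subspace_mfd[OF B])
  have Pm: "smooth_manifold ?P" by (rule smooth_manifold_prod_mfd[OF Bm mfd])
  have co: "comoment x (pull M ?P (\<lambda>q'. (b, q')) x (pull ?P M ?F (b, x) \<xi>)) = comoment (\<alpha> b x) \<xi>"
    if b: "b \<in> B" and x: "x \<in> pts M" for b x \<xi>
  proof -
    have s: "smooth_map M ?P (\<lambda>q'. (b, q'))"
      by (rule smooth_map_Pair[OF mfd Bm mfd smooth_map_const[OF mfd] smooth_map_id[OF mfd]]) (simp add: b)
    have "pull M ?P (\<lambda>q'. (b, q')) x (pull ?P M ?F (b, x) \<xi>) (\<rho> v x) = \<xi> (\<rho> v (\<alpha> b x))" for v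
    proof -
      let ?\<gamma> = "\<lambda>t. \<alpha> (- (t *\<^sub>R v)) x"
      have "push M ?P (\<lambda>q'. (b, q')) x (\<rho> v x) \<in> tangent ?P (b, x)"
        by (rule push_tangent[OF mfd Pm s x infinitesimal_tangent[OF x]])
      moreover have "push M ?P (\<lambda>q'. (b, q')) x (\<rho> v x) = velocity ?P (\<lambda>t. (b, ?\<gamma> t))"
        using push_velocity[OF mfd Pm s, of ?\<gamma>] act_0[OF x] x by (simp add: infinitesimal_def)
      moreover have "push ?P M ?F (b, x) (velocity ?P (\<lambda>t. (b, ?\<gamma> t))) = velocity M (\<lambda>t. \<alpha> b (?\<gamma> t))"
        using push_velocity[OF Pm mfd F, of "\<lambda>t. (b, ?\<gamma> t)"] act_0[OF x] x b by (simp add: pts_prod_mfd)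
      moreover have "velocity M (\<lambda>t. \<alpha> b (?\<gamma> t)) = push M M (\<alpha> b) x (\<rho> v x)"
        using push_velocity[OF mfd mfd act_smooth_right, of ?\<gamma> b] act_0[OF x] x by (simp add: infinitesimal_def)
      ultimately show ?thesis
        by (simp add: pull_def infinitesimal_tangent[OF x] push_infinitesimal[OF x])
    qed
    then show ?thesis unfolding comoment_def by simp
  qed
  show "bivectors_related ?P (prod_bivector (subspace_mfd B) zero_bivector M (induced_bivector M \<alpha> P)) M
     (induced_bivector M \<alpha> P) ?F"
    unfolding bivectors_related_def
    by (auto simp: pts_prod_mfd prod_bivector_def zero_bivector_def induced_bivector_eq co)
qed

end

section \<open>Orbits\<close>

context smooth_action
begin

text \<open>The Lie algebra of the stabilizer of \<open>x\<close>.\<close>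

definition stab :: "'m \<Rightarrow> 'a set" where
  "stab x = {v. \<rho> v x = (\<lambda>f. 0)}"

lemma infinitesimal_scale: "x \<in> pts M \<Longrightarrow> \<rho> (a *\<^sub>R v) x = (\<lambda>f. a * \<rho> v x f)"
  using infinitesimal_linear[of x a v 0 0] by simp

lemma infinitesimal_add: "x \<in> pts M \<Longrightarrow> \<rho> (u + v) x = (\<lambda>f. \<rho> u x f + \<rho> v x f)"
  using infinitesimal_linear[of x 1 u 1 v] by simp

lemma infinitesimal_diff: "x \<in> pts M \<Longrightarrow> \<rho> (u - v) x = (\<lambda>f. \<rho> u x f - \<rho> v x f)"
  using infinitesimal_linear[of x 1 u "-1" v] by simp

lemma stab_subspace: "x \<in> pts M \<Longrightarrow> subspace (stab x)"
  unfolding subspace_def stab_def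
  using infinitesimal_scale[of x 0 0] by (simp add: infinitesimal_add infinitesimal_scale)

text \<open>\<open>\<alpha> b\<close> pushes a vanishing fundamental vector to a vanishing one; the
  inverse transformation gives the other inclusion.\<close>

lemma stab_act:
  assumes "x \<in> pts M"
  shows "stab (\<alpha> a x) = stab x"
proof -
  have sub: "stab y \<subseteq> stab (\<alpha> b y)" if "y \<in> pts M" for y b
  proof
    fix v assume "v \<in> stab y"
    then have "push M M (\<alpha> b) y (\<rho> v y) = (\<lambda>f. 0)" by (simp add: stab_def push_def fun_eq_iff)
    then show "v \<in> stab (\<alpha> b y)" by (simp add: stab_def push_infinitesimal[OF that])
  qed
  show ?thesis using sub[OF assms, of a] sub[OF act_pts[OF assms, of a], of "- a"] act_uminus[OF assms, of a] by auto
qed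

lemma stab_orbit_deriv:
  assumes U: "(U, \<phi>) \<in> matlas M" "x \<in> U" and "A v \<in> mmodel M" "\<rho> v x = chart_vec M U \<phi> x (- A v)"
  shows "v \<in> stab x \<longleftrightarrow> A v = 0"
proof -
  have m: "- A v \<in> mmodel M" "0 \<in> mmodel M" using assms(3) model by (auto simp: subspace_neg subspace_0)
  have "chart_vec M U \<phi> x 0 = (\<lambda>f. 0)" using chart_vec_linear[OF U m(2,2), of 0 0] by simp
  then have "v \<in> stab x \<longleftrightarrow> chart_vec M U \<phi> x (- A v) = chart_vec M U \<phi> x 0"
    using assms(4) by (simp add: stab_def)
  also have "\<dots> \<longleftrightarrow> - A v = 0" using inj_on_eq_iff[OF chart_vec_inj[OF U] m] .
  finally show ?thesis by simp
qed

text \<open>The stabilizer algebra is the same at all points of the curve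
  \<open>\<alpha> (t v) x\<close>, so the curve has derivative 0 in a chart around each of its
  points. It is locally constant, and the real line is connected.\<close>

lemma stab_fixes:
  assumes x: "x \<in> pts M" and v: "v \<in> stab x"
  shows "\<alpha> v x = x"
proof -
  define \<gamma> where "\<gamma> = (\<lambda>t. \<alpha> (t *\<^sub>R v) x)"
  have \<gamma>M: "\<gamma> t \<in> pts M" for t by (simp add: \<gamma>_def act_pts[OF x])
  have "\<forall>\<^sub>F t in at t0. \<gamma> t0 = \<gamma> t" for t0
  proof -
    obtain U \<phi> where U: "(U, \<phi>) \<in> matlas M" "\<gamma> t0 \<in> U" by (rule chart_exists[OF \<gamma>M])
    have "continuous_on UNIV (\<lambda>t. t *\<^sub>R v)" by (intro continuous_intros)
    from open_vimage[OF act_vimage_open[OF x chart_openin[OF U(1)]] this]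
    have S: "open {t. \<gamma> t \<in> U}" by (simp add: \<gamma>_def vimage_def)
    then obtain e where e: "e > 0" "ball t0 e \<subseteq> {t. \<gamma> t \<in> U}" using U(2) open_contains_ball by blast
    have der: "((\<lambda>t. \<phi> (\<gamma> t)) has_derivative (\<lambda>h. 0)) (at t within ball t0 e)" if "t \<in> ball t0 e" for t
    proof -
      have tU: "\<gamma> t \<in> U" using e that by auto
      obtain A where A: "\<forall>v. A v \<in> mmodel M" "\<forall>v. chart_deriv U \<phi> (\<lambda>s. \<alpha> (s *\<^sub>R v) (\<gamma> t)) (A v)"
          "\<forall>v. \<rho> v (\<gamma> t) = chart_vec M U \<phi> (\<gamma> t) (- A v)"
        by (rule orbit_deriv[OF U(1) tU]) blast
      have "v \<in> stab (\<gamma> t)" using v by (simp add: \<gamma>_def stab_act[OF x])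
      then have A0: "A v = 0" using stab_orbit_deriv[where A = A, OF U(1) tU] A by blast
      have eq: "\<alpha> (s *\<^sub>R v) (\<gamma> t) = \<gamma> (t + s)" for s
        unfolding \<gamma>_def using act_add[OF x, of "s *\<^sub>R v" "t *\<^sub>R v"] by (simp add: scaleR_left_distrib add.commute)
      have d: "((\<lambda>s. \<phi> (\<gamma> (t + s))) has_derivative (\<lambda>s. s *\<^sub>R 0)) (at 0)"
        using A(2)[THEN spec, of v] unfolding A0 eq chart_deriv_def has_vector_derivative_def by blast
      have l: "((\<lambda>t'. t' - t) has_derivative (\<lambda>s. s)) (at t)"
        by (auto intro!: derivative_eq_intros)
      have "((\<lambda>t'. \<phi> (\<gamma> (t + (t' - t)))) has_derivative (\<lambda>s. s *\<^sub>R 0)) (at t)"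
        by (rule has_derivative_compose[OF l]) (use d in simp)
      then show ?thesis by (simp add: has_derivative_at_withinI)
    qed
    obtain c where c: "\<forall>t\<in>ball t0 e. \<phi> (\<gamma> t) = c"
      using has_derivative_zero_constant[OF convex_ball der] by blast
    have eq: "\<gamma> t0 = \<gamma> t" if "t \<in> ball t0 e" for t
    proof -
      have "\<phi> (\<gamma> t0) = \<phi> (\<gamma> t)" using c e(1) that by simp
      moreover have "\<gamma> t \<in> U" using e that by auto
      ultimately show ?thesis using inj_onD[OF chart_inj[OF U(1)]] U(2) by blast
    qed
    have "\<forall>\<^sub>F t in at t0. t \<in> ball t0 e"
      by (rule eventually_at_in_open'[OF open_ball]) (use e(1) in simp)
    then show ?thesis by eventually_elim (rule eq)
  qed
  then have "\<gamma> 0 = \<gamma> 1"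
    by (intro connected_local_const[where A = UNIV]) auto
  then show ?thesis using act_0[OF x] by (simp add: \<gamma>_def)
qed

end

text \<open>Here \<open>g\<close> is a linear projection onto \<open>B \<inter> stab x\<close>, so that its kernel in \<open>B\<close> is the complement
  \<open>C\<close>, and \<open>A\<close> is the derivative at 0 of the orbit map in some chart, with left inverse \<open>A'\<close> on \<open>C\<close>.
  The only role of \<open>A\<close> below is to move \<open>C\<close> into the type of the model space of \<open>M\<close>.\<close>

locale orbit_setup = smooth_action M \<alpha>
  for M :: "('m, 'e::euclidean_space) mfd" and \<alpha> :: "'a::euclidean_space \<Rightarrow> 'm \<Rightarrow> 'm" +
  fixes B :: "'a set" and x :: 'm and A :: "'a \<Rightarrow> 'e" and A' :: "'e \<Rightarrow> 'a" and g :: "'a \<Rightarrow> 'a" and r :: real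
  assumes B: "subspace B" and x: "x \<in> pts M"
    and A: "linear A" and A': "linear A'"
    and g: "linear g" "\<And>b. g b \<in> B \<inter> stab x" "\<And>b. b \<in> B \<inter> stab x \<Longrightarrow> g b = b"
    and A'_A: "\<And>c. c \<in> B \<Longrightarrow> g c = 0 \<Longrightarrow> A' (A c) = c"
    and r: "r > 0"
    and discrete: "\<And>c. c \<in> B \<Longrightarrow> g c = 0 \<Longrightarrow> norm c < 2 * r \<Longrightarrow> \<alpha> c x = x \<Longrightarrow> c = 0"
begin

section \<open>The orbit as a quotient of the complement \<open>C\<close>\<close>

definition C :: "'a set" where "C = {c \<in> B. g c = 0}"
definition orb :: "'a \<Rightarrow> 'm" where "orb c = \<alpha> c x"
definition pr :: "'a \<Rightarrow> 'a" where "pr b = b - g b"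
definition D :: "'a \<Rightarrow> 'a set" where "D c0 = C \<inter> ball c0 r"
definition cdom :: "'a \<Rightarrow> 'm set" where "cdom c0 = orb ` D c0"
definition crd :: "'a \<Rightarrow> 'm \<Rightarrow> 'e" where "crd c0 = (\<lambda>y. A (inv_into (D c0) orb y))"
text \<open>The quotient topology for \<open>orb\<close> on \<open>C\<close>. It can be strictly
  finer than the topology induced from \<open>M\<close>, for instance when the orbit winds densely
  around a torus.\<close>

definition otop :: "'m topology" where
  "otop = topology (\<lambda>U. U \<subseteq> orb ` C \<and> openin (top_of_set C) {c \<in> C. orb c \<in> U})"
definition X :: "('m, 'e) mfd" where
  "X = \<lparr> mtop = otop, mmodel = A ` C, matlas = {(cdom c0, crd c0) | c0. c0 \<in> C} \<rparr>"

lemma C_subspace: "subspace C"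
  unfolding C_def using B g(1)
  by (auto simp: subspace_def linear_add linear_cmul linear_0)

lemma C_B: "c \<in> C \<Longrightarrow> c \<in> B" by (simp add: C_def)

lemma A'_A_C: "c \<in> C \<Longrightarrow> A' (A c) = c" using A'_A by (simp add: C_def)

lemma pr_linear: "linear pr"
  unfolding pr_def using linear_compose_sub[OF linear_id g(1)] by simp

lemma pr_C: "b \<in> B \<Longrightarrow> pr b \<in> C"
  unfolding C_def pr_def using B g(2,3) by (auto simp: subspace_diff linear_diff[OF g(1)])

lemma pr_id: "c \<in> C \<Longrightarrow> pr c = c" by (simp add: C_def pr_def)

lemma orb_add: "orb (a + b) = \<alpha> a (orb b)"
  unfolding orb_def by (rule act_add[OF x])

lemma orb_pts: "orb a \<in> pts M" by (simp add: orb_def act_pts[OF x])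

text \<open>The fibres of \<open>orb\<close> are the cosets of the stabilizer of \<open>x\<close>.
  This governs injectivity, openness and the change of charts below.\<close>

lemma orb_eq_iff: "orb a = orb b \<longleftrightarrow> orb (a - b) = x"
proof
  assume "orb a = orb b"
  have "orb (a - b) = \<alpha> (- b) (orb a)" using orb_add[of "- b" a] by simp
  also have "\<dots> = \<alpha> (- b) (orb b)" using \<open>orb a = orb b\<close> by simp
  also have "\<dots> = x" unfolding orb_def by (rule act_uminus[OF x])
  finally show "orb (a - b) = x" .
next
  assume "orb (a - b) = x"
  then show "orb a = orb b" using orb_add[of b "a - b"] by (simp add: orb_def)
qed

lemma orb_stab: "k \<in> stab x \<Longrightarrow> orb (a + k) = orb a"
  unfolding orb_def act_add[OF x] stab_fixes[OF x] ..

lemma orb_pr: "orb (pr b) = orb b"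
  using orb_stab[of "g b" "pr b"] g(2) by (simp add: pr_def)

lemma orb_image: "orb ` C = orb ` B"
proof
  show "orb ` B \<subseteq> orb ` C"
  proof
    fix y assume "y \<in> orb ` B"
    then obtain b where b: "b \<in> B" "y = orb b" by blast
    then show "y \<in> orb ` C" using pr_C orb_pr[of b] by (intro image_eqI[of _ _ "pr b"]) auto
  qed
qed (use C_B in auto)

text \<open>Two points of a ball of radius \<open>r\<close> differ by less than
  \<open>2 * r\<close>, which is the bound in \<open>discrete\<close>.\<close>

lemma orb_inj: "inj_on orb (D c0)"
proof (rule inj_onI)
  fix a b assume ab: "a \<in> D c0" "b \<in> D c0" "orb a = orb b"
  then have "a - b \<in> C" using C_subspace by (auto simp: D_def subspace_diff)
  moreover have "norm (a - b) < 2 * r"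
    using ab dist_triangle[of a b c0] by (simp add: D_def dist_norm[symmetric] dist_commute)
  moreover have "\<alpha> (a - b) x = x" using ab(3) orb_eq_iff by (simp add: orb_def)
  ultimately have "a - b = 0" using discrete[of "a - b"] unfolding C_def by blast
  then show "a = b" by simp
qed

lemma orb_openin:
  assumes "openin (mtop M) W"
  shows "openin (top_of_set C) {c \<in> C. orb c \<in> W}"
proof -
  have "{c \<in> C. orb c \<in> W} = C \<inter> {a. \<alpha> a x \<in> W}" by (auto simp: orb_def)
  then show ?thesis using openin_open_Int[OF act_vimage_open[OF x assms]] by simp
qed

lemma openin_otop: "openin otop U \<longleftrightarrow> U \<subseteq> orb ` C \<and> openin (top_of_set C) {c \<in> C. orb c \<in> U}"
proof -
  have "istopology (\<lambda>U. U \<subseteq> orb ` C \<and> openin (top_of_set C) {c \<in> C. orb c \<in> U})"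
    unfolding istopology_def
  proof (intro conjI allI impI)
    fix S T assume ST: "S \<subseteq> orb ` C \<and> openin (top_of_set C) {c \<in> C. orb c \<in> S}"
      "T \<subseteq> orb ` C \<and> openin (top_of_set C) {c \<in> C. orb c \<in> T}"
    have "{c \<in> C. orb c \<in> S \<inter> T} = {c \<in> C. orb c \<in> S} \<inter> {c \<in> C. orb c \<in> T}" by auto
    then show "openin (top_of_set C) {c \<in> C. orb c \<in> S \<inter> T}"
      using openin_Int[OF conjunct2[OF ST(1)] conjunct2[OF ST(2)]] by simp
  next
    fix \<K> assume K: "\<forall>K\<in>\<K>. K \<subseteq> orb ` C \<and> openin (top_of_set C) {c \<in> C. orb c \<in> K}"
    have "{c \<in> C. orb c \<in> \<Union>\<K>} = \<Union>((\<lambda>K. {c \<in> C. orb c \<in> K}) ` \<K>)" by auto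
    moreover have "openin (top_of_set C) (\<Union>((\<lambda>K. {c \<in> C. orb c \<in> K}) ` \<K>))"
      by (rule openin_Union) (use K in blast)
    ultimately show "openin (top_of_set C) {c \<in> C. orb c \<in> \<Union>\<K>}" by (simp only:)
  qed auto
  from fun_cong[OF topology_inverse'[OF this], of U] show ?thesis unfolding otop_def .
qed

lemma topspace_otop: "topspace otop = orb ` C"
proof
  show "topspace otop \<subseteq> orb ` C" using openin_otop[of "topspace otop"] by simp
  have "{c \<in> C. orb c \<in> orb ` C} = C" by auto
  then have "openin otop (orb ` C)" unfolding openin_otop by simp
  then show "orb ` C \<subseteq> topspace otop" by (rule openin_subset)
qed

lemma orb_continuous: "continuous_map (top_of_set C) otop orb"
  unfolding continuous_map_def by (auto simp: topspace_otop openin_otop)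

text \<open>The saturation of \<open>V\<close> is the union of its translates by the elements of
  \<open>C\<close> that fix \<open>x\<close>, and each translate is open in
  \<open>C\<close>.\<close>

lemma orb_open:
  assumes "openin (top_of_set C) V"
  shows "openin otop (orb ` V)"
proof -
  have VC: "V \<subseteq> C" using openin_subset[OF assms] by simp
  define K where "K = {k \<in> C. orb k = x}"
  have "openin (top_of_set C) {c \<in> C. c - k \<in> V}" if "k \<in> K" for k
  proof -
    have "continuous_map (top_of_set C) (top_of_set C) (\<lambda>c. c - k)"
      using that C_subspace by (auto simp: K_def continuous_map_in_subtopology subspace_diff intro!: continuous_intros)
    from openin_continuous_map_preimage[OF this assms] show ?thesis by simp
  qed
  then have "openin (top_of_set C) (\<Union>k\<in>K. {c \<in> C. c - k \<in> V})" by auto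
  moreover have "(\<Union>k\<in>K. {c \<in> C. c - k \<in> V}) = {c \<in> C. orb c \<in> orb ` V}"
  proof (intro equalityI subsetI)
    fix c assume "c \<in> (\<Union>k\<in>K. {c \<in> C. c - k \<in> V})"
    then obtain k where k: "k \<in> K" "c \<in> C" "c - k \<in> V" by blast
    then have "orb c = orb (c - k)" using orb_eq_iff[of c "c - k"] by (simp add: K_def)
    then show "c \<in> {c \<in> C. orb c \<in> orb ` V}" using k by auto
  next
    fix c assume "c \<in> {c \<in> C. orb c \<in> orb ` V}"
    then obtain c' where c: "c \<in> C" "c' \<in> V" "orb c = orb c'" by auto
    then have "c - c' \<in> K" using orb_eq_iff VC C_subspace by (auto simp: K_def subspace_diff)
    then show "c \<in> (\<Union>k\<in>K. {c \<in> C. c - k \<in> V})" using c by (intro UN_I[of "c - c'"]) auto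
  qed
  ultimately show ?thesis unfolding openin_otop using VC by auto
qed

lemma D_openin: "openin (top_of_set C) (D c0)"
  unfolding D_def by (simp add: openin_open_Int)

lemma crd_orb: "c \<in> D c0 \<Longrightarrow> crd c0 (orb c) = A c"
  unfolding crd_def by (simp add: inv_into_f_f[OF orb_inj])

lemma crd_image: "crd c0 ` cdom c0 = A ` D c0"
  unfolding cdom_def image_image by (rule image_cong[OF refl crd_orb])

lemma D_C: "c \<in> D c0 \<Longrightarrow> c \<in> C" by (simp add: D_def)

lemma crd_inj: "inj_on (crd c0) (cdom c0)"
proof (rule inj_onI)
  fix y z assume "y \<in> cdom c0" "z \<in> cdom c0" and eq: "crd c0 y = crd c0 z"
  then obtain a b where ab: "a \<in> D c0" "y = orb a" "b \<in> D c0" "z = orb b" unfolding cdom_def by blast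
  then have "A a = A b" using eq by (simp add: crd_orb)
  then have "a = b" using A'_A_C D_C ab by metis
  then show "y = z" using ab by simp
qed

lemma crd_inv:
  assumes "c \<in> D c0"
  shows "inv_into (cdom c0) (crd c0) (A c) = orb c"
proof -
  have "orb c \<in> cdom c0" using assms by (simp add: cdom_def)
  from inv_into_f_f[OF crd_inj this] show ?thesis unfolding crd_orb[OF assms] .
qed

lemma cdom_openin: "openin otop (cdom c0)"
  unfolding cdom_def by (rule orb_open[OF D_openin])

lemma otop_inclusion: "continuous_map otop (mtop M) (\<lambda>p. p)"
proof -
  have "{y \<in> orb ` C. y \<in> W} \<subseteq> orb ` C" "{c \<in> C. orb c \<in> {y \<in> orb ` C. y \<in> W}} = {c \<in> C. orb c \<in> W}" for W
    by auto
  then show ?thesis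
    unfolding continuous_map_def topspace_otop openin_otop using orb_pts orb_openin by fastforce
qed

text \<open>If \<open>orb c = orb d\<close> with \<open>d\<close> in the ball around
  \<open>c0\<close>, then \<open>k = d - c\<close> fixes \<open>x\<close>, and the chart sees
  \<open>orb c'\<close> as \<open>orb (c' + k)\<close> for all \<open>c'\<close> near
  \<open>c\<close>. Transition maps, the orbit map and its derivatives are all computed from the
  resulting affine formula.\<close>

lemma local_form:
  assumes "c \<in> C" "orb c \<in> cdom c0"
  obtains k N where "open N" "c \<in> N" "\<forall>c'\<in>C \<inter> N. orb c' \<in> cdom c0 \<and> crd c0 (orb c') = A c' + A k"
proof -
  obtain d where d: "d \<in> D c0" "orb c = orb d" using assms(2) unfolding cdom_def by blast
  define k where "k = d - c"
  have kC: "k \<in> C" using d assms(1) C_subspace D_C by (simp add: k_def subspace_diff)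
  have k: "orb k = x" using d(2) orb_eq_iff[of d c] by (simp add: k_def)
  have kadd: "orb (c' + k) = orb c'" for c' unfolding orb_add k by (simp add: orb_def)
  let ?N = "(\<lambda>c'. c' + k) -` ball c0 r"
  have N: "open ?N" by (rule open_vimage[OF open_ball]) (intro continuous_intros)
  have cN: "c \<in> ?N" using d by (simp add: k_def D_def)
  have "orb c' \<in> cdom c0 \<and> crd c0 (orb c') = A c' + A k" if "c' \<in> C \<inter> ?N" for c'
  proof -
    have "c' + k \<in> D c0" using that kC C_subspace by (simp add: D_def subspace_add)
    then have "orb (c' + k) \<in> cdom c0" "crd c0 (orb (c' + k)) = A (c' + k)"
      by (simp_all add: crd_orb cdom_def)
    then show ?thesis by (simp add: kadd linear_add[OF A])
  qed
  then show thesis using that[OF N cN] by blast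
qed

lemma A'_vimage_open: "open N \<Longrightarrow> open (A' -` N)"
  by (rule open_vimage) (simp_all add: A' linear_continuous_on linear_linear)

lemma X_manifold: "smooth_manifold X"
  unfolding smooth_manifold_def
proof (intro conjI)
  show "subspace (mmodel X)" using linear_subspace_image[OF A C_subspace] by (simp add: X_def)
  \<comment> \<open>The inclusion into \<open>M\<close> is continuous and injective, so open sets of
    \<open>M\<close> already separate the points.\<close>
  show "Hausdorff_space (mtop X)"
    using Hausdorff_space_injective_preimage[OF Hausdorff otop_inclusion] by (simp add: X_def)
  \<comment> \<open>\<open>orb\<close> is a continuous open map from \<open>C\<close> onto the
    orbit, so it carries a countable base to a countable base.\<close>
  show "second_countable (mtop X)"
    using second_countable_open_map_image[OF orb_continuous] orb_open topspace_otop
    by (simp add: X_def open_map_def second_countable_subtopology second_countable_euclidean)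
  have "orb c \<in> cdom c" if "c \<in> C" for c
    using that r by (auto simp: cdom_def D_def)
  moreover have "cdom c0 \<subseteq> orb ` C" for c0 by (auto simp: cdom_def D_def)
  ultimately have "(\<Union>c0\<in>C. cdom c0) = orb ` C" by blast
  moreover have "(\<Union>(U, \<phi>)\<in>matlas X. U) = (\<Union>c0\<in>C. cdom c0)" by (auto simp: X_def)
  ultimately show "(\<Union>(U, \<phi>)\<in>matlas X. U) = pts X"
    by (simp add: X_def topspace_otop)
  have homeo: "homeomorphic_map (subtopology otop (cdom c0)) (top_of_set (A ` D c0)) (crd c0)" for c0
  proof -
    have DC: "top_of_set (D c0) = subtopology (top_of_set C) (D c0)"
      by (simp add: subtopology_subtopology D_def Int_absorb1)
    have dom: "topspace (subtopology otop (cdom c0)) = cdom c0"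
      using openin_subset[OF cdom_openin] by (simp add: Int_absorb1)
    have "homeomorphic_map (top_of_set (D c0)) (subtopology otop (cdom c0)) orb"
    proof (rule bijective_open_imp_homeomorphic_map)
      show "continuous_map (top_of_set (D c0)) (subtopology otop (cdom c0)) orb"
        unfolding continuous_map_in_subtopology DC
        using continuous_map_from_subtopology[OF orb_continuous] by (auto simp: cdom_def)
      show "open_map (top_of_set (D c0)) (subtopology otop (cdom c0)) orb"
        unfolding open_map_def
      proof (intro allI impI)
        fix V assume V: "openin (top_of_set (D c0)) V"
        then have "openin otop (orb ` V)" using orb_open openin_trans[OF _ D_openin] by blast
        moreover have "orb ` V \<subseteq> cdom c0" using openin_subset[OF V] by (auto simp: cdom_def)
        ultimately show "openin (subtopology otop (cdom c0)) (orb ` V)"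
          by (simp add: openin_open_subtopology[OF cdom_openin])
      qed
      show "orb ` topspace (top_of_set (D c0)) = topspace (subtopology otop (cdom c0))"
        unfolding dom by (simp add: cdom_def)
      show "inj_on orb (topspace (top_of_set (D c0)))" by (simp add: orb_inj)
    qed
    then obtain h where h: "homeomorphic_maps (top_of_set (D c0)) (subtopology otop (cdom c0)) orb h"
      by (auto simp: homeomorphic_map_maps)
    then have "homeomorphic_map (subtopology otop (cdom c0)) (top_of_set (D c0)) h"
      using homeomorphic_maps_sym homeomorphic_maps_imp_map by blast
    moreover have "homeomorphic_map (top_of_set (D c0)) (top_of_set (A ` D c0)) A"
      unfolding homeomorphic_map_maps
      using A'_A_C[OF D_C] linear_continuous_on[OF A[unfolded linear_conv_bounded_linear]]
        linear_continuous_on[OF A'[unfolded linear_conv_bounded_linear]]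
      by (intro exI[of _ A']) (auto simp: homeomorphic_maps_def)
    ultimately have "homeomorphic_map (subtopology otop (cdom c0)) (top_of_set (A ` D c0)) (A \<circ> h)"
      by (rule homeomorphic_map_compose)
    moreover have "(A \<circ> h) y = crd c0 y" if y: "y \<in> topspace (subtopology otop (cdom c0))" for y
    proof -
      obtain c where c: "c \<in> D c0" "y = orb c" using y unfolding dom unfolding cdom_def by blast
      have "h (orb c) = c" using h c by (simp add: homeomorphic_maps_def)
      then show ?thesis using c by (simp add: crd_orb)
    qed
    ultimately show ?thesis by (rule homeomorphic_map_eq)
  qed
  have "openin (top_of_set (A ` C)) (A ` D c0)" for c0
  proof -
    have "A ` D c0 = A ` C \<inter> A' -` ball c0 r"
      using A'_A_C by (auto simp: D_def)
    then show ?thesis by (simp add: openin_open_Int A'_vimage_open)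
  qed
  then show "\<forall>(U, \<phi>)\<in>matlas X. openin (mtop X) U \<and> openin (top_of_set (mmodel X)) (\<phi> ` U) \<and>
      homeomorphic_map (subtopology (mtop X) U) (top_of_set (\<phi> ` U)) \<phi>"
    using cdom_openin homeo by (auto simp: X_def crd_image)
  have "smooth_on (crd c1 ` (cdom c1 \<inter> cdom c2)) (crd c2 \<circ> inv_into (cdom c1) (crd c1))" for c1 c2
  proof (rule smooth_on_local)
    fix y assume "y \<in> crd c1 ` (cdom c1 \<inter> cdom c2)"
    then obtain p where p: "p \<in> cdom c1" "p \<in> cdom c2" "y = crd c1 p" by blast
    obtain c where "c \<in> D c1" "p = orb c" using p(1) unfolding cdom_def by blast
    then have c: "c \<in> D c1" "y = A c" "orb c \<in> cdom c2" using p by (simp_all add: crd_orb)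
    obtain k N where N: "open N" "c \<in> N" "\<forall>c'\<in>C \<inter> N. orb c' \<in> cdom c2 \<and> crd c2 (orb c') = A c' + A k"
      by (rule local_form[OF D_C[OF c(1)] c(3)])
    have "smooth_on (crd c1 ` (cdom c1 \<inter> cdom c2) \<inter> A' -` N) (\<lambda>y. y + A k)"
      by (intro smooth_on_add smooth_on_id smooth_on_const)
    then have "smooth_on (crd c1 ` (cdom c1 \<inter> cdom c2) \<inter> A' -` N) (crd c2 \<circ> inv_into (cdom c1) (crd c1))"
    proof (rule smooth_on_cong)
      fix z assume z: "z \<in> crd c1 ` (cdom c1 \<inter> cdom c2) \<inter> A' -` N"
      then have "z \<in> A ` D c1" unfolding crd_image[symmetric] by blast
      then obtain d where d: "d \<in> D c1" "z = A d" by blast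
      then have "d \<in> C \<inter> N" using z A'_A_C D_C by auto
      then show "z + A k = (crd c2 \<circ> inv_into (cdom c1) (crd c1)) z"
        using N(3) d by (simp add: crd_inv)
    qed
    then show "\<exists>N. open N \<and> y \<in> N \<and>
        smooth_on (crd c1 ` (cdom c1 \<inter> cdom c2) \<inter> N) (crd c2 \<circ> inv_into (cdom c1) (crd c1))"
      using A'_vimage_open[OF N(1)] N(2) c A'_A_C D_C by (intro exI[of _ "A' -` N"]) auto
  qed
  then show "\<forall>(U, \<phi>)\<in>matlas X. \<forall>(V, \<psi>)\<in>matlas X. smooth_on (\<phi> ` (U \<inter> V)) (\<psi> \<circ> inv_into U \<phi>)"
    by (auto simp: X_def)
qed

end

section \<open>The orbit map, the immersion and the tangent spaces of the orbit\<close>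

context orbit_setup
begin

lemma pts_X: "pts X = orb ` B"
  by (simp add: X_def topspace_otop orb_image)

lemma matlas_X:
  assumes "(U, \<phi>) \<in> matlas X"
  obtains c0 where "c0 \<in> C" "U = cdom c0" "\<phi> = crd c0"
  using assms by (auto simp: X_def)

lemma B_mfd: "smooth_manifold (subspace_mfd B)"
  by (rule smooth_manifold_subspace_mfd[OF B])

lemma pr_vimage_open: "open N \<Longrightarrow> open (pr -` N)"
  by (rule open_vimage) (simp_all add: pr_linear linear_continuous_on linear_linear)

text \<open>On \<open>B\<close> the orbit map factors through the projection \<open>pr\<close> onto
  \<open>C\<close>, because \<open>pr\<close> changes its argument only by elements that fix
  \<open>x\<close>. On \<open>C\<close> it is affine in the charts by
  \<open>local_form\<close>.\<close>

lemma orb_smooth: "smooth_map (subspace_mfd B) X orb"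
proof (rule smooth_map_subspaceI[OF B X_manifold])
  have "continuous_map (top_of_set B) (top_of_set C) pr"
    using pr_C linear_continuous_on[OF pr_linear[unfolded linear_conv_bounded_linear]] by auto
  from continuous_map_compose[OF this orb_continuous]
  show "continuous_map (top_of_set B) (mtop X) orb"
    by (simp add: comp_def orb_pr X_def)
  fix U \<phi> assume "(U, \<phi>) \<in> matlas X"
  then obtain c0 where c0: "U = cdom c0" "\<phi> = crd c0" by (rule matlas_X)
  show "smooth_on (B \<inter> orb -` U) (\<phi> \<circ> orb)"
  proof (rule smooth_on_local)
    fix b assume b: "b \<in> B \<inter> orb -` U"
    then have p: "pr b \<in> C" "orb (pr b) \<in> cdom c0" using pr_C by (simp_all add: orb_pr c0)
    obtain k N where N: "open N" "pr b \<in> N" "\<forall>c\<in>C \<inter> N. orb c \<in> cdom c0 \<and> crd c0 (orb c) = A c + A k"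
      by (rule local_form[OF p])
    have "smooth_on (B \<inter> orb -` U \<inter> pr -` N) (\<lambda>b. A (pr b) + A k)"
      using linear_compose[OF pr_linear A] by (intro smooth_on_add smooth_on_linear smooth_on_const) (simp add: comp_def)
    then have "smooth_on (B \<inter> orb -` U \<inter> pr -` N) (\<phi> \<circ> orb)"
    proof (rule smooth_on_cong)
      fix b' assume "b' \<in> B \<inter> orb -` U \<inter> pr -` N"
      then have "crd c0 (orb (pr b')) = A (pr b') + A k" using N(3) pr_C by blast
      then show "A (pr b') + A k = (\<phi> \<circ> orb) b'" by (simp add: orb_pr c0)
    qed
    then show "\<exists>N. open N \<and> b \<in> N \<and> smooth_on (B \<inter> orb -` U \<inter> N) (\<phi> \<circ> orb)"
      using pr_vimage_open[OF N(1)] N(2) by (intro exI[of _ "pr -` N"]) simp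
  qed
qed

text \<open>Since \<open>A'\<close> undoes \<open>A\<close> on \<open>C\<close>, the inclusion sends
  the point with coordinates \<open>y\<close> to \<open>\<alpha> (A' y) x\<close>, so its smoothness
  is that of the action.\<close>

lemma X_inclusion: "smooth_map X M (\<lambda>p. p)"
proof (rule smooth_mapI)
  show "continuous_map (mtop X) (mtop M) (\<lambda>p. p)" using otop_inclusion by (simp add: X_def)
  fix U \<phi> V \<psi> assume "(U, \<phi>) \<in> matlas X" and V: "(V, \<psi>) \<in> matlas M"
  then obtain c0 where c0: "U = cdom c0" "\<phi> = crd c0" by (elim matlas_X)
  have "smooth_on (\<phi> ` (U \<inter> (\<lambda>p. p) -` V)) (\<lambda>y. \<psi> (\<alpha> (A' y) x))"
  proof (rule smooth_on_compose[OF act_chart[OF V x] smooth_on_linear[OF A']])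
    fix y assume "y \<in> \<phi> ` (U \<inter> (\<lambda>p. p) -` V)"
    then obtain p where p: "p \<in> cdom c0" "p \<in> V" "y = crd c0 p" by (auto simp: c0)
    obtain c where c: "c \<in> D c0" "p = orb c" using p(1) unfolding cdom_def by blast
    have "A' y = c" unfolding p(3) c(2) crd_orb[OF c(1)] by (rule A'_A_C[OF D_C[OF c(1)]])
    then show "A' y \<in> {a. \<alpha> a x \<in> V}"
      using p(2) c(2) by (simp add: orb_def)
  qed
  then show "smooth_on (\<phi> ` (U \<inter> (\<lambda>p. p) -` V)) (\<psi> \<circ> (\<lambda>p. p) \<circ> inv_into U \<phi>)"
  proof (rule smooth_on_cong)
    fix y assume "y \<in> \<phi> ` (U \<inter> (\<lambda>p. p) -` V)"
    then obtain p where p: "p \<in> cdom c0" "p \<in> V" "y = crd c0 p" by (auto simp: c0)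
    obtain c where c: "c \<in> D c0" "p = orb c" using p(1) unfolding cdom_def by blast
    then have "y = A c" using p by (simp add: crd_orb)
    then show "\<psi> (\<alpha> (A' y) x) = (\<psi> \<circ> (\<lambda>p. p) \<circ> inv_into U \<phi>) y"
      using c A'_A_C[OF D_C] by (simp add: c0 crd_inv orb_def)
  qed
qed

text \<open>For small times the curve \<open>orb (b + t w)\<close> is a straight line in the chart
  with direction \<open>A (pr w)\<close>. These directions fill the model space as \<open>w\<close>
  runs through \<open>B\<close>.\<close>

lemma tangent_X:
  assumes b: "b \<in> B"
  shows "tangent X (orb b) = (\<lambda>w. velocity X (\<lambda>t. orb (b + t *\<^sub>R w))) ` B"
proof -
  interpret X: smooth_mfd X by (rule smooth_mfd.intro) (rule X_manifold)
  have "orb b \<in> pts X" using b pts_X by simp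
  then obtain U \<phi> where U: "(U, \<phi>) \<in> matlas X" "orb b \<in> U" by (rule X.chart_exists)
  obtain c0 where c0: "U = cdom c0" "\<phi> = crd c0" by (rule matlas_X[OF U(1)])
  have p: "pr b \<in> C" "orb (pr b) \<in> cdom c0" using pr_C[OF b] U(2) by (simp_all add: orb_pr c0)
  obtain k N where N: "open N" "pr b \<in> N" "\<forall>c\<in>C \<inter> N. orb c \<in> cdom c0 \<and> crd c0 (orb c) = A c + A k"
    by (rule local_form[OF p])
  have cd: "chart_deriv U \<phi> (\<lambda>t. orb (b + t *\<^sub>R w)) (A (pr w))" if w: "w \<in> B" for w
  proof -
    have eq: "orb (b + t *\<^sub>R w) = orb (pr b + t *\<^sub>R pr w)" for t
      using orb_pr[of "b + t *\<^sub>R w"] linear_add[OF pr_linear] linear_cmul[OF pr_linear] by simp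
    have tend: "((\<lambda>t. pr b + t *\<^sub>R pr w) \<longlongrightarrow> pr b + 0 *\<^sub>R pr w) (nhds 0)"
      by (intro tendsto_intros) (simp add: filterlim_ident)
    have "\<forall>\<^sub>F t in nhds 0. pr b + t *\<^sub>R pr w \<in> N"
      by (rule topological_tendstoD[OF tend N(1)]) (use N in simp)
    then have ev: "\<forall>\<^sub>F t in nhds 0. orb (b + t *\<^sub>R w) \<in> U \<and>
        \<phi> (orb (b + t *\<^sub>R w)) = (A (pr b) + A k) + t *\<^sub>R A (pr w)"
    proof eventually_elim
      case (elim t)
      have "pr b + t *\<^sub>R pr w \<in> C \<inter> N"
        using elim pr_C b w C_subspace by (simp add: subspace_add subspace_scale)
      from bspec[OF N(3) this] show ?case
        by (simp add: eq c0 linear_add[OF A] linear_cmul[OF A])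
    qed
    have "((\<lambda>t. (A (pr b) + A k) + t *\<^sub>R A (pr w)) has_vector_derivative A (pr w)) (at 0)"
      by (auto intro!: derivative_eq_intros)
    moreover have ev2: "\<forall>\<^sub>F t in nhds 0. (A (pr b) + A k) + t *\<^sub>R A (pr w) = \<phi> (orb (b + t *\<^sub>R w))"
      using ev by eventually_elim simp
    ultimately have "((\<lambda>t. \<phi> (orb (b + t *\<^sub>R w))) has_vector_derivative A (pr w)) (at 0)"
      using has_vector_derivative_cong_ev[where x = 0 and S = UNIV and f' = "A (pr w)"
          and f = "\<lambda>t. (A (pr b) + A k) + t *\<^sub>R A (pr w)" and g = "\<lambda>t. \<phi> (orb (b + t *\<^sub>R w))"]
        eventually_nhds_x_imp_x[OF ev2] by simp
    moreover have "\<forall>\<^sub>F t in nhds 0. orb (b + t *\<^sub>R w) \<in> U" using ev by eventually_elim simp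
    ultimately show ?thesis by (simp add: chart_deriv_def)
  qed
  have v: "velocity X (\<lambda>t. orb (b + t *\<^sub>R w)) = chart_vec X U \<phi> (orb b) (A (pr w))" if w: "w \<in> B" for w
    by (rule X.velocity_eq_chart_vec[OF U(1) _ cd[OF w]]) (use w pr_C in \<open>auto simp: X_def\<close>)
  have "mmodel X = (\<lambda>w. A (pr w)) ` B"
  proof -
    have "C = pr ` B"
    proof (intro equalityI subsetI)
      fix c assume "c \<in> C"
      then show "c \<in> pr ` B" using pr_id[of c] C_B[of c] by (intro image_eqI[of _ _ c]) simp_all
    qed (use pr_C in auto)
    then show ?thesis by (simp add: X_def image_image)
  qed
  then show ?thesis
    unfolding X.tangent_eq_chart_vec[OF U] using v by (simp add: image_image)
qed

lemma push_X:
  assumes "b \<in> B"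
  shows "push X M (\<lambda>p. p) (orb b) (velocity X (\<lambda>t. orb (b + t *\<^sub>R w))) = \<rho> (- w) (orb b)"
  using push_velocity[OF X_manifold mfd X_inclusion, of "\<lambda>t. orb (b + t *\<^sub>R w)"] assms
    velocity_act[OF x, of b w] by (simp add: pts_X orb_def)

lemma X_immersed: "immersed_submanifold X M"
  unfolding immersed_submanifold_def
proof (intro conjI ballI)
  show "pts X \<subseteq> pts M" using orb_pts by (auto simp: pts_X)
  fix p assume "p \<in> pts X"
  then obtain b where b: "b \<in> B" "p = orb b" by (auto simp: pts_X)
  show "inj_on (push X M (\<lambda>p. p) p) (tangent X p)"
    unfolding b(2) tangent_X[OF b(1)]
  proof (rule inj_onI, elim imageE)
    fix V W v w
    assume VW: "push X M (\<lambda>p. p) (orb b) V = push X M (\<lambda>p. p) (orb b) W"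
      "V = velocity X (\<lambda>t. orb (b + t *\<^sub>R v))" "W = velocity X (\<lambda>t. orb (b + t *\<^sub>R w))"
    then have "\<rho> (- v) (orb b) = \<rho> (- w) (orb b)" by (simp add: push_X[OF b(1)])
    \<comment> \<open>Equal push-forwards put \<open>w - v\<close> into the stabilizer algebra. Then
      the two curves coincide for all times, so their velocities in \<open>X\<close> agree without a
      computation in charts.\<close>
    then have "\<rho> (- v - - w) (orb b) = (\<lambda>f. 0)"
      unfolding infinitesimal_diff[OF orb_pts] by simp
    then have "w - v \<in> stab (orb b)" by (simp add: stab_def)
    then have "w - v \<in> stab x" unfolding orb_def stab_act[OF x] .
    then have "t *\<^sub>R (w - v) \<in> stab x" for t using stab_subspace[OF x] by (simp add: subspace_scale)
    then have "orb (b + t *\<^sub>R v) = orb (b + t *\<^sub>R w)" for t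
      using orb_stab[of "t *\<^sub>R (w - v)" "b + t *\<^sub>R v"] by (simp add: algebra_simps)
    then show "V = W" using VW by simp
  qed
qed (use X_manifold X_inclusion in auto)

lemma sub_tangent_X:
  assumes "b \<in> B"
  shows "sub_tangent X M (orb b) = (\<lambda>w. \<rho> w (orb b)) ` B"
proof -
  have "(\<lambda>w. - w) ` B = B"
  proof (intro equalityI subsetI)
    fix w assume "w \<in> B"
    then show "w \<in> (\<lambda>w. - w) ` B" using B by (intro image_eqI[of _ _ "- w"]) (auto simp: subspace_neg)
  qed (use B in \<open>auto simp: subspace_neg\<close>)
  then have "(\<lambda>w. \<rho> w (orb b)) ` B = (\<lambda>w. \<rho> (- w) (orb b)) ` B"
    by (metis (no_types, lifting) image_cong image_image)
  then show ?thesis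
    unfolding sub_tangent_def tangent_X[OF assms] image_image push_X[OF assms] by simp
qed

lemma tangent_subspace_mfd:
  assumes "b \<in> B"
  shows "tangent (subspace_mfd B) b = (\<lambda>w. velocity (subspace_mfd B) (\<lambda>t. b + t *\<^sub>R w)) ` B"
proof -
  interpret S: smooth_mfd "subspace_mfd B" by (rule smooth_mfd.intro) (rule B_mfd)
  have U: "(B, id) \<in> matlas (subspace_mfd B)" "b \<in> B" using assms by (simp_all add: subspace_mfd_def)
  have "velocity (subspace_mfd B) (\<lambda>t. b + t *\<^sub>R w) = chart_vec (subspace_mfd B) B id b w" if "w \<in> B" for w
  proof (rule S.velocity_eq_chart_vec[OF U(1)])
    have "((\<lambda>t. id (b + t *\<^sub>R w)) has_vector_derivative w) (at 0)"
      by (auto intro!: derivative_eq_intros)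
    then show "chart_deriv B id (\<lambda>t. b + t *\<^sub>R w) w"
      using that assms B by (simp add: chart_deriv_def subspace_add subspace_scale)
  qed (use that in \<open>simp_all add: subspace_mfd_def\<close>)
  moreover have "mmodel (subspace_mfd B) = B" by (simp add: subspace_mfd_def)
  ultimately show ?thesis unfolding S.tangent_eq_chart_vec[OF U] by simp
qed

lemma X_orbit: "orbit_manifold B \<alpha> x X"
  unfolding orbit_manifold_def
proof (intro conjI ballI)
  show "pts X = (\<lambda>b. \<alpha> b x) ` B" by (simp add: pts_X orb_def)
  show "smooth_map (subspace_mfd B) X (\<lambda>b. \<alpha> b x)"
    using orb_smooth by (simp add: orb_def[abs_def])
  fix b assume b: "b \<in> B"
  have "push (subspace_mfd B) X orb b (velocity (subspace_mfd B) (\<lambda>t. b + t *\<^sub>R w))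
      = velocity X (\<lambda>t. orb (b + t *\<^sub>R w))" for w
    using push_velocity[OF B_mfd X_manifold orb_smooth, of "\<lambda>t. b + t *\<^sub>R w"] b by simp
  then have "push (subspace_mfd B) X orb b ` tangent (subspace_mfd B) b = tangent X (orb b)"
    unfolding tangent_subspace_mfd[OF b] tangent_X[OF b] image_image by simp
  then show "push (subspace_mfd B) X (\<lambda>b. \<alpha> b x) b ` tangent (subspace_mfd B) b = tangent X (\<alpha> b x)"
    by (simp add: orb_def[abs_def])
qed (rule X_manifold)

end

section \<open>Existence of the orbit manifold\<close>

context smooth_action
begin

lemma orbit_exists:
  assumes B: "subspace B" and x: "x \<in> pts M"
  obtains X :: "('m, 'e) mfd" where "orbit_manifold B \<alpha> x X" "immersed_submanifold X M"
    "pts X = (\<lambda>b. \<alpha> b x) ` B"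
    "\<forall>b\<in>B. sub_tangent X M (\<alpha> b x) = (\<lambda>w. \<rho> w (\<alpha> b x)) ` B"
proof -
  obtain U \<phi> where U: "(U, \<phi>) \<in> matlas M" "x \<in> U" by (rule chart_exists[OF x])
  obtain A where A: "linear A" "((\<lambda>a. \<phi> (\<alpha> a x)) has_derivative A) (at 0)"
    "\<forall>v. A v \<in> mmodel M" "\<forall>v. \<rho> v x = chart_vec M U \<phi> x (- A v)"
    by (rule orbit_deriv[OF U]) blast
  have A0: "v \<in> stab x \<longleftrightarrow> A v = 0" for v using stab_orbit_deriv[where A = A, OF U] A by blast
  let ?K = "B \<inter> stab x"
  have K: "subspace ?K" using B stab_subspace[OF x] by (rule subspace_inter)
  have spanK: "span ?K = ?K" using K by simp
  \<comment> \<open>The projection onto \<open>?K\<close> arises as a linear left inverse of the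
    identity on \<open>?K\<close>.\<close>
  obtain g where g: "range g \<subseteq> ?K" "linear g" "\<forall>k\<in>?K. g k = k"
    using linear_inj_on_left_inverse[OF linear_id, of ?K] unfolding spanK by auto
  let ?C = "{c \<in> B. g c = 0}"
  have C: "subspace ?C"
    using B g(2) by (auto simp: subspace_def linear_add linear_cmul linear_0)
  have AC: "c = 0" if "c \<in> ?C" "A c = 0" for c
    using that g(3) A0[of c] by auto
  have "inj_on A (span ?C)"
    unfolding span_eq_iff[THEN iffD2, OF C]
  proof (rule inj_onI)
    fix a b assume "a \<in> ?C" "b \<in> ?C" "A a = A b"
    then have "a - b = 0" using subspace_diff[OF C] by (intro AC) (simp_all add: linear_diff[OF A(1)])
    then show "a = b" by simp
  qed
  then obtain A' where A': "linear A'" "\<forall>c\<in>?C. A' (A c) = c"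
    using linear_inj_on_left_inverse[OF A(1), of ?C] unfolding span_eq_iff[THEN iffD2, OF C] by blast
  \<comment> \<open>\<open>m\<close> bounds the injective map \<open>A\<close> from below on the
    complement. Where the linearization error is at most \<open>m / 2 * norm c\<close>, a
    \<open>c\<close> fixing \<open>x\<close> satisfies
    \<open>m * norm c \<le> norm (A c) \<le> m / 2 * norm c\<close>, so \<open>c = 0\<close>. This
    holds for norms below \<open>d\<close>, and \<open>discrete\<close> has the bound
    \<open>2 * r\<close>, hence the radius \<open>d / 2\<close>.\<close>
  obtain m where m: "m > 0" "\<forall>c\<in>?C. norm (A c) \<ge> m * norm c"
    using injective_imp_isometric[OF closed_subspace[OF C] C A(1)[unfolded linear_conv_bounded_linear]] AC
    by blast
  have "\<forall>e>0. \<exists>d>0. \<forall>y. norm (y - 0) < d \<longrightarrow>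
      norm (\<phi> (\<alpha> y x) - \<phi> (\<alpha> 0 x) - A (y - 0)) \<le> e * norm (y - 0)"
    using A(2) unfolding has_derivative_at_alt by blast
  from this[rule_format, of "m / 2"] m(1) obtain d where d: "d > 0"
    "\<forall>y. norm y < d \<longrightarrow> norm (\<phi> (\<alpha> y x) - \<phi> (\<alpha> 0 x) - A y) \<le> m / 2 * norm y" by auto
  have "orbit_setup M \<alpha> B x A A' g (d / 2)"
  proof (rule orbit_setup.intro[OF smooth_action_axioms], rule orbit_setup_axioms.intro)
    show "c = 0" if "c \<in> B" "g c = 0" "norm c < 2 * (d / 2)" "\<alpha> c x = x" for c
    proof -
      have "norm (\<phi> (\<alpha> c x) - \<phi> (\<alpha> 0 x) - A c) \<le> m / 2 * norm c" using d(2)[rule_format, of c] that(3) by simp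
      then have "norm (A c) \<le> m / 2 * norm c" using that act_0[OF x] by simp
      moreover have "m * norm c \<le> norm (A c)" using m that by simp
      ultimately have "m * norm c \<le> 0" by simp
      then show "c = 0" using m(1) by (simp add: mult_le_0_iff)
    qed
  qed (use B x A(1) A' g d(1) in auto)
  then interpret orbit_setup M \<alpha> B x A A' g "d / 2" .
  show thesis
    by (rule that[OF X_orbit X_immersed]) (use sub_tangent_X in \<open>auto simp: pts_X orb_def\<close>)
qed

end

section \<open>Coregular Poisson-Dirac orbits\<close>

text \<open>The definite description in \<open>vsharp\<close> has exactly one solution, namely the
  vector whose coordinates are the values of \<open>P \<xi>\<close> on the dual basis.\<close>

lemma vsharp_apply:
  assumes P: "bivector P"
  shows "blinfun_apply \<eta> (vsharp P \<xi>) = P \<xi> \<eta>"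
proof -
  have bl: "bilinear P" using P by (simp add: bivector_def)
  then have lin: "linear (P \<xi>)" by (simp add: bilinear_def)
  let ?u = "\<Sum>i\<in>Basis. P \<xi> (blinfun_inner_left i) *\<^sub>R i"
  have u: "blinfun_apply \<eta> ?u = P \<xi> \<eta>" for \<eta>
  proof -
    have "P \<xi> \<eta> = P \<xi> (\<Sum>i\<in>Basis. blinfun_apply \<eta> i *\<^sub>R blinfun_inner_left i)"
      using blinfun_expansion[of \<eta>] by simp
    also have "\<dots> = blinfun_apply \<eta> ?u"
      by (simp add: linear_sum[OF lin] linear_cmul[OF lin] blinfun.sum_right blinfun.scaleR_right mult.commute)
    finally show ?thesis by simp
  qed
  have uniq: "w = ?u" if "\<forall>\<eta>. blinfun_apply \<eta> w = P \<xi> \<eta>" for w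
  proof (rule euclidean_eqI)
    fix i :: 'a
    show "w \<bullet> i = ?u \<bullet> i"
      using that[rule_format, of "blinfun_inner_left i"] u[of "blinfun_inner_left i"] by simp
  qed
  have "vsharp P \<xi> = ?u"
    unfolding vsharp_def
  proof (rule the_equality)
    show "\<forall>\<eta>. blinfun_apply \<eta> ?u = P \<xi> \<eta>" using u by (rule allI)
  qed (rule uniq)
  then show ?thesis using u by simp
qed

lemma blinfun_separates:
  fixes u w :: "'a::euclidean_space"
  assumes "\<And>\<eta> :: 'a \<Rightarrow>\<^sub>L real. blinfun_apply \<eta> u = blinfun_apply \<eta> w"
  shows "u = w"
proof (rule euclidean_eqI)
  fix i :: 'a
  show "u \<bullet> i = w \<bullet> i" using assms[of "blinfun_inner_left i"] by simp
qed

lemma vsharp_linear: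
  assumes P: "bivector P"
  shows "linear (vsharp P)"
proof -
  have bl: "bilinear P" using P by (simp add: bivector_def)
  show ?thesis
  proof (rule linearI)
    show "vsharp P (\<xi> + \<zeta>) = vsharp P \<xi> + vsharp P \<zeta>" for \<xi> \<zeta>
      by (rule blinfun_separates) (simp add: vsharp_apply[OF P] blinfun.add_right bilinear_ladd[OF bl])
    show "vsharp P (c *\<^sub>R \<xi>) = c *\<^sub>R vsharp P \<xi>" for c \<xi>
      by (rule blinfun_separates) (simp add: vsharp_apply[OF P] blinfun.scaleR_right bilinear_lmul[OF bl])
  qed
qed

text \<open>Well-definedness: \<open>P \<xi> \<eta>\<close> is \<open>\<eta>\<close> evaluated at
  \<open>vsharp P \<xi>\<close>, so it depends on \<open>\<xi>\<close> only through that vector, and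
  by antisymmetry the same holds for \<open>\<eta>\<close>.\<close>

lemma leaf_form_vsharp:
  assumes P: "bivector P"
  shows "leaf_form P (vsharp P \<xi>) (vsharp P \<eta>) = P \<xi> \<eta>"
  unfolding leaf_form_def
proof (rule the_equality)
  fix c
  assume "\<exists>\<xi>' \<eta>'. vsharp P \<xi> = vsharp P \<xi>' \<and> vsharp P \<eta> = vsharp P \<eta>' \<and> c = P \<xi>' \<eta>'"
  then obtain \<xi>' \<eta>' where e: "vsharp P \<xi> = vsharp P \<xi>'" "vsharp P \<eta> = vsharp P \<eta>'" "c = P \<xi>' \<eta>'" by blast
  have "P \<xi> \<eta> = P \<xi>' \<eta>" using vsharp_apply[OF P, of \<eta> \<xi>] vsharp_apply[OF P, of \<eta> \<xi>'] e(1) by simp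
  also have "\<dots> = - P \<eta> \<xi>'" by (rule bivector_antisym[OF P])
  also have "\<dots> = - P \<eta>' \<xi>'" using vsharp_apply[OF P, of \<xi>' \<eta>] vsharp_apply[OF P, of \<xi>' \<eta>'] e(2) by simp
  also have "\<dots> = c" using bivector_antisym[OF P, of \<eta>' \<xi>'] e(3) by simp
  finally show "c = P \<xi> \<eta>" by simp
qed (intro exI[of _ \<xi>] exI[of _ \<eta>] conjI refl)

text \<open>In the application \<open>W\<close> is \<open>B + stab x\<close>. Writing
  \<open>J u = vsharp P \<eta>\<close> for \<open>u = vsharp P \<xi>\<close> turns the positive
  number attached to a nonzero \<open>u\<close> into \<open>- \<xi> (J u)\<close>, which is 0
  because \<open>J u\<close> lies in \<open>W\<close>.\<close>

lemma positive_bivector_annihilator: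
  assumes P: "positive_bivector J P" and W: "\<And>w. w \<in> W \<Longrightarrow> J w \<in> W"
    and \<xi>: "\<And>w. w \<in> W \<Longrightarrow> blinfun_apply \<xi> w = 0" and u: "vsharp P \<xi> \<in> W"
  shows "vsharp P \<xi> = 0"
proof (rule ccontr)
  assume ne: "vsharp P \<xi> \<noteq> 0"
  have bv: "bivector P" and JS: "J ` range (vsharp P) \<subseteq> range (vsharp P)"
    and pos: "\<forall>u\<in>range (vsharp P). u \<noteq> 0 \<longrightarrow> leaf_form P u (J u) > 0"
    using P by (auto simp: positive_bivector_def Let_def complex_subspace_def)
  have "J (vsharp P \<xi>) \<in> range (vsharp P)" using JS by blast
  then obtain \<eta> where \<eta>: "J (vsharp P \<xi>) = vsharp P \<eta>" by blast
  have "0 < leaf_form P (vsharp P \<xi>) (vsharp P \<eta>)" using bspec[OF pos rangeI[of _ \<xi>]] ne by (simp add: \<eta>)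
  also have "\<dots> = P \<xi> \<eta>" by (rule leaf_form_vsharp[OF bv])
  also have "\<dots> = - P \<eta> \<xi>" by (rule bivector_antisym[OF bv])
  also have "\<dots> = - blinfun_apply \<xi> (J (vsharp P \<xi>))" by (simp add: \<eta> vsharp_apply[OF bv])
  also have "\<dots> = 0" using \<xi>[OF W[OF u]] by simp
  finally show False by simp
qed

section \<open>Conormal spaces along an orbit and the coregularity argument\<close>

context smooth_action
begin

lemma infinitesimal_zero: "x \<in> pts M \<Longrightarrow> \<rho> 0 x = (\<lambda>f. 0)"
  using infinitesimal_scale[of x 0 0] by simp

lemma infinitesimal_sum:
  assumes "x \<in> pts M"
  shows "\<rho> (\<Sum>i\<in>I. c i *\<^sub>R h i) x = (\<lambda>f. \<Sum>i\<in>I. c i * \<rho> (h i) x f)"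
  by (induction I rule: infinite_finite_induct)
    (simp_all add: infinitesimal_zero[OF assms] infinitesimal_add[OF assms] infinitesimal_scale[OF assms])

text \<open>The sharp map of the induced bivector is the transpose of \<open>\<rho>\<close>,
  followed by \<open>vsharp P\<close>, followed by \<open>\<rho>\<close>. That covectors separate
  tangent vectors gives the uniqueness in the definite description.\<close>

lemma sharp_induced:
  assumes P: "bivector P" and x: "x \<in> pts M" and \<xi>: "\<xi> \<in> cotangent M x"
  shows "sharp M (induced_bivector M \<alpha> P) x \<xi> = \<rho> (vsharp P (comoment x \<xi>)) x"
  unfolding sharp_def
proof (rule the_equality)
  let ?X = "\<rho> (vsharp P (comoment x \<xi>)) x"
  have X: "\<eta> ?X = induced_bivector M \<alpha> P x \<xi> \<eta>" if "\<eta> \<in> cotangent M x" for \<eta>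
    unfolding comoment_apply[OF x that, symmetric] vsharp_apply[OF P] induced_bivector_eq ..
  then show "?X \<in> tangent M x \<and> (\<forall>\<eta>\<in>cotangent M x. \<eta> ?X = induced_bivector M \<alpha> P x \<xi> \<eta>)"
    using infinitesimal_tangent[OF x] by blast
  fix Y assume "Y \<in> tangent M x \<and> (\<forall>\<eta>\<in>cotangent M x. \<eta> Y = induced_bivector M \<alpha> P x \<xi> \<eta>)"
  then show "Y = ?X"
    using X infinitesimal_tangent[OF x] by (intro cotangent_separates[OF x]) auto
qed

text \<open>The image of the conormal space at \<open>x\<close> of an orbit of \<open>B\<close> under the transpose of \<open>\<rho>\<close>.\<close>

definition annih :: "'a set \<Rightarrow> 'm \<Rightarrow> ('a \<Rightarrow>\<^sub>L real) set" where
  "annih B x = comoment x ` {\<xi> \<in> cotangent M x. \<forall>w\<in>B. \<xi> (\<rho> w x) = 0}"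

text \<open>Pull-back along \<open>\<alpha> a\<close> carries the vanishing conditions over and does
  not change \<open>comoment\<close>. This lets a single subspace \<open>F\<close> serve at all
  points of the orbit.\<close>

lemma annih_act:
  assumes x: "x \<in> pts M"
  shows "annih B (\<alpha> a x) = annih B x"
proof -
  have sub: "annih B (\<alpha> a y) \<subseteq> annih B y" if y: "y \<in> pts M" for a y
  proof
    fix \<nu> assume "\<nu> \<in> annih B (\<alpha> a y)"
    then obtain \<xi> where \<xi>: "\<nu> = comoment (\<alpha> a y) \<xi>" "\<xi> \<in> cotangent M (\<alpha> a y)"
      "\<forall>w\<in>B. \<xi> (\<rho> w (\<alpha> a y)) = 0" unfolding annih_def by blast
    let ?\<zeta> = "pull M M (\<alpha> a) y \<xi>"
    have "?\<zeta> \<in> cotangent M y" by (rule pull_cotangent[OF mfd mfd act_smooth_right y \<xi>(2)])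
    moreover have "?\<zeta> (\<rho> w y) = \<xi> (\<rho> w (\<alpha> a y))" for w
      by (simp add: pull_def infinitesimal_tangent[OF y] push_infinitesimal[OF y])
    ultimately show "\<nu> \<in> annih B y"
      unfolding annih_def using \<xi> comoment_pull[OF y, of a \<xi>] by (intro image_eqI[of _ _ ?\<zeta>]) auto
  qed
  show ?thesis using sub[OF x, of a] sub[OF act_pts[OF x, of a], of "- a"] act_uminus[OF x, of a] by auto
qed

lemma annih_subspace:
  assumes x: "x \<in> pts M"
  shows "subspace (annih B x)"
proof -
  let ?N = "{\<xi> \<in> cotangent M x. \<forall>w\<in>B. \<xi> (\<rho> w x) = 0}"
  have comb: "a *\<^sub>R \<nu> + b *\<^sub>R \<mu> \<in> annih B x" if lm: "\<nu> \<in> annih B x" "\<mu> \<in> annih B x" for a b \<nu> \<mu>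
  proof -
    obtain \<xi> where \<xi>: "\<nu> = comoment x \<xi>" "\<xi> \<in> cotangent M x" "\<forall>w\<in>B. \<xi> (\<rho> w x) = 0"
      using lm(1) unfolding annih_def by blast
    obtain \<eta> where \<eta>: "\<mu> = comoment x \<eta>" "\<eta> \<in> cotangent M x" "\<forall>w\<in>B. \<eta> (\<rho> w x) = 0"
      using lm(2) unfolding annih_def by blast
    show ?thesis
      unfolding annih_def \<xi>(1) \<eta>(1) comoment_lincomb[OF x \<xi>(2) \<eta>(2), symmetric]
      using \<xi> \<eta> cotangent_lincomb[OF \<xi>(2) \<eta>(2)] by (intro imageI) simp
  qed
  have "(\<lambda>X. 0) \<in> ?N" by (simp add: cotangent_def)
  then have ne: "comoment x (\<lambda>X. 0) \<in> annih B x" unfolding annih_def by (rule imageI)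
  show ?thesis
    unfolding subspace_def
    using comb[OF ne ne, of 0 0] comb[of _ _ 1 1] comb[of _ _ _ 0] by auto
qed

text \<open>Adding an element of \<open>stab x\<close> does not change \<open>\<rho> w x\<close>, so
  vanishing on \<open>B\<close> extends to \<open>B + stab x\<close>. The positivity argument uses
  exactly this inclusion of \<open>annih B x\<close> in the annihilator of
  \<open>B + stab x\<close>.\<close>

lemma annih_vanishes:
  assumes x: "x \<in> pts M" and "\<nu> \<in> annih B x" "w \<in> B" "k \<in> stab x"
  shows "blinfun_apply \<nu> (w + k) = 0"
proof -
  obtain \<xi> where \<xi>: "\<nu> = comoment x \<xi>" "\<xi> \<in> cotangent M x" "\<forall>w\<in>B. \<xi> (\<rho> w x) = 0"
    using assms(2) unfolding annih_def by blast
  have "\<rho> (w + k) x = \<rho> w x" using assms(4) infinitesimal_add[OF x] by (simp add: stab_def)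
  then show ?thesis unfolding \<xi>(1) comoment_apply[OF x \<xi>(2)] using \<xi>(3) assms(3) by simp
qed

lemma coregular_orbit:
  fixes X :: "('m, 'f::euclidean_space) mfd"
  assumes P: "positive_bivector J P" and J: "linear J" and B: "complex_subspace J B"
    and x: "x \<in> pts M" and stab_J: "\<And>v. v \<in> stab x \<Longrightarrow> J v \<in> stab x"
    and X: "immersed_submanifold X M" "pts X = (\<lambda>b. \<alpha> b x) ` B"
      "\<forall>b\<in>B. sub_tangent X M (\<alpha> b x) = (\<lambda>w. \<rho> w (\<alpha> b x)) ` B"
  shows "coregular_poisson_dirac M (induced_bivector M \<alpha> P) X"
proof -
  have bv: "bivector P" using P by (simp add: positive_bivector_def)
  have Bsub: "subspace B" and BJ: "\<And>w. w \<in> B \<Longrightarrow> J w \<in> B"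
    using B by (auto simp: complex_subspace_def)
  have Xm: "smooth_manifold X" "smooth_map X M (\<lambda>p. p)" "pts X \<subseteq> pts M"
    using X(1) by (auto simp: immersed_submanifold_def)
  define F where "F = vsharp P ` annih B x"
  have Fsub: "subspace F"
    unfolding F_def by (rule linear_subspace_image[OF vsharp_linear[OF bv] annih_subspace[OF x]])
  \<comment> \<open>Used twice: with \<open>w = 0\<close> for the independence of the frame, and
    with \<open>w\<close> giving a vector tangent to the orbit for the trivial intersection.\<close>
  have F0: "u = 0" if u: "u \<in> F" "w \<in> B" "k \<in> stab x" "u = w + k" for u w k
  proof -
    let ?W = "{w + k | w k. w \<in> B \<and> k \<in> stab x}"
    obtain \<nu> where \<nu>: "\<nu> \<in> annih B x" "u = vsharp P \<nu>" using u(1) unfolding F_def by blast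
    have "vsharp P \<nu> = 0"
    proof (rule positive_bivector_annihilator[OF P, of ?W])
      fix w assume "w \<in> ?W"
      then obtain a b where ab: "w = a + b" "a \<in> B" "b \<in> stab x" by blast
      then show "J w \<in> ?W" using BJ stab_J linear_add[OF J] by blast
      show "blinfun_apply \<nu> w = 0" unfolding ab(1) by (rule annih_vanishes[OF x \<nu>(1) ab(2,3)])
    next
      show "vsharp P \<nu> \<in> ?W" unfolding \<nu>(2)[symmetric] using u(2-4) by blast
    qed
    then show ?thesis using \<nu> by simp
  qed
  have E: "sharp M (induced_bivector M \<alpha> P) q ` conormal X M q = (\<lambda>u. \<rho> u q) ` F"
    and T: "sub_tangent X M q = (\<lambda>w. \<rho> w q) ` B" and st: "stab q = stab x" if q: "q \<in> pts X" for q
  proof -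
    obtain b where b: "b \<in> B" "q = \<alpha> b x" using q X(2) by blast
    have qM: "q \<in> pts M" using b act_pts[OF x] by simp
    show T: "sub_tangent X M q = (\<lambda>w. \<rho> w q) ` B" using X(3) b by blast
    show "stab q = stab x" using b stab_act[OF x] by simp
    have con: "conormal X M q = {\<xi> \<in> cotangent M q. \<forall>w\<in>B. \<xi> (\<rho> w q) = 0}"
      unfolding conormal_def T by blast
    have "sharp M (induced_bivector M \<alpha> P) q ` conormal X M q
        = (\<lambda>\<xi>. \<rho> (vsharp P (comoment q \<xi>)) q) ` {\<xi> \<in> cotangent M q. \<forall>w\<in>B. \<xi> (\<rho> w q) = 0}"
      unfolding con by (rule image_cong[OF refl]) (simp add: sharp_induced[OF bv qM])
    also have "\<dots> = (\<lambda>u. \<rho> u q) ` vsharp P ` annih B q"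
      unfolding annih_def image_image ..
    also have "annih B q = annih B x" using b annih_act[OF x] by simp
    finally show "sharp M (induced_bivector M \<alpha> P) q ` conormal X M q = (\<lambda>u. \<rho> u q) ` F"
      unfolding F_def .
  qed
  \<comment> \<open>Every fibre is the image of the same \<open>F\<close>, so one basis of
    \<open>F\<close> yields vector fields that form a frame over the whole orbit.\<close>
  obtain S where S: "S \<subseteq> F" "independent S" "F \<subseteq> span S" "card S = dim F" by (rule basis_exists)
  have spanS: "span S = F" by (rule subset_antisym[OF span_minimal[OF S(1) Fsub] S(3)])
  have finS: "finite S" using S(2) by (rule independent_imp_finite)
  obtain h where h: "bij_betw h {0..<card S} S" using ex_bij_betw_nat_finite[OF finS] by (rule exE)
  define k where "k = card S"
  have hk: "bij_betw h {..<k} S" using h by (simp add: k_def atLeast0LessThan)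
  have hS: "(\<Sum>i<k. (c (h i)) *\<^sub>R h i) = (\<Sum>v\<in>S. c v *\<^sub>R v)" for c
    by (rule sum.reindex_bij_betw[OF hk])
  \<comment> \<open>Independence of \<open>S\<close> concerns coefficients indexed by vectors;
    frames are indexed by numbers below \<open>k\<close>, and this translates between the
    two.\<close>
  have hinv: "\<exists>c'. \<forall>i<k. c' (h i) = c i" for c :: "nat \<Rightarrow> real"
    using bij_betw_imp_inj_on[OF hk] by (intro exI[of _ "\<lambda>v. c (inv_into {..<k} h v)"]) simp
  have sumF: "(\<Sum>i<k. c i *\<^sub>R h i) \<in> F" for c
    using bij_betwE[OF hk] S(1) by (intro subspace_sum[OF Fsub] subspace_scale[OF Fsub]) auto
  have frame: "(\<lambda>u. \<rho> u q) ` F = {(\<lambda>f. \<Sum>i<k. c i * \<rho> (h i) q f) | c. True}" if q: "q \<in> pts M" for q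
  proof (intro equalityI subsetI)
    fix Y assume "Y \<in> (\<lambda>u. \<rho> u q) ` F"
    then obtain u where u: "Y = \<rho> u q" "u \<in> F" by (rule imageE)
    have "u \<in> span S" using u spanS by simp
    then obtain c where c: "u = (\<Sum>v\<in>S. c v *\<^sub>R v)" unfolding span_finite[OF finS] by (rule rangeE)
    have "Y = (\<lambda>f. \<Sum>i<k. c (h i) * \<rho> (h i) q f)"
      unfolding u(1) c hS[symmetric] by (rule infinitesimal_sum[OF q])
    then show "Y \<in> {(\<lambda>f. \<Sum>i<k. c i * \<rho> (h i) q f) | c. True}"
      by (intro CollectI exI conjI TrueI)
  next
    fix Y assume "Y \<in> {(\<lambda>f. \<Sum>i<k. c i * \<rho> (h i) q f) | c. True}"
    then obtain c where "Y = (\<lambda>f. \<Sum>i<k. c i * \<rho> (h i) q f)" by (elim CollectE exE conjE)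
    then have "Y = \<rho> (\<Sum>i<k. c i *\<^sub>R h i) q" using infinitesimal_sum[OF q, of c h "{..<k}"] by simp
    then show "Y \<in> (\<lambda>u. \<rho> u q) ` F" by (simp only:) (rule imageI[OF sumF])
  qed
  have indep: "\<forall>i<k. c i = 0"
    if q: "q \<in> pts X" and z: "(\<lambda>f. \<Sum>i<k. c i * \<rho> (h i) q f) = (\<lambda>f. 0)" for q c
  proof -
    have qM: "q \<in> pts M" using q Xm by blast
    let ?u = "\<Sum>i<k. c i *\<^sub>R h i"
    have "\<rho> ?u q = (\<lambda>f. 0)" using infinitesimal_sum[OF qM, of c h "{..<k}"] z by simp
    then have "?u \<in> stab x" using st[OF q] by (auto simp: stab_def)
    then have u0: "?u = 0" using F0[OF sumF, of 0] subspace_0[OF Bsub] by simp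
    obtain c' where c': "\<forall>i<k. c' (h i) = c i" using hinv[of c] by (rule exE)
    have "(\<Sum>v\<in>S. c' v *\<^sub>R v) = ?u" unfolding hS[symmetric] using c' by (intro sum.cong) auto
    then have "c' v = 0" if "v \<in> S" for v
      using independentD[OF S(2) finS order_refl _ that] u0 by simp
    then show ?thesis using c' bij_betwE[OF hk] by simp
  qed
  have sect: "smooth_section_along X M (pts X) (\<lambda>q. \<rho> v q)" for v
    unfolding smooth_section_along_def
  proof (intro conjI ballI allI impI)
    show "\<rho> v q \<in> tangent M q" if "q \<in> pts X" for q using that Xm by (intro infinitesimal_tangent) blast
    fix V f assume "smooth_fun M V f"
    from smooth_fun_compose[OF Xm(1) mfd Xm(2) infinitesimal_smooth[OF this, of v]]
    show "smooth_fun X (pts X \<inter> V) (\<lambda>q. \<rho> v q f)" by (simp add: comp_def)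
  qed
  have "vector_subbundle_along X M (\<lambda>p. sharp M (induced_bivector M \<alpha> P) p ` conormal X M p)"
    unfolding vector_subbundle_along_def
  proof (intro ballI exI conjI)
    show "openin (mtop X) (pts X)" by simp
    show "\<forall>i<k. smooth_section_along X M (pts X) (\<lambda>q. \<rho> (h i) q)" by (simp add: sect)
    fix q assume q: "q \<in> pts X"
    show "sharp M (induced_bivector M \<alpha> P) q ` conormal X M q
        = {(\<lambda>f. \<Sum>i<k. c i * \<rho> (h i) q f) | c. True}"
      unfolding E[OF q] by (rule frame) (use q Xm in blast)
    show "\<forall>c. (\<lambda>f. \<Sum>i<k. c i * \<rho> (h i) q f) = (\<lambda>f. 0) \<longrightarrow> (\<forall>i<k. c i = 0)"
      by (intro allI impI) (rule indep[OF q, rule_format])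
  qed
  moreover have "sharp M (induced_bivector M \<alpha> P) q ` conormal X M q \<inter> sub_tangent X M q = {\<lambda>f. 0}"
    if q: "q \<in> pts X" for q
  proof (intro equalityI subsetI)
    have qM: "q \<in> pts M" using q Xm by blast
    fix Y assume "Y \<in> sharp M (induced_bivector M \<alpha> P) q ` conormal X M q \<inter> sub_tangent X M q"
    then have "Y \<in> (\<lambda>u. \<rho> u q) ` F" "Y \<in> (\<lambda>w. \<rho> w q) ` B" unfolding E[OF q] T[OF q] by blast+
    then obtain u w where uw: "u \<in> F" "w \<in> B" "Y = \<rho> u q" "Y = \<rho> w q" by blast
    have "\<rho> (u - w) q = (\<lambda>f. 0)" using infinitesimal_diff[OF qM, of u w] uw(3,4) by simp
    then have "u - w \<in> stab x" using st[OF q] by (auto simp: stab_def)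
    then have "u = 0" using F0[OF uw(1,2), of "u - w"] by simp
    then show "Y \<in> {\<lambda>f. 0}" using uw(3) infinitesimal_zero[OF qM] by simp
  next
    have qM: "q \<in> pts M" using q Xm by blast
    fix Y :: "'m tvec" assume "Y \<in> {\<lambda>f. 0}"
    then have "Y = \<rho> 0 q" using infinitesimal_zero[OF qM] by simp
    then show "Y \<in> sharp M (induced_bivector M \<alpha> P) q ` conormal X M q \<inter> sub_tangent X M q"
      unfolding E[OF q] T[OF q] using subspace_0[OF Fsub] subspace_0[OF Bsub] by blast
  qed
  ultimately show ?thesis unfolding coregular_poisson_dirac_def using X(1) by blast
qed

text \<open>The derivative of the orbit map satisfies \<open>A (J v) = JM (A v)\<close>, so its
  kernel, which is \<open>stab x\<close>, is invariant under \<open>J\<close>.\<close>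

lemma stab_complex:
  assumes JM: "linear JM" and hol: "holomorphic_action J M JM \<alpha>" and x: "x \<in> pts M" and v: "v \<in> stab x"
  shows "J v \<in> stab x"
proof -
  obtain U \<phi> where U: "(U, \<phi>) \<in> matlas M" "x \<in> U" by (rule chart_exists[OF x])
  obtain A where A: "\<forall>v. A v \<in> mmodel M" "\<forall>v. chart_deriv U \<phi> (\<lambda>t. \<alpha> (t *\<^sub>R v) x) (A v)"
    "\<forall>v. \<rho> v x = chart_vec M U \<phi> x (- A v)"
    by (rule orbit_deriv[OF U]) blast
  have A0: "v \<in> stab x \<longleftrightarrow> A v = 0" for v using stab_orbit_deriv[where A = A, OF U] A by blast
  let ?P = "prod_mfd (subspace_mfd (UNIV :: 'a set)) M"
  let ?act = "\<lambda>(a, x). \<alpha> a x"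
  let ?\<kappa> = "map_prod id \<phi> :: 'a \<times> 'm \<Rightarrow> 'a \<times> 'e"
  let ?S = "?\<kappa> ` (UNIV \<times> U \<inter> ?act -` U)"
  let ?f = "\<phi> \<circ> ?act \<circ> inv_into (UNIV \<times> U) ?\<kappa>"
  have chartP: "(UNIV \<times> U, ?\<kappa>) \<in> matlas ?P"
    using U by (auto simp: prod_mfd_def subspace_mfd_def)
  have "\<forall>(W, \<kappa>)\<in>matlas ?P. \<forall>(V, \<psi>)\<in>matlas M. complex_differentiable_on (mmodel ?P) (map_prod J JM) JM
      (\<kappa> ` (W \<inter> ?act -` V)) (\<psi> \<circ> ?act \<circ> inv_into W \<kappa>)"
    using hol by (simp add: holomorphic_action_def holomorphic_map_def)
  from bspec[OF this chartP] have "\<forall>(V, \<psi>)\<in>matlas M. complex_differentiable_on (mmodel ?P) (map_prod J JM) JM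
      (?\<kappa> ` (UNIV \<times> U \<inter> ?act -` V)) (\<psi> \<circ> ?act \<circ> inv_into (UNIV \<times> U) ?\<kappa>)" by (simp only: prod.case)
  from bspec[OF this U(1)] have cd: "complex_differentiable_on (mmodel ?P) (map_prod J JM) JM ?S ?f"
    by (simp only: prod.case)
  have "(0, \<phi> x) \<in> ?S" using U act_0[OF x] by (intro image_eqI[of _ _ "(0, x)"]) auto
  from bspec[OF cd[unfolded complex_differentiable_on_def] this]
  obtain D where D: "(?f has_derivative D) (at (0, \<phi> x) within ?S)"
    "\<forall>w\<in>mmodel ?P. D (map_prod J JM w) = JM (D w)"
    by (elim exE conjE)
  \<comment> \<open>\<open>D\<close> is a derivative within a set that may be too thin to determine
    it in all directions. In direction \<open>(w, 0)\<close> it is determined, because the curve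
    \<open>(t w, \<phi> x)\<close> stays in the set for small times.\<close>
  have DA: "D (w, 0) = A w" for w
  proof -
    let ?T = "{t. \<alpha> (t *\<^sub>R w) x \<in> U}"
    let ?c = "\<lambda>t. (t *\<^sub>R w, \<phi> x)"
    have "continuous_on UNIV (\<lambda>t. t *\<^sub>R w)" by (intro continuous_intros)
    from open_vimage[OF act_vimage_open[OF x chart_openin[OF U(1)]] this]
    have T: "open ?T" by (simp add: vimage_def)
    have T0: "0 \<in> ?T" using U act_0[OF x] by simp
    have l: "(?c has_derivative (\<lambda>t. t *\<^sub>R (w, 0))) (at 0 within ?T)"
      by (auto intro!: derivative_eq_intros)
    have "?c ` ?T \<subseteq> ?S"
    proof (rule image_subsetI)
      fix t assume "t \<in> ?T"
      then show "?c t \<in> ?S" using U by (intro image_eqI[of _ _ "(t *\<^sub>R w, x)"]) auto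
    qed
    then have "(?f has_derivative D) (at (?c 0) within ?c ` ?T)"
      using has_derivative_subset[OF D(1)] by simp
    from has_derivative_in_compose[OF l this]
    have "((\<lambda>t. ?f (?c t)) has_derivative (\<lambda>t. D (t *\<^sub>R (w, 0)))) (at 0)"
      using at_within_open[OF T0 T] by simp
    moreover have "?f (?c t) = \<phi> (\<alpha> (t *\<^sub>R w) x)" for t
    proof -
      have "inv_into (UNIV \<times> U) ?\<kappa> (id (t *\<^sub>R w), \<phi> x) = (inv_into UNIV id (id (t *\<^sub>R w)), inv_into U \<phi> (\<phi> x))"
        using U chart_inj[OF U(1)] by (intro inv_into_map_prod) auto
      moreover have "inv_into UNIV id (id (t *\<^sub>R w)) = t *\<^sub>R w"
        by (simp only: inv_into_f_f inj_on_id UNIV_I)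
      ultimately show ?thesis using U by simp
    qed
    ultimately have "((\<lambda>t. \<phi> (\<alpha> (t *\<^sub>R w) x)) has_vector_derivative D (w, 0)) (at 0)"
      unfolding has_vector_derivative_def linear_cmul[OF has_derivative_linear[OF D(1)]] by simp
    moreover have "((\<lambda>t. \<phi> (\<alpha> (t *\<^sub>R w) x)) has_vector_derivative A w) (at 0)"
      using A(2) by (simp add: chart_deriv_def)
    ultimately show ?thesis by (rule vector_derivative_unique_at)
  qed
  have "(v, 0) \<in> mmodel ?P" using model by (simp add: prod_mfd_def subspace_mfd_def subspace_0)
  from bspec[OF D(2) this] have "D (map_prod J JM (v, 0)) = JM (D (v, 0))" .
  then have "A (J v) = JM (A v)" by (simp add: linear_0[OF JM] DA)
  then show ?thesis using A0 v linear_0[OF JM] by simp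
qed

end

theorem lemma4p5:
  fixes J :: "'a::euclidean_space \<Rightarrow> 'a"
    and \<pi>A :: "'a \<Rightarrow>\<^sub>L real \<Rightarrow> 'a \<Rightarrow>\<^sub>L real \<Rightarrow> real"
    and M :: "('m, 'e::euclidean_space) mfd"
    and JM :: "'e \<Rightarrow> 'e"
    and \<alpha> :: "'a \<Rightarrow> 'm \<Rightarrow> 'm"
  assumes "complex_structure UNIV J"
    and "positive_bivector J \<pi>A"
    and "complex_manifold M JM"
    and "holomorphic_action J M JM \<alpha>"
  defines "\<pi>M \<equiv> induced_bivector M \<alpha> \<pi>A"
  shows "poisson_structure M \<pi>M \<and> invariant_bivector M \<alpha> \<pi>M \<and>
    (\<forall>B. complex_subspace J B \<longrightarrow>
       poisson_action B zero_bivector M \<pi>M \<alpha> \<and>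
       (\<forall>x\<in>pts M. \<exists>X :: ('m, 'e) mfd. orbit_manifold B \<alpha> x X \<and> coregular_poisson_dirac M \<pi>M X))"
proof -
  have J: "linear J" and JM: "linear JM"
    using assms(1,3) by (auto simp: complex_structure_def complex_manifold_def)
  have P: "bivector \<pi>A" using assms(2) by (simp add: positive_bivector_def)
  interpret smooth_action M \<alpha>
    by unfold_locales
      (use assms(3,4) in \<open>auto simp: complex_manifold_def holomorphic_action_def holomorphic_map_def\<close>)
  have "\<exists>X :: ('m, 'e) mfd. orbit_manifold B \<alpha> x X \<and> coregular_poisson_dirac M \<pi>M X"
    if B: "complex_subspace J B" and x: "x \<in> pts M" for B x
  proof -
    have "subspace B" using B by (simp add: complex_subspace_def)
    then obtain X :: "('m, 'e) mfd" where X: "orbit_manifold B \<alpha> x X" "immersed_submanifold X M"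
      "pts X = (\<lambda>b. \<alpha> b x) ` B" "\<forall>b\<in>B. sub_tangent X M (\<alpha> b x) = (\<lambda>w. \<rho> w (\<alpha> b x)) ` B"
      using x by (rule orbit_exists)
    have "coregular_poisson_dirac M \<pi>M X"
      unfolding \<pi>M_def
      by (rule coregular_orbit[OF assms(2) J B x stab_complex[OF JM assms(4) x] X(2-4)])
    with X(1) show ?thesis by blast
  qed
  then show ?thesis
    using poisson_structure_induced[OF P] invariant_induced poisson_action_induced
    by (auto simp: \<pi>M_def complex_subspace_def)
qed

end
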